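(* Assume: (A1) the solution set $S_1$ of the variational inequality is nonempty; (A3) $F$ has a stochastic oracle $F_\xi$ that is variable $\bar L$-Lipschitz in mean; (A4) $\|F(x)-F(y)\|_*\le L\|x-y\|$ for all $x,y\in K$; (A7) for some $\beta>0$, for all $x\in\mathrm{dom} f$ and $y\in\mathrm{dom}(\partial f)$, $$\langle F(x),y-x\rangle+g(y)-g(x)\ge0\ \Longrightarrow\ \langle F(y),y-x\rangle+g(y)-g(x)\ge\beta D(x,y).$$ Let $\{x_s\}$ be generated by the algorithm with $0<p<1$, $p<\gamma<1$, $\alpha\le\frac{\gamma-p}{1-p}$ and $$\frac{\frac12+\gamma}{\beta}<\alpha<\frac{\sqrt{b^2L^4+8b\bar L^2\left(\frac{1-\gamma}{1-p}\right)}-bL^2}{4\bar L^2},$$ and let $x'\in S_1$. Then $$\mathbb E\left[\|x'-x_s\|\right]\le\sqrt{\frac{4}{(1+\gamma-\alpha)\,\theta^s}D(x',x_0)},$$ where $$1<\theta\le\min\left\{\frac{\frac12+\alpha\beta+\frac\alpha2}{1+\gamma+\frac\alpha2},\ \frac{\frac{1-\gamma}{1-p}+2\alpha L^2}{\frac{2\alpha^2\bar L^2}{b}+3\alpha L^2},\ \frac1{1-\gamma}\right\}.$$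
   Context: Setting. $\mathcal X$ is a finite-dimensional space with inner product $\langle\cdot,\cdot\rangle$ and a norm $\|\cdot\|$ with dual norm $\|\cdot\|_*$. $K\subset\mathcal X$ is nonempty, closed and convex; $g:K\to(-\infty,+\infty]$ is proper, convex, lower semicontinuous; $F:\mathrm{dom}\,g\to\mathcal X$ is an operator of the form $F=\frac1M\sum_{i=1}^M F_i$. The variational inequality is: find $x^*\in K$ with $\langle F(x^* ),y-x^*\rangle+g(y)-g(x^* )\ge 0$ for all $y\in K$; $S_1$ is its solution set. Bregman distance. $f:K\to(-\infty,+\infty]$ is proper, convex, lower semicontinuous, $\mathrm{dom}\,g\subset\mathrm{dom}\,f$, $f$ is differentiable on $\mathrm{dom}(\partial f)=\{x\in\mathrm{dom} f:\partial f(x)\ne\emptyset\}$ and 1-strongly convex: $f(x)\ge f(y)+\langle\nabla f(y),x-y\rangle+\frac12\|x-y\|^2$ for $x\in\mathrm{dom} f$, $y\in\mathrm{dom}(\partial f)$. $D(x,y)=f(x)-f(y)-\langle\nabla f(y),x-y\rangle$ for $x\in\mathrm{dom}\,g$, $y\in\mathrm{dom}(\partial f)$. Stochastic oracle. $F$ has a stochastic oracle $F_\xi$ that is variable $\bar L$-Lipschitz in mean if for any $x,y\in\mathrm{dom}\,g$ there is a distribution $Q_{x,y}$ of $\xi$ such that (i) $F(z)=\mathbb E_{\xi\sim Q_{x,y}}[F_\xi(z)]$ for all $z\in\mathrm{dom}\,g$; (ii) $\mathbb E_{\xi\sim Q_{x,y}}[\|F_\xi(x)-F_\xi(y)\|_*^2]\le\bar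 L^2\|x-y\|^2$. Algorithm. Parameters: $0<\gamma\le1$, $0<p\le1$, stepsize $\alpha>0$, batch size $b\in\{1,\dots,M\}$. Start with $x_0=x_{-1}=w_0=w_{-1}\in K$. For $s=0,1,2,\dots$: draw $\xi^s_1,\dots,\xi^s_b\in\{1,\dots,M\}$ independently from $Q_{x_s,w_{s-1}}$ and set $B^s=\{\xi_1^s,\dots,\xi_b^s\}$ (with multiplicity); set $\bar x_s=(\nabla f)^{-1}\big(\gamma\nabla f(x_s)+(1-\gamma)\nabla f(x_{s-1})\big)$; $\Delta^s=\frac1b\sum_{\xi\in B^s}\big(F(w_s)+F_\xi(x_s)-F_\xi(w_{s-1})\big)$; $x_{s+1}=\arg\min_{x\in K}\{\alpha g(x)+\langle\alpha\Delta^s,x\rangle+D(x,\bar x_s)\}$; and let $w_{s+1}=x_{s+1}$ with probability $p$ and $w_{s+1}=x_s$ with probability $1-p$ (fresh independent coin). All iterates are assumed well defined, i.e. the points used as second arguments of $D$ lie in $\mathrm{dom}(\partial f)$. *)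

theory Defs
  imports "HOL-Probability.Probability"
begin

definition is_norm :: "('a::euclidean_space \<Rightarrow> real) \<Rightarrow> bool" where
  "is_norm N \<longleftrightarrow>
     (\<forall>x. 0 \<le> N x) \<and> (\<forall>x. N x = 0 \<longleftrightarrow> x = 0) \<and>
     (\<forall>c x. N (c *\<^sub>R x) = \<bar>c\<bar> * N x) \<and> (\<forall>x y. N (x + y) \<le> N x + N y)"

definition dual_norm :: "('a::euclidean_space \<Rightarrow> real) \<Rightarrow> 'a \<Rightarrow> real" where
  "dual_norm N y = (SUP x\<in>{x. N x \<le> 1}. y \<bullet> x)"

(* A function K \<rightarrow> (-\<infinity>, +\<infinity>] is represented by a total ereal-valued function of which only
   the values on K are ever used. *)

definition eff_dom :: "'a set \<Rightarrow> ('a \<Rightarrow> ereal) \<Rightarrow> 'a set" where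
  "eff_dom K h = {x \<in> K. h x < \<infinity>}"

definition proper_on :: "'a set \<Rightarrow> ('a \<Rightarrow> ereal) \<Rightarrow> bool" where
  "proper_on K h \<longleftrightarrow> (\<forall>x\<in>K. h x \<noteq> -\<infinity>) \<and> (\<exists>x\<in>K. h x < \<infinity>)"

(* The library's convex_on is for real-valued functions only. The endpoints t = 0, 1 are
   unproblematic because 0 * \<infinity> = 0 in ereal. *)
definition ereal_convex_on :: "'a::real_vector set \<Rightarrow> ('a \<Rightarrow> ereal) \<Rightarrow> bool" where
  "ereal_convex_on K h \<longleftrightarrow>
     (\<forall>x\<in>K. \<forall>y\<in>K. \<forall>t::real. 0 \<le> t \<longrightarrow> t \<le> 1 \<longrightarrow>
        h ((1 - t) *\<^sub>R x + t *\<^sub>R y) \<le> ereal (1 - t) * h x + ereal t * h y)"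

definition lsc_on :: "'a::topological_space set \<Rightarrow> ('a \<Rightarrow> ereal) \<Rightarrow> bool" where
  "lsc_on K h \<longleftrightarrow> (\<forall>x\<in>K. h x \<le> Liminf (at x within K) h)"

definition subdiff :: "'a::euclidean_space set \<Rightarrow> ('a \<Rightarrow> ereal) \<Rightarrow> 'a \<Rightarrow> 'a set" where
  "subdiff K h x = {v. \<forall>y\<in>K. h x + ereal (v \<bullet> (y - x)) \<le> h y}"

definition dom_subdiff :: "'a::euclidean_space set \<Rightarrow> ('a \<Rightarrow> ereal) \<Rightarrow> 'a set" where
  "dom_subdiff K h = {x \<in> eff_dom K h. subdiff K h x \<noteq> {}}"

(* f is only defined on K, so differentiability is relative to dom f (which may have empty
   interior) and the gradient map is part of the data. At interior points of dom f it is the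
   usual gradient. *)
definition has_gradient_map ::
    "'a::euclidean_space set \<Rightarrow> ('a \<Rightarrow> ereal) \<Rightarrow> ('a \<Rightarrow> 'a) \<Rightarrow> bool" where
  "has_gradient_map K f gradf \<longleftrightarrow>
     (\<forall>x\<in>dom_subdiff K f.
        ((\<lambda>z. real_of_ereal (f z)) has_derivative (\<lambda>h. gradf x \<bullet> h)) (at x within eff_dom K f))"

definition strongly_convex1 ::
    "('a::euclidean_space \<Rightarrow> real) \<Rightarrow> 'a set \<Rightarrow> ('a \<Rightarrow> ereal) \<Rightarrow> ('a \<Rightarrow> 'a) \<Rightarrow> bool" where
  "strongly_convex1 N K f gradf \<longleftrightarrow>
     (\<forall>x\<in>eff_dom K f. \<forall>y\<in>dom_subdiff K f.
        f x \<ge> f y + ereal (gradf y \<bullet> (x - y)) + ereal ((1/2) * (N (x - y))\<^sup>2))"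

definition bregman ::
    "('a::euclidean_space \<Rightarrow> ereal) \<Rightarrow> ('a \<Rightarrow> 'a) \<Rightarrow> 'a \<Rightarrow> 'a \<Rightarrow> real" where
  "bregman f gradf x y = real_of_ereal (f x) - real_of_ereal (f y) - gradf y \<bullet> (x - y)"

(* If g x = \<infinity> then x is not a solution: testing with y in dom g gives -\<infinity> \<ge> 0. *)
definition vi_solutions ::
    "'a::euclidean_space set \<Rightarrow> ('a \<Rightarrow> ereal) \<Rightarrow> ('a \<Rightarrow> 'a) \<Rightarrow> 'a set" where
  "vi_solutions K g F = {x \<in> K. \<forall>y\<in>K. ereal (F x \<bullet> (y - x)) + g y - g x \<ge> 0}"

definition variable_lipschitz_oracle ::
    "('a::euclidean_space \<Rightarrow> real) \<Rightarrow> 'a set \<Rightarrow> ('a \<Rightarrow> 'a) \<Rightarrow> nat \<Rightarrow> (nat \<Rightarrow> 'a \<Rightarrow> 'a) \<Rightarrow>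
     ('a \<Rightarrow> 'a \<Rightarrow> nat pmf) \<Rightarrow> real \<Rightarrow> bool" where
  "variable_lipschitz_oracle N G F M F\<xi> Q Lbar \<longleftrightarrow>
     (\<forall>x\<in>G. \<forall>y\<in>G.
        set_pmf (Q x y) \<subseteq> {1..M} \<and>
        (\<forall>z\<in>G. F z = measure_pmf.expectation (Q x y) (\<lambda>\<xi>. F\<xi> \<xi> z)) \<and>
        measure_pmf.expectation (Q x y) (\<lambda>\<xi>. (dual_norm N (F\<xi> \<xi> x - F\<xi> \<xi> y))\<^sup>2)
          \<le> Lbar\<^sup>2 * (N (x - y))\<^sup>2)"

(* States of the algorithm are (x_s, x_{s-1}, w_s, w_{s-1}). *)
type_synonym 'a alg_state = "'a \<times> 'a \<times> 'a \<times> 'a"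

definition mirror_mean :: "('a::euclidean_space \<Rightarrow> 'a) \<Rightarrow> real \<Rightarrow> 'a \<Rightarrow> 'a \<Rightarrow> 'a" where
  "mirror_mean gradf \<gamma> x xp = \<gamma> *\<^sub>R gradf x + (1 - \<gamma>) *\<^sub>R gradf xp"

definition xbar ::
    "'a::euclidean_space set \<Rightarrow> ('a \<Rightarrow> ereal) \<Rightarrow> ('a \<Rightarrow> 'a) \<Rightarrow> real \<Rightarrow> 'a \<Rightarrow> 'a \<Rightarrow> 'a" where
  "xbar K f gradf \<gamma> x xp = inv_into (dom_subdiff K f) gradf (mirror_mean gradf \<gamma> x xp)"

(* The batch B is a list, so indices count with multiplicity. *)
definition batch_estimate ::
    "('a::euclidean_space \<Rightarrow> 'a) \<Rightarrow> (nat \<Rightarrow> 'a \<Rightarrow> 'a) \<Rightarrow> nat \<Rightarrow> 'a alg_state \<Rightarrow> nat list \<Rightarrow> 'a" where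
  "batch_estimate F F\<xi> b = (\<lambda>(x, xp, w, wp) B.
     (1 / real b) *\<^sub>R (\<Sum>\<xi>\<leftarrow>B. F w + F\<xi> \<xi> x - F\<xi> \<xi> wp))"

definition prox_objective ::
    "('a::euclidean_space \<Rightarrow> ereal) \<Rightarrow> ('a \<Rightarrow> ereal) \<Rightarrow> ('a \<Rightarrow> 'a) \<Rightarrow> real \<Rightarrow> 'a \<Rightarrow> 'a \<Rightarrow> 'a \<Rightarrow> ereal"
  where
  "prox_objective g f gradf \<alpha> \<Delta> c z =
     ereal \<alpha> * g z + ereal ((\<alpha> *\<^sub>R \<Delta>) \<bullet> z) + ereal (bregman f gradf z c)"

definition step_objective ::
    "'a::euclidean_space set \<Rightarrow> ('a \<Rightarrow> ereal) \<Rightarrow> ('a \<Rightarrow> ereal) \<Rightarrow> ('a \<Rightarrow> 'a) \<Rightarrow> ('a \<Rightarrow> 'a) \<Rightarrow>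
     (nat \<Rightarrow> 'a \<Rightarrow> 'a) \<Rightarrow> real \<Rightarrow> real \<Rightarrow> nat \<Rightarrow> 'a alg_state \<Rightarrow> nat list \<Rightarrow> 'a \<Rightarrow> ereal" where
  "step_objective K g f gradf F F\<xi> \<alpha> \<gamma> b = (\<lambda>(x, xp, w, wp) B.
     prox_objective g f gradf \<alpha> (batch_estimate F F\<xi> b (x, xp, w, wp) B) (xbar K f gradf \<gamma> x xp))"

definition alg_step ::
    "'a::euclidean_space set \<Rightarrow> ('a \<Rightarrow> ereal) \<Rightarrow> ('a \<Rightarrow> ereal) \<Rightarrow> ('a \<Rightarrow> 'a) \<Rightarrow> ('a \<Rightarrow> 'a) \<Rightarrow>
     (nat \<Rightarrow> 'a \<Rightarrow> 'a) \<Rightarrow> ('a \<Rightarrow> 'a \<Rightarrow> nat pmf) \<Rightarrow> real \<Rightarrow> real \<Rightarrow> real \<Rightarrow> nat \<Rightarrow>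
     'a alg_state \<Rightarrow> 'a alg_state pmf" where
  "alg_step K g f gradf F F\<xi> Q \<alpha> \<gamma> p b = (\<lambda>(x, xp, w, wp).
     do {
       B \<leftarrow> replicate_pmf b (Q x wp);
       coin \<leftarrow> bernoulli_pmf p;
       let xn = arg_min_on (step_objective K g f gradf F F\<xi> \<alpha> \<gamma> b (x, xp, w, wp) B) K;
       return_pmf (xn, x, if coin then xn else x, w)
     })"

(* All randomness is finite, so the joint law of the state after s iterations is a pmf. *)
primrec alg_law ::
    "'a::euclidean_space set \<Rightarrow> ('a \<Rightarrow> ereal) \<Rightarrow> ('a \<Rightarrow> ereal) \<Rightarrow> ('a \<Rightarrow> 'a) \<Rightarrow> ('a \<Rightarrow> 'a) \<Rightarrow>
     (nat \<Rightarrow> 'a \<Rightarrow> 'a) \<Rightarrow> ('a \<Rightarrow> 'a \<Rightarrow> nat pmf) \<Rightarrow> real \<Rightarrow> real \<Rightarrow> real \<Rightarrow> nat \<Rightarrow>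
     'a \<Rightarrow> nat \<Rightarrow> 'a alg_state pmf" where
  "alg_law K g f gradf F F\<xi> Q \<alpha> \<gamma> p b x0 0 = return_pmf (x0, x0, x0, x0)"
| "alg_law K g f gradf F F\<xi> Q \<alpha> \<gamma> p b x0 (Suc s) =
     bind_pmf (alg_law K g f gradf F F\<xi> Q \<alpha> \<gamma> p b x0 s) (alg_step K g f gradf F F\<xi> Q \<alpha> \<gamma> p b)"

(* Every state reached with positive probability has x_s in dom(\<partial>f), the inverse image defining
   xbar_s exists in dom(\<partial>f), and every possible proximal subproblem has a minimizer. *)
definition alg_well_defined ::
    "'a::euclidean_space set \<Rightarrow> ('a \<Rightarrow> ereal) \<Rightarrow> ('a \<Rightarrow> ereal) \<Rightarrow> ('a \<Rightarrow> 'a) \<Rightarrow> ('a \<Rightarrow> 'a) \<Rightarrow>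
     (nat \<Rightarrow> 'a \<Rightarrow> 'a) \<Rightarrow> ('a \<Rightarrow> 'a \<Rightarrow> nat pmf) \<Rightarrow> real \<Rightarrow> real \<Rightarrow> real \<Rightarrow> nat \<Rightarrow>
     'a \<Rightarrow> bool" where
  "alg_well_defined K g f gradf F F\<xi> Q \<alpha> \<gamma> p b x0 \<longleftrightarrow>
     (\<forall>s. \<forall>(x, xp, w, wp)\<in>set_pmf (alg_law K g f gradf F F\<xi> Q \<alpha> \<gamma> p b x0 s).
        x \<in> dom_subdiff K f \<and>
        mirror_mean gradf \<gamma> x xp \<in> gradf ` dom_subdiff K f \<and>
        (\<forall>B\<in>set_pmf (replicate_pmf b (Q x wp)).
           \<exists>z. is_arg_min (step_objective K g f gradf F F\<xi> \<alpha> \<gamma> b (x, xp, w, wp) B) (\<lambda>z. z \<in> K) z))"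

end

theory Submission
  imports Defs
begin

text \<open>
  The argument is a Lyapunov argument: a nonnegative function \<open>V\<close> of the state is contracted in mean by
  the factor \<open>\<lambda> = 1 / \<theta>\<close> in each step, it dominates a multiple of \<open>N (x' - x)\<^sup>2\<close>, and the claim follows
  by Cauchy-Schwarz. In both cases below, with \<open>D\<close> the Bregman distance, \<open>V\<close> has the shape
    \<open>A D(x', x) + B D(x', x\<^sub>p) + \<alpha> \<langle>F x - F w\<^sub>p, x' - x\<rangle> + R N (x - w\<^sub>p)\<^sup>2\<close>
  (where the part \<open>N (x' - x)\<^sup>2 / 2\<close> of the Bregman distance gets its own coefficient in the first case).
  The one-step inequality (\<open>one_step\<close>) comes from the optimality condition of the proximal step, the
  three-point identity for both mirror points, and the monotonicity hypothesis applied to \<open>x'\<close> and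
  the new iterate.

  Four ideas carry the proof.

  The coin is observed late. The coin that selects \<open>w\<^sub>s\<close> is independent of \<open>(x\<^sub>s, x\<^sub>s\<^sub>-\<^sub>1, w\<^sub>s\<^sub>-\<^sub>1)\<close> and of
  the batch, whose law depends on \<open>x\<^sub>s\<close> and \<open>w\<^sub>s\<^sub>-\<^sub>1\<close> only. The chain of these triples (\<open>precoin_law\<close>) is
  therefore the right one to study: a step averages the two choices \<open>w\<^sub>s \<in> {x\<^sub>s, x\<^sub>s\<^sub>-\<^sub>1}\<close> over the same batch.

  The noise is bounded by stability. The new iterate depends on the batch, so the error of the
  batch estimate does not average out against \<open>x' - x\<^sub>s\<^sub>+\<^sub>1\<close>, and in a general norm there is no
  bias-variance identity. Instead one batch entry is exchanged with an independent copy
  (\<open>batch_noise_bound\<close>); the proximal step moves by at most \<open>\<alpha> / b\<close> times the change of the entry, which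
  gives the bound \<open>2 \<alpha>\<^sup>2 Lbar\<^sup>2 / b N (x\<^sub>s - w\<^sub>s\<^sub>-\<^sub>1)\<^sup>2\<close>, without the factor 2 in one dimension.

  If \<open>2 L < \<beta>\<close>, the problem is one-dimensional. The monotonicity hypothesis, applied along segments that
  start at \<open>x'\<close>, is then so strong that all iterates lie on one ray emanating from \<open>x'\<close>
  (\<open>iterates_on_ray\<close>). In radial coordinates the two coin outcomes can be compared with each other, and
  the constants of \<open>ray_constants\<close> work.

  If \<open>\<beta> \<le> 2 L\<close>, the parameters are confined. Then \<open>\<alpha> \<beta> \<le> 2 \<alpha> L\<close>, while the bounds on \<open>\<theta>\<close> make \<open>\<alpha> \<beta>\<close> large
  and \<open>\<alpha> L\<close> small; this leaves only \<open>1/10 \<le> \<gamma> \<le> 1/2\<close> and \<open>\<theta>\<close> close to 1. In this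
  small region Young's inequality with a separate weight for each coin outcome suffices
  (\<open>bregman_constants\<close>).
\<close>

section \<open>Norms and dual norms\<close>

lemma is_normD:
  assumes "is_norm N"
  shows is_norm_nonneg: "0 \<le> N x" and is_norm_zero: "N 0 = 0" and is_norm_eq_0: "N x = 0 \<longleftrightarrow> x = 0"
    and is_norm_scaleR: "N (c *\<^sub>R x) = \<bar>c\<bar> * N x" and is_norm_triangle: "N (x + y) \<le> N x + N y"
    and is_norm_minus: "N (- x) = N x" and is_norm_commute: "N (x - y) = N (y - x)"
proof -
  show "0 \<le> N x" "N 0 = 0" "N x = 0 \<longleftrightarrow> x = 0" "N (c *\<^sub>R x) = \<bar>c\<bar> * N x" "N (x + y) \<le> N x + N y"
    using assms by (auto simp: is_norm_def)
  have m: "N (- z) = N z" for z using assms unfolding is_norm_def by (metis abs_minus_cancel abs_one mult_1 scaleR_minus1_left)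
  show "N (- x) = N x" by (rule m)
  show "N (x - y) = N (y - x)" using m[of "x - y"] by simp
qed

text \<open>
  Norms on a finite-dimensional space are equivalent; this makes the supremum in the dual norm finite.
\<close>
lemma is_norm_ball_bounded:
  fixes N :: "'a::euclidean_space \<Rightarrow> real"
  assumes N: "is_norm N"
  obtains C where "0 < C" "\<And>x. norm x \<le> C * N x"
proof -
  have "convex_on UNIV N"
  proof (rule convex_onI)
    fix t :: real and x y :: 'a assume t: "0 < t" "t < 1"
    have "N ((1 - t) *\<^sub>R x + t *\<^sub>R y) \<le> N ((1 - t) *\<^sub>R x) + N (t *\<^sub>R y)" by (rule is_norm_triangle[OF N])
    then show "N ((1 - t) *\<^sub>R x + t *\<^sub>R y) \<le> (1 - t) * N x + t * N y" using t by (simp add: is_norm_scaleR[OF N])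
  qed simp
  then have cont: "continuous_on UNIV N" by (intro convex_on_continuous) auto
  have ne: "sphere (0::'a) 1 \<noteq> {}" by simp
  from continuous_attains_inf[OF compact_sphere ne continuous_on_subset[OF cont subset_UNIV]]
  obtain u where u: "u \<in> sphere 0 1" "\<And>x. x \<in> sphere 0 1 \<Longrightarrow> N u \<le> N x" by blast
  have pos: "0 < N u"
  proof -
    have "u \<noteq> 0" using u(1) by auto
    then show ?thesis using is_norm_eq_0[OF N, of u] is_norm_nonneg[OF N, of u] by simp
  qed
  show ?thesis
  proof (rule that[of "1 / N u"])
    show "0 < 1 / N u" using pos by simp
    fix x show "norm x \<le> 1 / N u * N x"
    proof (cases "x = 0")
      case True then show ?thesis using is_norm_zero[OF N] by simp
    next
      case False
      have "N u \<le> N ((1 / norm x) *\<^sub>R x)" using False by (intro u(2)) simp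
      also have "\<dots> = N x / norm x" by (simp add: is_norm_scaleR[OF N])
      finally show ?thesis using False pos by (simp add: field_simps)
    qed
  qed
qed

lemma dual_norm_bdd:
  assumes "is_norm N" shows "bdd_above ((\<lambda>x. y \<bullet> x) ` {x. N x \<le> 1})"
proof -
  from is_norm_ball_bounded[OF assms] obtain C where C: "0 < C" "\<And>x. norm x \<le> C * N x" by metis
  show ?thesis
  proof (rule bdd_aboveI2)
    fix x assume "x \<in> {x. N x \<le> 1}"
    then have "norm x \<le> C" using C(2)[of x] C(1) by (smt (verit) mem_Collect_eq mult_left_le)
    then show "y \<bullet> x \<le> norm y * C" using norm_cauchy_schwarz[of y x] mult_left_mono[of "norm x" C "norm y"] by simp
  qed
qed

lemma dual_norm_upper: "is_norm N \<Longrightarrow> N x \<le> 1 \<Longrightarrow> y \<bullet> x \<le> dual_norm N y"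
  unfolding dual_norm_def by (rule cSUP_upper[OF _ dual_norm_bdd]) auto

lemma dual_norm_nonneg: "is_norm N \<Longrightarrow> 0 \<le> dual_norm N y"
  using dual_norm_upper[of N 0 y] by (simp add: is_norm_zero)

lemma dual_norm_ineq:
  assumes N: "is_norm N" shows "y \<bullet> x \<le> dual_norm N y * N x"
proof (cases "x = 0")
  case True then show ?thesis by (simp add: is_norm_zero[OF N])
next
  case False
  then have pos: "0 < N x" using is_norm_eq_0[OF N, of x] is_norm_nonneg[OF N, of x] by simp
  have "y \<bullet> ((1 / N x) *\<^sub>R x) \<le> dual_norm N y"
    using pos by (intro dual_norm_upper[OF N]) (simp add: is_norm_scaleR[OF N])
  then show ?thesis using pos by (simp add: field_simps)
qed

lemma dual_norm_diff:
  assumes N: "is_norm N" shows "dual_norm N (y - z) \<le> dual_norm N y + dual_norm N z"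
  unfolding dual_norm_def[of N "y - z"]
proof (rule cSUP_least)
  show "{x. N x \<le> 1} \<noteq> {}" using is_norm_zero[OF N] by (intro ex_in_conv[THEN iffD1] exI[of _ 0]) simp
  fix x assume x: "x \<in> {x. N x \<le> 1}"
  then have "y \<bullet> x \<le> dual_norm N y" "z \<bullet> (- x) \<le> dual_norm N z"
    by (auto intro!: dual_norm_upper[OF N] simp: is_norm_minus[OF N] simp del: inner_minus_right)
  then show "(y - z) \<bullet> x \<le> dual_norm N y + dual_norm N z" by (simp add: inner_diff_left)
qed

section \<open>Finite expectations and batch resampling\<close>

abbreviation (input) expect :: "'b pmf \<Rightarrow> ('b \<Rightarrow> 'c::euclidean_space) \<Rightarrow> 'c" where
  "expect p h \<equiv> measure_pmf.expectation p h"

text \<open>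
  All laws below have finite support, which settles integrability and Fubini once and for all.
\<close>
lemma expect_mono:
  fixes h k :: "'b \<Rightarrow> real"
  assumes "finite (set_pmf p)" "\<And>x. x \<in> set_pmf p \<Longrightarrow> h x \<le> k x"
  shows "expect p h \<le> expect p k"
  using assms by (intro integral_mono_AE integrable_measure_pmf_finite) (auto simp: AE_measure_pmf_iff)

lemma expect_cong: "(\<And>x. x \<in> set_pmf p \<Longrightarrow> h x = k x) \<Longrightarrow> expect p h = expect p k"
  by (intro integral_cong_AE) (auto simp: AE_measure_pmf_iff)

lemma expect_add: "finite (set_pmf p) \<Longrightarrow> expect p (\<lambda>x. h x + k x) = expect p h + expect p k"
  by (intro Bochner_Integration.integral_add integrable_measure_pmf_finite)

lemma expect_diff: "finite (set_pmf p) \<Longrightarrow> expect p (\<lambda>x. h x - k x) = expect p h - expect p k"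
  by (intro Bochner_Integration.integral_diff integrable_measure_pmf_finite)

lemma expect_sum: "finite (set_pmf p) \<Longrightarrow> expect p (\<lambda>x. \<Sum>i\<in>I. h i x) = (\<Sum>i\<in>I. expect p (h i))"
  by (intro Bochner_Integration.integral_sum integrable_measure_pmf_finite)

lemma expect_inner: "finite (set_pmf p) \<Longrightarrow> expect p (\<lambda>x. h x \<bullet> z) = expect p h \<bullet> z"
  by (intro integral_inner_left integrable_measure_pmf_finite)

lemma expect_bind:
  fixes h :: "'c \<Rightarrow> real"
  assumes "finite (set_pmf p)" "\<And>x. x \<in> set_pmf p \<Longrightarrow> finite (set_pmf (k x))"
  shows "expect (bind_pmf p k) h = expect p (\<lambda>x. expect (k x) h)"
proof -
  have "expect (bind_pmf p k) h = (\<Sum>a\<in>set_pmf p. pmf p a *\<^sub>R expect (k a) h)"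
    using assms by (intro pmf_expectation_bind) auto
  also have "\<dots> = expect p (\<lambda>x. expect (k x) h)"
    using assms(1) by (subst integral_measure_pmf_real[of "set_pmf p"]) (auto simp: mult.commute)
  finally show ?thesis .
qed

lemma finite_replicate_pmf: "finite (set_pmf q) \<Longrightarrow> finite (set_pmf (replicate_pmf n q))"
  by (induction n) auto

lemma length_replicate_pmf: "B \<in> set_pmf (replicate_pmf n q) \<Longrightarrow> length B = n"
  by (induction n arbitrary: B) auto

lemma replicate_pmf_update:
  "B \<in> set_pmf (replicate_pmf n q) \<Longrightarrow> x \<in> set_pmf q \<Longrightarrow> B[i := x] \<in> set_pmf (replicate_pmf n q)"
  by (induction n arbitrary: B i) (auto split: nat.split)

text \<open>
  The entries of an i.i.d. batch are exchangeable with an independent copy.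
\<close>
lemma replicate_pmf_resample:
  assumes "i < n"
  shows "do {B \<leftarrow> replicate_pmf n q; x \<leftarrow> q; return_pmf (B, x)}
       = do {B \<leftarrow> replicate_pmf n q; x \<leftarrow> q; return_pmf (B[i := x], B ! i)}"
  using assms
proof (induction n arbitrary: i)
  case (Suc n)
  show ?case
  proof (cases i)
    case 0
    have "do {B \<leftarrow> replicate_pmf (Suc n) q; x \<leftarrow> q; return_pmf (B, x)}
        = do {z \<leftarrow> q; B \<leftarrow> replicate_pmf n q; x \<leftarrow> q; return_pmf (z # B, x)}"
      by (simp add: bind_assoc_pmf bind_return_pmf)
    also have "\<dots> = do {z \<leftarrow> q; x \<leftarrow> q; B \<leftarrow> replicate_pmf n q; return_pmf (z # B, x)}"
      by (subst (2) bind_commute_pmf) (rule refl)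
    also have "\<dots> = do {x \<leftarrow> q; z \<leftarrow> q; B \<leftarrow> replicate_pmf n q; return_pmf (z # B, x)}"
      by (subst bind_commute_pmf) (rule refl)
    also have "\<dots> = do {x \<leftarrow> q; B \<leftarrow> replicate_pmf n q; z \<leftarrow> q; return_pmf (z # B, x)}"
      by (subst (2) bind_commute_pmf) (rule refl)
    also have "\<dots> = do {B \<leftarrow> replicate_pmf (Suc n) q; x \<leftarrow> q; return_pmf (B[i := x], B ! i)}"
      by (simp add: 0 bind_assoc_pmf bind_return_pmf)
    finally show ?thesis .
  next
    case (Suc j)
    have IH: "do {B \<leftarrow> replicate_pmf n q; x \<leftarrow> q; return_pmf (B, x)}
       = do {B \<leftarrow> replicate_pmf n q; x \<leftarrow> q; return_pmf (B[j := x], B ! j)}"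
      using Suc Suc.IH Suc.prems by simp
    have "do {B \<leftarrow> replicate_pmf (Suc n) q; x \<leftarrow> q; return_pmf (B, x)}
        = do {z \<leftarrow> q; Bx \<leftarrow> do {B \<leftarrow> replicate_pmf n q; x \<leftarrow> q; return_pmf (B, x)}; return_pmf (z # fst Bx, snd Bx)}"
      by (simp add: bind_assoc_pmf bind_return_pmf)
    also have "\<dots> = do {B \<leftarrow> replicate_pmf (Suc n) q; x \<leftarrow> q; return_pmf (B[i := x], B ! i)}"
      unfolding IH by (simp add: Suc bind_assoc_pmf bind_return_pmf)
    finally show ?thesis .
  qed
qed simp

lemma expect_resample:
  fixes H :: "'b list \<Rightarrow> 'b \<Rightarrow> real"
  assumes fin: "finite (set_pmf q)" and i: "i < n"
  shows "expect (replicate_pmf n q) (\<lambda>B. expect q (\<lambda>x. H B x))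
       = expect (replicate_pmf n q) (\<lambda>B. expect q (\<lambda>x. H (B[i := x]) (B ! i)))"
proof -
  note fr = finite_replicate_pmf[OF fin, of n]
  have "expect (do {B \<leftarrow> replicate_pmf n q; x \<leftarrow> q; return_pmf (B, x)}) (\<lambda>(B, x). H B x)
     = expect (do {B \<leftarrow> replicate_pmf n q; x \<leftarrow> q; return_pmf (B[i := x], B ! i)}) (\<lambda>(B, x). H B x)"
    by (subst replicate_pmf_resample[OF i]) (rule refl)
  then show ?thesis using fin fr by (simp add: expect_bind)
qed

text \<open>
  Symmetrisation. Exchanging entry \<open>i\<close> of the batch with an independent copy flips the sign of
  \<open>X (B ! i) - X x\<close>, so the two forms of the expectation add up to one that contains
  \<open>y (B[i := x]) - y B\<close> only. The anchor \<open>z\<close> disappears, and what remains is the sensitivity of \<open>y\<close> to a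
  single entry.
\<close>
lemma batch_noise_bound:
  fixes X :: "'b \<Rightarrow> 'a::euclidean_space" and y :: "'b list \<Rightarrow> 'a"
  assumes fin: "finite (set_pmf q)"
    and stab: "\<And>B i x. B \<in> set_pmf (replicate_pmf n q) \<Longrightarrow> i < n \<Longrightarrow> x \<in> set_pmf q \<Longrightarrow>
      (X (B ! i) - X x) \<bullet> (y (B[i := x]) - y B) \<le> c * \<Phi> (B ! i) x"
  shows "expect (replicate_pmf n q) (\<lambda>B. ((\<Sum>x\<leftarrow>B. X x) - real n *\<^sub>R expect q X) \<bullet> (z - y B))
       \<le> real n * (c / 2 * expect q (\<lambda>x'. expect q (\<lambda>x. \<Phi> x' x)))"
proof -
  note fr = finite_replicate_pmf[OF fin, of n]
  let ?E = "expect (replicate_pmf n q)"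
  have coord: "?E (\<lambda>B. (X (B ! i) - expect q X) \<bullet> (z - y B)) \<le> c / 2 * expect q (\<lambda>x'. expect q (\<lambda>x. \<Phi> x' x))"
    if i: "i < n" for i
  proof -
    define H where "H B x = (X (B ! i) - X x) \<bullet> (z - y B)" for B x
    have 1: "?E (\<lambda>B. (X (B ! i) - expect q X) \<bullet> (z - y B)) = ?E (\<lambda>B. expect q (\<lambda>x. H B x))" (is "?S = _")
      unfolding H_def using fin
      by (intro expect_cong) (simp add: expect_inner expect_diff)
    have 2: "?E (\<lambda>B. expect q (\<lambda>x. H B x)) = ?E (\<lambda>B. expect q (\<lambda>x. (X x - X (B ! i)) \<bullet> (z - y (B[i := x]))))"
      unfolding expect_resample[OF fin i, of H]
      by (intro expect_cong) (simp add: H_def i length_replicate_pmf)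
    have "2 * ?S = ?E (\<lambda>B. expect q (\<lambda>x. H B x + (X x - X (B ! i)) \<bullet> (z - y (B[i := x]))))"
      using 1 2 fin fr by (simp add: expect_add)
    also have "\<dots> \<le> ?E (\<lambda>B. expect q (\<lambda>x. c * \<Phi> (B ! i) x))"
    proof (intro expect_mono fin fr)
      fix B x assume "B \<in> set_pmf (replicate_pmf n q)" "x \<in> set_pmf q"
      from stab[OF this(1) i this(2)]
      show "H B x + (X x - X (B ! i)) \<bullet> (z - y (B[i := x])) \<le> c * \<Phi> (B ! i) x"
        unfolding H_def by (simp add: inner_diff_left inner_diff_right)
    qed
    also have "\<dots> = c * ?E (\<lambda>B. expect q (\<lambda>x. \<Phi> (B ! i) x))" by simp
    also have "?E (\<lambda>B. expect q (\<lambda>x. \<Phi> (B ! i) x)) = expect q (\<lambda>x'. expect q (\<lambda>x. \<Phi> x' x))"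
      using expect_resample[OF fin i, of "\<lambda>B x'. expect q (\<lambda>x. \<Phi> x' x)"] by simp
    finally show ?thesis by simp
  qed
  have "?E (\<lambda>B. ((\<Sum>x\<leftarrow>B. X x) - real n *\<^sub>R expect q X) \<bullet> (z - y B))
      = ?E (\<lambda>B. \<Sum>i<n. (X (B ! i) - expect q X) \<bullet> (z - y B))"
  proof (intro expect_cong)
    fix B assume "B \<in> set_pmf (replicate_pmf n q)"
    then have "(\<Sum>x\<leftarrow>B. X x) = (\<Sum>i<n. X (B ! i))"
      by (simp add: sum_list_sum_nth length_replicate_pmf atLeast0LessThan)
    then show "((\<Sum>x\<leftarrow>B. X x) - real n *\<^sub>R expect q X) \<bullet> (z - y B) = (\<Sum>i<n. (X (B ! i) - expect q X) \<bullet> (z - y B))"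
      by (simp add: inner_sum_left[symmetric] sum_subtractf scaleR_conv_of_real sum_constant_scaleR)
  qed
  also have "\<dots> = (\<Sum>i<n. ?E (\<lambda>B. (X (B ! i) - expect q X) \<bullet> (z - y B)))" by (rule expect_sum[OF fr])
  also have "\<dots> \<le> (\<Sum>i<n. c / 2 * expect q (\<lambda>x'. expect q (\<lambda>x. \<Phi> x' x)))" by (intro sum_mono coord) auto
  finally show ?thesis by simp
qed

section \<open>Bregman distances and the proximal step\<close>

locale vr_setting =
  fixes N :: "'a::euclidean_space \<Rightarrow> real"
    and K :: "'a set" and g f :: "'a \<Rightarrow> ereal" and gradf F :: "'a \<Rightarrow> 'a"
    and F\<xi> :: "nat \<Rightarrow> 'a \<Rightarrow> 'a" and Q :: "'a \<Rightarrow> 'a \<Rightarrow> nat pmf"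
    and M b :: nat and L Lbar \<alpha> \<beta> \<gamma> p :: real and x0 x' :: 'a
  assumes norm: "is_norm N"
    and K: "convex K"
    and g: "proper_on K g" "ereal_convex_on K g" "lsc_on K g"
    and f: "proper_on K f"
    and dom: "eff_dom K g \<subseteq> eff_dom K f"
    and grad: "has_gradient_map K f gradf"
    and strong: "strongly_convex1 N K f gradf"
    and A3: "variable_lipschitz_oracle N (eff_dom K g) F M F\<xi> Q Lbar"
    and A4: "0 \<le> L"
      "\<forall>x\<in>eff_dom K g. \<forall>y\<in>eff_dom K g. dual_norm N (F x - F y) \<le> L * N (x - y)"
    and A7: "0 < \<beta>"
      "\<forall>x\<in>eff_dom K f. \<forall>y\<in>dom_subdiff K f.
         ereal (F x \<bullet> (y - x)) + g y - g x \<ge> 0 \<longrightarrow>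
         ereal (F y \<bullet> (y - x)) + g y - g x \<ge> ereal (\<beta> * bregman f gradf x y)"
    and b: "1 \<le> b"
    and p: "0 < p" "p < 1"
    and \<gamma>: "p < \<gamma>" "\<gamma> < 1"
    and \<alpha>: "0 < \<alpha>"
    and x0: "x0 \<in> eff_dom K g" "x0 \<in> dom_subdiff K f"
    and well_defined: "alg_well_defined K g f gradf F F\<xi> Q \<alpha> \<gamma> p b x0"
    and x': "x' \<in> vi_solutions K g F"
begin

abbreviation "D \<equiv> bregman f gradf"
abbreviation "is_prox d v y \<equiv> is_arg_min (prox_objective g f gradf \<alpha> d v) (\<lambda>z. z \<in> K) y"
abbreviation "batch x wp \<equiv> replicate_pmf b (Q x wp)"
abbreviation "estimate x xp w wp B \<equiv> batch_estimate F F\<xi> b (x, xp, w, wp) B"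
abbreviation "state_law \<equiv> alg_law K g f gradf F F\<xi> Q \<alpha> \<gamma> p b x0"
definition "G = eff_dom K g"

text \<open>
  All iterates stay in \<open>C\<close>: there \<open>g\<close> is finite and the Bregman distance may have its second argument.
\<close>
definition "C = G \<inter> dom_subdiff K f"
definition "gr x = real_of_ereal (g x)"
definition "fr x = real_of_ereal (f x)"

lemma G_D:
  assumes "x \<in> G"
  shows "x \<in> K" "g x = ereal (gr x)" "f x = ereal (fr x)" "x \<in> eff_dom K f"
proof -
  show K: "x \<in> K" and f1: "x \<in> eff_dom K f" using assms dom by (auto simp: G_def eff_dom_def)
  have "g x < \<infinity>" "g x \<noteq> -\<infinity>" using assms g(1) by (auto simp: G_def eff_dom_def proper_on_def)
  then show "g x = ereal (gr x)" by (cases "g x") (auto simp: gr_def)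
  have "f x < \<infinity>" "f x \<noteq> -\<infinity>" using f1 f(1) by (auto simp: eff_dom_def proper_on_def)
  then show "f x = ereal (fr x)" by (cases "f x") (auto simp: fr_def)
qed

lemma C_D: "x \<in> C \<Longrightarrow> x \<in> G" "x \<in> C \<Longrightarrow> x \<in> dom_subdiff K f"
  by (auto simp: C_def)

lemma G_I: "x \<in> K \<Longrightarrow> g x < \<infinity> \<Longrightarrow> x \<in> G"
  by (simp add: G_def eff_dom_def)

lemma G_convex:
  assumes x: "x \<in> G" and y: "y \<in> G" and t: "0 \<le> t" "t \<le> 1"
  shows "(1 - t) *\<^sub>R x + t *\<^sub>R y \<in> G" "gr ((1 - t) *\<^sub>R x + t *\<^sub>R y) \<le> (1 - t) * gr x + t * gr y"
proof -
  let ?z = "(1 - t) *\<^sub>R x + t *\<^sub>R y"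
  have zK: "?z \<in> K" using K G_D(1)[OF x] G_D(1)[OF y] t by (intro convexD) auto
  have "g ?z \<le> ereal (1 - t) * g x + ereal t * g y"
    using g(2) G_D(1)[OF x] G_D(1)[OF y] t unfolding ereal_convex_on_def by blast
  then have le: "g ?z \<le> ereal ((1 - t) * gr x + t * gr y)" unfolding G_D(2)[OF x] G_D(2)[OF y] by simp
  then show zG: "?z \<in> G" using zK by (intro G_I) (auto intro: le_less_trans)
  show "gr ?z \<le> (1 - t) * gr x + t * gr y" using le unfolding G_D(2)[OF zG] by simp
qed

lemma strongD:
  assumes "x \<in> G" "y \<in> C" shows "(N (x - y))\<^sup>2 \<le> 2 * D x y"
proof -
  have y: "y \<in> G" "y \<in> dom_subdiff K f" using assms C_D by auto
  have "f x \<ge> f y + ereal (gradf y \<bullet> (x - y)) + ereal ((1/2) * (N (x - y))\<^sup>2)"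
    using strong G_D(4)[OF assms(1)] y(2) unfolding strongly_convex1_def by blast
  then show ?thesis unfolding G_D(3)[OF assms(1)] G_D(3)[OF y(1)]
    by (simp add: bregman_def G_D(3)[OF assms(1)] G_D(3)[OF y(1)])
qed

lemma D_nonneg: "x \<in> G \<Longrightarrow> y \<in> C \<Longrightarrow> 0 \<le> D x y"
  using strongD[of x y] zero_le_power2[of "N (x - y)"] by linarith

lemma three_point: "(gradf y - gradf v) \<bullet> (y - z) = D z y + D y v - D z v"
  by (simp add: bregman_def inner_diff_left inner_diff_right algebra_simps)

text \<open>
  If \<open>g x'\<close> were infinite, the variational inequality would fail at \<open>x0\<close>, where \<open>g\<close> is finite.
\<close>
lemma x'_G: "x' \<in> G"
proof -
  have x'K: "x' \<in> K" using x' by (simp add: vi_solutions_def)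
  have "x0 \<in> K" using x0 by (simp add: eff_dom_def)
  then have ge: "ereal (F x' \<bullet> (x0 - x')) + g x0 - g x' \<ge> 0" using x' by (auto simp: vi_solutions_def)
  have x0G: "x0 \<in> G" using x0 by (simp add: G_def)
  have "g x' \<noteq> \<infinity>"
  proof
    assume "g x' = \<infinity>"
    with ge show False unfolding G_D(2)[OF x0G] by simp
  qed
  then show ?thesis using x'K by (intro G_I) (auto simp: less_top[symmetric] top_ereal_def)
qed

lemma A7_real:
  assumes x: "x \<in> G" and y: "y \<in> C" and ge: "0 \<le> F x \<bullet> (y - x) + gr y - gr x"
  shows "\<beta> * D x y \<le> F y \<bullet> (y - x) + gr y - gr x"
proof -
  have yG: "y \<in> G" using C_D y by auto
  have "ereal (F x \<bullet> (y - x)) + g y - g x \<ge> 0" using ge unfolding G_D(2)[OF x] G_D(2)[OF yG] by simp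
  then have "ereal (F y \<bullet> (y - x)) + g y - g x \<ge> ereal (\<beta> * D x y)"
    using A7(2) G_D(4)[OF x] C_D(2)[OF y] by blast
  then show ?thesis unfolding G_D(2)[OF x] G_D(2)[OF yG] by simp
qed

lemma solution_ge: "y \<in> G \<Longrightarrow> 0 \<le> F x' \<bullet> (y - x') + gr y - gr x'"
proof -
  assume y: "y \<in> G"
  have "ereal (F x' \<bullet> (y - x')) + g y - g x' \<ge> 0" using x' G_D(1)[OF y] by (auto simp: vi_solutions_def)
  then show ?thesis unfolding G_D(2)[OF y] G_D(2)[OF x'_G] by simp
qed

lemma A4_C: "x \<in> G \<Longrightarrow> y \<in> G \<Longrightarrow> (F x - F y) \<bullet> z \<le> L * N (x - y) * N z"
  using dual_norm_ineq[OF norm, of "F x - F y" z] A4(2) is_norm_nonneg[OF norm, of z]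
  unfolding G_def by (smt (verit) mult_right_mono)

text \<open>
  The first-order optimality condition of the proximal step. It is obtained along the segment from \<open>y\<close>
  to \<open>z\<close>, since \<open>f\<close> is differentiable only relative to its domain.
\<close>
lemma prox_opt:
  assumes y: "y \<in> C" and z: "z \<in> G"
    and min: "is_prox d v y"
  shows "\<alpha> * (gr y - gr z) + \<alpha> * (d \<bullet> (y - z)) + (gradf y - gradf v) \<bullet> (y - z) \<le> 0"
proof -
  have yG: "y \<in> G" using y C_D by auto
  have obj: "prox_objective g f gradf \<alpha> d v w
      = ereal (\<alpha> * gr w + \<alpha> * (d \<bullet> w) + (fr w - fr v - gradf v \<bullet> (w - v)))" if "w \<in> G" for w
    unfolding prox_objective_def G_D(2)[OF that] by (simp add: bregman_def fr_def)
  define c where "c = \<alpha> * (gr z - gr y) + \<alpha> * (d \<bullet> (z - y)) - gradf v \<bullet> (z - y)"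
  define \<phi> where "\<phi> s = fr (y + s *\<^sub>R (z - y))" for s
  have path: "y + s *\<^sub>R (z - y) = (1 - s) *\<^sub>R y + s *\<^sub>R z" for s by (simp add: algebra_simps)
  have low: "- c \<le> (\<phi> s - \<phi> 0) / (s - 0)" if s: "0 < s" "s \<le> 1" for s
  proof -
    let ?w = "y + s *\<^sub>R (z - y)"
    have wG: "?w \<in> G" and gw: "gr ?w \<le> (1 - s) * gr y + s * gr z"
      using G_convex[OF yG z, of s] s unfolding path by auto
    have "\<not> prox_objective g f gradf \<alpha> d v ?w < prox_objective g f gradf \<alpha> d v y"
      using min G_D(1)[OF wG] unfolding is_arg_min_def by blast
    then have "\<alpha> * gr y + \<alpha> * (d \<bullet> y) + (fr y - fr v - gradf v \<bullet> (y - v))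
        \<le> \<alpha> * gr ?w + \<alpha> * (d \<bullet> ?w) + (fr ?w - fr v - gradf v \<bullet> (?w - v))"
      unfolding obj[OF wG] obj[OF yG] by simp
    moreover have "\<alpha> * gr ?w \<le> \<alpha> * ((1 - s) * gr y + s * gr z)" using gw \<alpha> by (intro mult_left_mono) auto
    ultimately have "0 \<le> s * c + (\<phi> s - \<phi> 0)"
      unfolding c_def \<phi>_def by (simp add: inner_add_right inner_diff_right algebra_simps)
    then show ?thesis using s by (simp add: field_simps)
  qed
  have "((\<lambda>w. real_of_ereal (f w)) has_derivative (\<lambda>h. gradf y \<bullet> h)) (at y within eff_dom K f)"
    using grad C_D(2)[OF y] unfolding has_gradient_map_def by blast
  then have der: "(fr has_derivative (\<lambda>h. gradf y \<bullet> h)) (at y within eff_dom K f)"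
    unfolding fr_def[abs_def] .
  have img: "(\<lambda>s. y + s *\<^sub>R (z - y)) ` {0..1} \<subseteq> eff_dom K f"
    using G_convex(1)[OF yG z] G_D(4) unfolding path by auto
  have "((\<lambda>s. fr (y + s *\<^sub>R (z - y))) has_derivative (\<lambda>s. gradf y \<bullet> (s *\<^sub>R (z - y)))) (at 0 within {0..1})"
  proof (rule has_derivative_in_compose[where f = "\<lambda>s. y + s *\<^sub>R (z - y)" and f' = "\<lambda>s. s *\<^sub>R (z - y)"])
    show "((\<lambda>s. y + s *\<^sub>R (z - y)) has_derivative (\<lambda>s. s *\<^sub>R (z - y))) (at 0 within {0..1})"
      by (auto intro!: derivative_eq_intros)
    show "(fr has_derivative (\<lambda>h. gradf y \<bullet> h)) (at (y + 0 *\<^sub>R (z - y)) within (\<lambda>s. y + s *\<^sub>R (z - y)) ` {0..1})"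
      using has_derivative_subset[OF der img] by simp
  qed
  then have "(\<phi> has_real_derivative (gradf y \<bullet> (z - y))) (at 0 within {0..1})"
    unfolding has_field_derivative_def \<phi>_def[abs_def] by (simp add: mult_commute_abs)
  then have lim: "((\<lambda>s. (\<phi> s - \<phi> 0) / (s - 0)) \<longlongrightarrow> gradf y \<bullet> (z - y)) (at 0 within {0..1})"
    by (simp add: has_field_derivative_iff)
  have "- c \<le> gradf y \<bullet> (z - y)"
  proof (rule tendsto_lowerbound[OF lim])
    show "\<forall>\<^sub>F s in at 0 within {0..1}. - c \<le> (\<phi> s - \<phi> 0) / (s - 0)"
      unfolding eventually_at by (intro exI[of _ 1]) (use low in auto)
    show "at (0::real) within {0..1} \<noteq> bot" by (simp add: trivial_limit_within islimpt_Icc)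
  qed
  then show ?thesis unfolding c_def by (simp add: inner_diff_left inner_diff_right algebra_simps)
qed

text \<open>
  Adding the optimality conditions of the two minimizers leaves the gradient difference, which is
  strongly monotone; the mirror point \<open>v\<close> cancels.
\<close>
lemma prox_stable:
  assumes y1: "y1 \<in> C" and y2: "y2 \<in> C"
    and min1: "is_prox d1 v y1"
    and min2: "is_prox d2 v y2"
  shows "(N (y1 - y2))\<^sup>2 \<le> \<alpha> * ((d1 - d2) \<bullet> (y2 - y1))"
proof -
  note G1 = C_D(1)[OF y1] and G2 = C_D(1)[OF y2]
  have "D y2 y1 + D y1 y2 = (gradf y1 - gradf y2) \<bullet> (y1 - y2)"
    by (simp add: bregman_def inner_diff_left inner_diff_right algebra_simps)
  moreover have comm: "N (y2 - y1) = N (y1 - y2)" by (rule is_norm_commute[OF norm])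
  ultimately have "(N (y1 - y2))\<^sup>2 \<le> (gradf y1 - gradf y2) \<bullet> (y1 - y2)"
    using strongD[OF G1 y2] strongD[OF G2 y1] unfolding comm by linarith
  with prox_opt[OF y1 G2 min1] prox_opt[OF y2 G1 min2] show ?thesis
    by (simp add: inner_diff_left inner_diff_right algebra_simps)
qed

text \<open>
  Optimality of \<open>y\<close> is tested at \<open>x'\<close>. The variational inequality at \<open>x'\<close> and the monotonicity hypothesis
  turn the values of \<open>g\<close> into a gain \<open>\<beta> D x' y\<close>, and the three-point identity splits the gradient terms.
\<close>
lemma one_step:
  assumes y: "y \<in> C"
    and gv: "gradf v = mirror_mean gradf \<gamma> x xp"
    and min: "is_prox d v y"
  shows "(1 + \<alpha> * \<beta>) * D x' y \<le> \<gamma> * (D x' x - D y x) + (1 - \<gamma>) * (D x' xp - D y xp)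
           + \<alpha> * ((d - F y) \<bullet> (x' - y))"
proof -
  note yG = C_D(1)[OF y]
  have "\<alpha> * (\<beta> * D x' y) \<le> \<alpha> * (F y \<bullet> (y - x') + gr y - gr x')"
    using A7_real[OF x'_G y solution_ge[OF yG]] \<alpha> by (intro mult_left_mono) auto
  moreover have "(gradf y - gradf v) \<bullet> (y - x')
      = \<gamma> * ((gradf y - gradf x) \<bullet> (y - x')) + (1 - \<gamma>) * ((gradf y - gradf xp) \<bullet> (y - x'))"
    unfolding gv mirror_mean_def by (simp add: inner_diff_left inner_add_left algebra_simps)
  then have "(gradf y - gradf v) \<bullet> (y - x')
      = \<gamma> * (D x' y + D y x - D x' x) + (1 - \<gamma>) * (D x' y + D y xp - D x' xp)"
    unfolding three_point .
  ultimately show ?thesis using prox_opt[OF y x'_G min]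
    by (simp add: inner_diff_left inner_diff_right algebra_simps)
qed

section \<open>Strong monotonicity puts all iterates on a ray\<close>

text \<open>
  The gap \<open>F z \<bullet> (y - z) + gr y - gr z\<close> is nonnegative at \<open>z = x'\<close>. Suppose it is negative at some \<open>z\<close>
  and move from \<open>x'\<close> to \<open>z\<close>. At the last point \<open>X s\<close> where it is nonnegative (this point exists because
  \<open>g\<close> is lower semicontinuous) the monotonicity hypothesis applies and improves nonnegativity to
  \<open>(\<beta> / 2 - L) N (y - X s)\<^sup>2\<close>, which is positive as \<open>y\<close> is off the segment. But \<open>g\<close> is convex and \<open>F\<close>
  Lipschitz, so the gap cannot drop at once from a positive to a negative value.
\<close>
lemma vi_gap_nonneg:
  assumes L\<beta>: "2 * L < \<beta>" and y: "y \<in> C" and z: "z \<in> G" and off: "y \<notin> closed_segment x' z"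
  shows "0 \<le> F z \<bullet> (y - z) + gr y - gr z"
proof (rule ccontr)
  assume neg: "\<not> 0 \<le> F z \<bullet> (y - z) + gr y - gr z"
  note yG = C_D(1)[OF y]
  define X where "X s = (1 - s) *\<^sub>R x' + s *\<^sub>R z" for s
  define A where "A s = F (X s) \<bullet> (y - X s) + gr y" for s
  define S where "S = {s \<in> {0..1}. gr (X s) \<le> A s}"
  have X01: "X 0 = x'" "X 1 = z" by (simp_all add: X_def)
  have XG: "X s \<in> G" if "s \<in> {0..1}" for s using G_convex(1)[OF x'_G z, of s] that by (simp add: X_def)
  have Xdiff: "X s - X t = (s - t) *\<^sub>R (z - x')" for s t by (simp add: X_def algebra_simps)
  have NX: "N (X s - X t) = \<bar>s - t\<bar> * N (z - x')" for s t
    unfolding Xdiff by (rule is_norm_scaleR[OF norm])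
  \<comment> \<open>A Lipschitz constant of \<open>A\<close> along the segment.\<close>
  define k where "k = L * N (z - x') * (N (y - x') + N (z - x')) + L * N (z - x') * N (z - x')
     + \<bar>F x' \<bullet> (z - x')\<bar>"
  have k0: "0 \<le> k" unfolding k_def using A4(1) is_norm_nonneg[OF norm] by (intro add_nonneg_nonneg mult_nonneg_nonneg) auto
  have A_lip: "A s - A t \<le> k * \<bar>s - t\<bar>" if s: "s \<in> {0..1}" and t: "t \<in> {0..1}" for s t
  proof -
    have "A s - A t = (F (X s) - F (X t)) \<bullet> (y - X s) + (F (X t) - F x') \<bullet> (X t - X s) + F x' \<bullet> (X t - X s)"
      unfolding A_def by (simp add: inner_diff_left inner_diff_right)
    also have "(F (X s) - F (X t)) \<bullet> (y - X s) \<le> L * N (X s - X t) * N (y - X s)"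
      by (rule A4_C[OF XG[OF s] XG[OF t]])
    also have "\<dots> \<le> L * N (X s - X t) * (N (y - x') + N (z - x'))"
    proof (intro mult_left_mono)
      have "N (y - X s) \<le> N (y - x') + N (X 0 - X s)"
        using is_norm_triangle[OF norm, of "y - x'" "X 0 - X s"] by (simp add: X01)
      also have "N (X 0 - X s) \<le> 1 * N (z - x')" unfolding NX
        using s is_norm_nonneg[OF norm] by (intro mult_right_mono) auto
      finally show "N (y - X s) \<le> N (y - x') + N (z - x')" by simp
    qed (use A4(1) is_norm_nonneg[OF norm] in auto)
    also have "(F (X t) - F x') \<bullet> (X t - X s) \<le> L * N (X t - x') * N (X t - X s)"
      by (rule A4_C[OF XG[OF t] x'_G])
    also have "\<dots> \<le> L * N (z - x') * N (X t - X s)"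
    proof (intro mult_right_mono mult_left_mono)
      have "N (X t - X 0) \<le> 1 * N (z - x')" unfolding NX
        using t is_norm_nonneg[OF norm] by (intro mult_right_mono) auto
      then show "N (X t - x') \<le> N (z - x')" by (simp add: X01)
    qed (use A4(1) is_norm_nonneg[OF norm] in auto)
    also have "F x' \<bullet> (X t - X s) \<le> \<bar>F x' \<bullet> (z - x')\<bar> * \<bar>s - t\<bar>"
      unfolding Xdiff inner_scaleR_right by (metis abs_ge_self abs_minus_commute abs_mult mult.commute)
    finally show ?thesis unfolding NX k_def by (simp add: abs_minus_commute algebra_simps)
  qed
  have S0: "0 \<in> S" using solution_ge[OF yG] by (simp add: S_def A_def X01)
  have S1: "1 \<notin> S" using neg by (simp add: S_def A_def X01)
  have zx': "norm (z - x') > 0"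
  proof -
    have "z \<noteq> x'"
    proof
      assume "z = x'"
      then have "X 1 = X 0" using X01 by simp
      then have "A 1 = A 0" unfolding A_def by simp
      then show False using S0 S1 \<open>X 1 = X 0\<close> by (simp add: S_def)
    qed
    then show ?thesis by simp
  qed
  have bdd: "bdd_above S" by (rule bdd_aboveI[of _ 1]) (auto simp: S_def)
  define s where "s = Sup S"
  have "0 \<le> s" unfolding s_def by (rule cSup_upper[OF S0 bdd])
  moreover have "s \<le> 1" unfolding s_def
  proof (rule cSup_least)
    show "S \<noteq> {}" using S0 by blast
    fix r assume "r \<in> S" then show "r \<le> 1" by (simp add: S_def)
  qed
  ultimately have s01: "s \<in> {0..1}" by simp
  have sS: "s \<in> S"
  proof (rule ccontr)
    assume nS: "s \<notin> S"
    define e where "e = gr (X s) - A s"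
    have e0: "0 < e" using nS s01 by (simp add: S_def e_def)
    have "ereal (gr (X s) - e / 2) < g (X s)" unfolding G_D(2)[OF XG[OF s01]] using e0 by simp
    also have "\<dots> \<le> Liminf (at (X s) within K) g" using g(3) G_D(1)[OF XG[OF s01]] by (simp add: lsc_on_def)
    finally have "\<forall>\<^sub>F w in at (X s) within K. ereal (gr (X s) - e / 2) < g w" by (rule less_LiminfD)
    then obtain d where d: "d > 0" "\<And>w. w \<in> K \<Longrightarrow> w \<noteq> X s \<Longrightarrow> dist w (X s) < d \<Longrightarrow> ereal (gr (X s) - e / 2) < g w"
      unfolding eventually_at by auto
    define \<delta> where "\<delta> = min (d / norm (z - x')) (e / (2 * (k + 1)))"
    have "0 < \<delta>" unfolding \<delta>_def using d zx' e0 k0 by simp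
    then obtain t where t: "t \<in> S" "s - \<delta> < t" using less_cSupE[of "s - \<delta>" S] S0 unfolding s_def by (metis diff_less_eq empty_iff less_add_same_cancel1)
    have ts: "t \<le> s" unfolding s_def by (rule cSup_upper[OF t(1) bdd])
    have tne: "t < s" using t(1) nS ts by (cases "t = s") auto
    have t01: "t \<in> {0..1}" using t(1) by (simp add: S_def)
    have "dist (X t) (X s) = (s - t) * norm (z - x')" unfolding dist_norm Xdiff using tne by simp
    also have "\<dots> < \<delta> * norm (z - x')" using t(2) by (intro mult_strict_right_mono zx') simp
    also have "\<dots> \<le> d / norm (z - x') * norm (z - x')" unfolding \<delta>_def by (intro mult_right_mono) auto
    also have "\<dots> = d" using zx' by simp
    finally have near: "dist (X t) (X s) < d" .
    have "X t \<noteq> X s" using Xdiff[of t s] tne zx' by force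
    then have "ereal (gr (X s) - e / 2) < g (X t)"
      using d(2)[OF G_D(1)[OF XG[OF t01]] _ near] by simp
    then have 1: "gr (X s) - e / 2 < gr (X t)" unfolding G_D(2)[OF XG[OF t01]] by simp
    have "A t - A s \<le> k * \<bar>t - s\<bar>" by (rule A_lip[OF t01 s01])
    also have "\<dots> \<le> (k + 1) * (e / (2 * (k + 1)))" using t(2) tne k0 unfolding \<delta>_def by (intro mult_mono) auto
    also have "\<dots> = e / 2" using k0 by (simp add: field_simps)
    finally have "A t - A s \<le> e / 2" .
    moreover have "gr (X t) \<le> A t" using t(1) by (simp add: S_def)
    moreover have "A s = gr (X s) - e" by (simp add: e_def)
    ultimately show False using 1 by linarith
  qed
  have s1: "s < 1" using sS S1 s01 by (cases "s = 1") auto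
  have "X s \<in> closed_segment x' z" unfolding closed_segment_def X_def using s01 by auto
  then have ne: "y - X s \<noteq> 0" using off by auto
  then have Npos: "0 < N (y - X s)" using is_norm_eq_0[OF norm, of "y - X s"] is_norm_nonneg[OF norm, of "y - X s"] by simp
  define \<eta> where "\<eta> = A s - gr (X s)"
  have \<eta>0: "0 < \<eta>"
  proof -
    have "\<beta> * D (X s) y \<le> F y \<bullet> (y - X s) + gr y - gr (X s)"
      using sS by (intro A7_real[OF XG[OF s01] y]) (simp add: S_def A_def)
    also have "\<dots> = \<eta> + (F y - F (X s)) \<bullet> (y - X s)" unfolding \<eta>_def A_def by (simp add: inner_diff_left)
    also have "(F y - F (X s)) \<bullet> (y - X s) \<le> L * N (y - X s) * N (y - X s)" by (rule A4_C[OF yG XG[OF s01]])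
    finally have 1: "\<beta> * D (X s) y \<le> \<eta> + L * (N (y - X s))\<^sup>2" by (simp add: power2_eq_square)
    have "\<beta> * ((N (X s - y))\<^sup>2 / 2) \<le> \<beta> * D (X s) y"
      using strongD[OF XG[OF s01] y] A7(1) by (intro mult_left_mono) auto
    with 1 have "(\<beta> / 2 - L) * (N (y - X s))\<^sup>2 \<le> \<eta>"
      unfolding is_norm_commute[OF norm, of "X s" y] by (simp add: algebra_simps)
    moreover have "0 < (\<beta> / 2 - L) * (N (y - X s))\<^sup>2" using L\<beta> Npos by simp
    ultimately show ?thesis by linarith
  qed
  \<comment> \<open>To the right of \<open>s\<close> the gap decreases at rate at most \<open>q\<close>, so it stays positive
    for a step shorter than \<open>\<eta> / q\<close>.\<close>
  define q where "q = k + \<bar>gr z - gr (X s)\<bar> / (1 - s)"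
  have q0: "0 \<le> q" unfolding q_def using k0 s1 by simp
  define m where "m = min (1 - s) (\<eta> / (q + 1))"
  define t where "t = s + m / 2"
  have h: "0 < m" using s1 \<eta>0 q0 by (simp add: m_def)
  have "m \<le> 1 - s" by (simp add: m_def)
  then have t: "s < t" "t < 1" using h s1 unfolding t_def by auto
  have t01: "t \<in> {0..1}" using t s01 by auto
  have "t \<notin> S" using cSup_upper[OF _ bdd, of t] t unfolding s_def by auto
  then have "A t < gr (X t)" using t01 by (simp add: S_def)
  also have "gr (X t) \<le> gr (X s) + (t - s) * (\<bar>gr z - gr (X s)\<bar> / (1 - s))"
  proof -
    define \<tau> where "\<tau> = (t - s) / (1 - s)"
    have \<tau>: "0 \<le> \<tau>" "\<tau> \<le> 1" using t s1 by (auto simp: \<tau>_def field_simps)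
    have "\<tau> * (1 - s) = t - s" using s1 by (simp add: \<tau>_def)
    then have ts: "t = s + \<tau> - \<tau> * s" by (simp add: algebra_simps)
    have "X t = (1 - \<tau>) *\<^sub>R X s + \<tau> *\<^sub>R z" unfolding X_def ts by (simp add: algebra_simps)
    then have "gr (X t) \<le> (1 - \<tau>) * gr (X s) + \<tau> * gr z" using G_convex(2)[OF XG[OF s01] z \<tau>] by simp
    also have "\<dots> = gr (X s) + \<tau> * (gr z - gr (X s))" by (simp add: algebra_simps)
    also have "\<dots> \<le> gr (X s) + \<tau> * \<bar>gr z - gr (X s)\<bar>" using \<tau> by (intro add_left_mono mult_left_mono) auto
    finally show ?thesis by (simp add: \<tau>_def)
  qed
  finally have "A t < gr (X s) + (t - s) * (\<bar>gr z - gr (X s)\<bar> / (1 - s))" .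
  moreover have "A s - A t \<le> k * \<bar>s - t\<bar>" by (rule A_lip[OF s01 t01])
  moreover have "(t - s) * q = k * \<bar>s - t\<bar> + (t - s) * (\<bar>gr z - gr (X s)\<bar> / (1 - s))"
    unfolding q_def using t by (simp add: distrib_left mult.commute)
  ultimately have "\<eta> < (t - s) * q" unfolding \<eta>_def by linarith
  also have "\<dots> \<le> (t - s) * (q + 1)" using t by (intro mult_left_mono) auto
  also have "\<dots> \<le> \<eta> / (q + 1) * (q + 1)"
  proof (intro mult_right_mono)
    have "m \<le> \<eta> / (q + 1)" by (simp add: m_def)
    then show "t - s \<le> \<eta> / (q + 1)" using h unfolding t_def by linarith
    show "0 \<le> q + 1" using q0 by simp
  qed
  also have "\<dots> = \<eta>" using q0 by simp
  finally show False by simp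
qed

text \<open>
  Otherwise both gaps between \<open>y\<close> and \<open>z\<close> are nonnegative, and the monotonicity hypothesis forces
  \<open>D z y \<le> 0\<close>.
\<close>
lemma iterates_comparable:
  assumes L\<beta>: "2 * L < \<beta>" and y: "y \<in> C" and z: "z \<in> C"
  shows "y \<in> closed_segment x' z \<or> z \<in> closed_segment x' y"
proof (rule ccontr)
  assume "\<not> ?thesis"
  then have off: "y \<notin> closed_segment x' z" "z \<notin> closed_segment x' y" by auto
  have "\<beta> * D z y \<le> F y \<bullet> (y - z) + gr y - gr z"
    by (rule A7_real[OF C_D(1)[OF z] y vi_gap_nonneg[OF L\<beta> y C_D(1)[OF z] off(1)]])
  moreover have "0 \<le> F y \<bullet> (z - y) + gr z - gr y"
    by (rule vi_gap_nonneg[OF L\<beta> z C_D(1)[OF y] off(2)])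
  ultimately have "\<beta> * D z y \<le> 0" by (simp add: inner_diff_right)
  then have "D z y \<le> 0" using A7(1) by (simp add: mult_le_0_iff)
  then have "(N (z - y))\<^sup>2 \<le> 0" using strongD[OF C_D(1)[OF z] y] by linarith
  then have "z = y" using is_norm_eq_0[OF norm, of "z - y"] by simp
  then show False using off by simp
qed

lemma iterates_on_ray:
  assumes L\<beta>: "2 * L < \<beta>"
  obtains v where "N v = 1" "\<And>y. y \<in> C \<Longrightarrow> y - x' = N (y - x') *\<^sub>R v"
proof -
  have unit: "N ((1 / N u) *\<^sub>R u) = 1" if "u \<noteq> 0" for u
    using that is_norm_eq_0[OF norm, of u] is_norm_nonneg[OF norm, of u] by (simp add: is_norm_scaleR[OF norm])
  show ?thesis
  proof (cases "\<exists>z\<in>C. z \<noteq> x'")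
    case False
    obtain u :: 'a where "u \<in> Basis" using nonempty_Basis by blast
    then have "u \<noteq> 0" by (auto simp: nonzero_Basis)
    then show ?thesis using False by (intro that[of "(1 / N u) *\<^sub>R u"] unit) (auto simp: is_norm_zero[OF norm])
  next
    case True
    then obtain z where z: "z \<in> C" "z \<noteq> x'" by blast
    define u where "u = z - x'"
    have u: "u \<noteq> 0" "0 < N u" using z is_norm_eq_0[OF norm, of u] is_norm_nonneg[OF norm, of u] by (auto simp: u_def)
    show ?thesis
    proof (rule that[of "(1 / N u) *\<^sub>R u"])
      show "N ((1 / N u) *\<^sub>R u) = 1" by (rule unit[OF u(1)])
      fix y assume y: "y \<in> C"
      have "\<exists>c\<ge>0. y - x' = c *\<^sub>R u"
        using iterates_comparable[OF L\<beta> y z(1)]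
      proof
        assume "y \<in> closed_segment x' z"
        then obtain c where "0 \<le> c" "y = (1 - c) *\<^sub>R x' + c *\<^sub>R z" by (auto simp: closed_segment_def)
        then show ?thesis by (intro exI[of _ c]) (simp add: u_def algebra_simps)
      next
        assume "z \<in> closed_segment x' y"
        then obtain c where c: "0 \<le> c" "z = (1 - c) *\<^sub>R x' + c *\<^sub>R y" by (auto simp: closed_segment_def)
        then have "u = c *\<^sub>R (y - x')" by (simp add: u_def algebra_simps)
        moreover from this have "c \<noteq> 0" using u by auto
        ultimately show ?thesis using c by (intro exI[of _ "1 / c"]) simp
      qed
      then obtain c where c: "c \<ge> 0" "y - x' = c *\<^sub>R u" by blast
      then have "N (y - x') = c * N u" by (simp add: is_norm_scaleR[OF norm])
      then show "y - x' = N (y - x') *\<^sub>R (1 / N u) *\<^sub>R u" using c u by simp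
    qed
  qed
qed

section \<open>The Markov chain before the coin toss\<close>

definition next_pt :: "'a \<Rightarrow> 'a \<Rightarrow> 'a \<Rightarrow> 'a \<Rightarrow> nat list \<Rightarrow> 'a" where
  "next_pt x xp w wp B = arg_min_on (step_objective K g f gradf F F\<xi> \<alpha> \<gamma> b (x, xp, w, wp) B) K"

text \<open>
  The state is \<open>(x\<^sub>s, x\<^sub>s\<^sub>-\<^sub>1, w\<^sub>s\<^sub>-\<^sub>1)\<close>, without \<open>w\<^sub>s\<close>: the coin choosing \<open>w\<^sub>s\<close> is tossed at the beginning of
  the step that uses it, where it is independent of the state and of the batch.
\<close>
definition precoin_step :: "'a \<times> 'a \<times> 'a \<Rightarrow> ('a \<times> 'a \<times> 'a) pmf" where
  "precoin_step = (\<lambda>(x, xp, wp). do {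
     coin \<leftarrow> bernoulli_pmf p;
     B \<leftarrow> batch x wp;
     return_pmf (next_pt x xp (if coin then x else xp) wp B, x, if coin then x else xp) })"

primrec precoin_law :: "nat \<Rightarrow> ('a \<times> 'a \<times> 'a) pmf" where
  "precoin_law 0 = return_pmf (x0, x0, x0)"
| "precoin_law (Suc s) = bind_pmf (precoin_law s) precoin_step"

text \<open>
  Delaying the coin is consistent at time 0, because there both of its outcomes give \<open>x0\<close>.
\<close>
lemma alg_law_precoin_law:
  "state_law s = do {
     (x, xp, wp) \<leftarrow> precoin_law s;
     coin \<leftarrow> bernoulli_pmf p;
     return_pmf (x, xp, if coin then x else xp, wp) }"
proof (induction s)
  case 0
  show ?case by (simp add: bind_return_pmf)
next
  case (Suc s)
  show ?case
    unfolding alg_law.simps Suc.IH precoin_law.simps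
    by (simp add: alg_step_def precoin_step_def next_pt_def bind_assoc_pmf bind_return_pmf Let_def split_def
        cong: if_cong)
qed

text \<open>
  The properties of a state that the analysis of a step needs, for both outcomes of the coin.
\<close>
definition reachable :: "'a \<Rightarrow> 'a \<Rightarrow> 'a \<Rightarrow> bool" where
  "reachable x xp wp \<longleftrightarrow> x \<in> C \<and> xp \<in> C \<and> wp \<in> C \<and>
     gradf (xbar K f gradf \<gamma> x xp) = mirror_mean gradf \<gamma> x xp \<and>
     (\<forall>w\<in>{x, xp}. \<forall>B\<in>set_pmf (batch x wp). next_pt x xp w wp B \<in> C \<and>
        is_prox (estimate x xp w wp B) (xbar K f gradf \<gamma> x xp) (next_pt x xp w wp B))"

lemma coin_in_support: "c \<in> set_pmf (bernoulli_pmf p)"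
  using p by (cases c) (auto simp: set_pmf_iff)

lemma precoin_law_in_alg_law:
  assumes "(x, xp, wp) \<in> set_pmf (precoin_law s)" and w: "w \<in> {x, xp}"
  shows "(x, xp, w, wp) \<in> set_pmf (state_law s)"
  unfolding alg_law_precoin_law using assms(1) w coin_in_support[of "w = x"]
  by (auto intro!: bexI[of _ "(x, xp, wp)"] bexI[of _ "w = x"])

lemma precoin_law_Suc_support:
  assumes "w \<in> {x, xp}" "(x, xp, wp) \<in> set_pmf (precoin_law s)" "B \<in> set_pmf (batch x wp)"
  shows "(next_pt x xp w wp B, x, w) \<in> set_pmf (precoin_law (Suc s))"
  using assms coin_in_support[of "w = x"]
  by (auto simp: precoin_step_def Let_def intro!: bexI[of _ "(x, xp, wp)"] bexI[of _ "w = x"] bexI[of _ B])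

lemma well_definedD:
  assumes st: "(x, xp, wp) \<in> set_pmf (precoin_law s)" and w: "w \<in> {x, xp}"
  shows "x \<in> dom_subdiff K f" "gradf (xbar K f gradf \<gamma> x xp) = mirror_mean gradf \<gamma> x xp"
    "B \<in> set_pmf (batch x wp) \<Longrightarrow>
       is_prox (estimate x xp w wp B) (xbar K f gradf \<gamma> x xp) (next_pt x xp w wp B)"
proof -
  have wd: "x \<in> dom_subdiff K f" "mirror_mean gradf \<gamma> x xp \<in> gradf ` dom_subdiff K f"
    "\<forall>B\<in>set_pmf (batch x wp).
           \<exists>z. is_arg_min (step_objective K g f gradf F F\<xi> \<alpha> \<gamma> b (x, xp, w, wp) B) (\<lambda>z. z \<in> K) z"
    using well_defined precoin_law_in_alg_law[OF st w] unfolding alg_well_defined_def by fastforce+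
  show "x \<in> dom_subdiff K f" by (rule wd(1))
  show "gradf (xbar K f gradf \<gamma> x xp) = mirror_mean gradf \<gamma> x xp"
    unfolding xbar_def by (rule f_inv_into_f[OF wd(2)])
  assume "B \<in> set_pmf (batch x wp)"
  with wd(3) have "\<exists>z. is_arg_min (step_objective K g f gradf F F\<xi> \<alpha> \<gamma> b (x, xp, w, wp) B) (\<lambda>z. z \<in> K) z" by blast
  from someI_ex[OF this]
  show "is_prox (estimate x xp w wp B) (xbar K f gradf \<gamma> x xp) (next_pt x xp w wp B)"
    unfolding next_pt_def arg_min_on_def arg_min_def step_objective_def by simp
qed

text \<open>
  The objective is finite at \<open>x0\<close>, hence also at its minimizer.
\<close>
lemma minimizer_in_G:
  assumes min: "is_prox d v y"
  shows "y \<in> G"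
proof (rule G_I)
  show "y \<in> K" using min by (simp add: is_arg_min_def)
  have x0G: "x0 \<in> G" using x0 by (simp add: G_def)
  have "\<not> prox_objective g f gradf \<alpha> d v x0 < prox_objective g f gradf \<alpha> d v y"
    using min G_D(1)[OF x0G] unfolding is_arg_min_def by blast
  moreover have "prox_objective g f gradf \<alpha> d v x0 < \<infinity>"
    unfolding prox_objective_def G_D(2)[OF x0G] by simp
  ultimately have "prox_objective g f gradf \<alpha> d v y \<noteq> \<infinity>" by auto
  moreover have "prox_objective g f gradf \<alpha> d v y = \<infinity>" if "g y = \<infinity>"
    unfolding prox_objective_def that using \<alpha> by simp
  ultimately show "g y < \<infinity>" by (cases "g y") auto
qed

lemma precoin_law_in_C:
  "(x, xp, wp) \<in> set_pmf (precoin_law s) \<Longrightarrow> x \<in> C \<and> xp \<in> C \<and> wp \<in> C"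
proof (induction s arbitrary: x xp wp)
  case 0
  then show ?case using x0 by (simp add: C_def G_def)
next
  case (Suc s)
  from Suc.prems obtain st1 where st1: "st1 \<in> set_pmf (precoin_law s)" "(x, xp, wp) \<in> set_pmf (precoin_step st1)"
    by auto
  obtain x1 xp1 wp1 where st1_eq: "st1 = (x1, xp1, wp1)" by (rule prod_cases3)
  have st: "(x1, xp1, wp1) \<in> set_pmf (precoin_law s)" using st1 st1_eq by simp
  obtain c B where B: "B \<in> set_pmf (batch x1 wp1)"
    and eq0: "(x, xp, wp) = (next_pt x1 xp1 (if c then x1 else xp1) wp1 B, x1, if c then x1 else xp1)"
    using st1(2) unfolding st1_eq precoin_step_def prod.case set_bind_pmf set_return_pmf by blast
  have eq': "x = next_pt x1 xp1 (if c then x1 else xp1) wp1 B" "xp = x1" "wp = (if c then x1 else xp1)"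
    using eq0 unfolding prod.inject by blast+
  define w1 where "w1 = (if c then x1 else xp1)"
  have w1: "w1 \<in> {x1, xp1}" by (simp add: w1_def)
  note eq = eq'[folded w1_def]
  have "x \<in> G" unfolding eq by (rule minimizer_in_G[OF well_definedD(3)[OF st w1 B]])
  moreover have "x \<in> dom_subdiff K f" by (rule well_definedD(1)[OF Suc.prems insertI1])
  ultimately show ?case using Suc.IH[OF st] w1 eq by (auto simp: C_def)
qed

lemma precoin_law_reachable:
  assumes st: "(x, xp, wp) \<in> set_pmf (precoin_law s)"
  shows "reachable x xp wp"
  unfolding reachable_def
  using precoin_law_in_C[OF st] well_definedD(2)[OF st] well_definedD(3)[OF st]
    precoin_law_in_C[OF precoin_law_Suc_support[OF _ st]] by blast

lemma oracle_support:
  assumes "x \<in> G" "y \<in> G"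
  shows "finite (set_pmf (Q x y))"
  using A3 assms unfolding variable_lipschitz_oracle_def G_def by (meson finite_atLeastAtMost finite_subset)

lemma oracle_mean: "x \<in> G \<Longrightarrow> y \<in> G \<Longrightarrow> z \<in> G \<Longrightarrow> F z = expect (Q x y) (\<lambda>\<xi>. F\<xi> \<xi> z)"
  using A3 unfolding variable_lipschitz_oracle_def G_def by blast

lemma oracle_lipschitz:
  "x \<in> G \<Longrightarrow> y \<in> G \<Longrightarrow> expect (Q x y) (\<lambda>\<xi>. (dual_norm N (F\<xi> \<xi> x - F\<xi> \<xi> y))\<^sup>2) \<le> Lbar\<^sup>2 * (N (x - y))\<^sup>2"
  using A3 unfolding variable_lipschitz_oracle_def G_def by blast

lemma finite_precoin_law: "finite (set_pmf (precoin_law s))"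
proof (induction s)
  case (Suc s)
  have "finite (set_pmf (precoin_step st))" if "st \<in> set_pmf (precoin_law s)" for st
  proof -
    obtain x xp wp where st: "st = (x, xp, wp)" by (cases st)
    then have "x \<in> G" "wp \<in> G" using precoin_law_in_C that C_D by blast+
    then show ?thesis using finite_replicate_pmf[OF oracle_support, of x wp b]
      by (auto simp: precoin_step_def st Let_def)
  qed
  with Suc show ?case by simp
qed simp

lemma expect_precoin_step:
  fixes V :: "'a \<times> 'a \<times> 'a \<Rightarrow> real"
  assumes r: "reachable x xp wp"
  shows "expect (precoin_step (x, xp, wp)) V
    = expect (batch x wp) (\<lambda>B. p * V (next_pt x xp x wp B, x, x) + (1 - p) * V (next_pt x xp xp wp B, x, xp))"
proof -
  have "finite (set_pmf (Q x wp))" using r oracle_support C_D by (auto simp: reachable_def)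
  note fin = finite_replicate_pmf[OF this, of b]
  show ?thesis using fin p by (simp add: precoin_step_def Let_def expect_bind expect_add)
qed

lemma expect_precoin_law_Suc:
  fixes V :: "'a \<times> 'a \<times> 'a \<Rightarrow> real"
  shows "expect (precoin_law (Suc s)) V = expect (precoin_law s) (\<lambda>st. expect (precoin_step st) V)"
  using finite_precoin_law[of s] finite_precoin_law[of "Suc s"] by (simp add: expect_bind)

section \<open>The noise of the batch estimate\<close>

text \<open>
  The error of the batch estimate is tested against a vector that depends on the same batch, so its
  expectation need not vanish.
\<close>
definition noise :: "'a \<Rightarrow> 'a \<Rightarrow> 'a \<Rightarrow> 'a \<Rightarrow> nat list \<Rightarrow> real" where
  "noise x xp w wp B = \<alpha> * ((estimate x xp w wp B - F w - (F x - F wp)) \<bullet> (x' - next_pt x xp w wp B))"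

lemma batch_estimate_eq:
  assumes "length B = b"
  shows "estimate x xp w wp B = F w + (1 / real b) *\<^sub>R (\<Sum>\<xi>\<leftarrow>B. F\<xi> \<xi> x - F\<xi> \<xi> wp)"
proof -
  have "(\<Sum>\<xi>\<leftarrow>B. F w + F\<xi> \<xi> x - F\<xi> \<xi> wp) = real (length B) *\<^sub>R F w + (\<Sum>\<xi>\<leftarrow>B. F\<xi> \<xi> x - F\<xi> \<xi> wp)"
    by (induction B) (auto simp: algebra_simps)
  then show ?thesis using b assms by (simp add: batch_estimate_def scaleR_add_right)
qed

lemma sum_list_map_update_diff:
  fixes X :: "nat \<Rightarrow> 'a"
  shows "i < length B \<Longrightarrow> (\<Sum>\<xi>\<leftarrow>B. X \<xi>) - (\<Sum>\<xi>\<leftarrow>B[i := \<zeta>]. X \<xi>) = X (B ! i) - X \<zeta>"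
proof (induction B arbitrary: i)
  case (Cons a B)
  then show ?case by (cases i) (auto simp: algebra_simps)
qed simp

text \<open>
  The functional \<open>\<Psi>\<close> measures oracle differences: the dual norm in general, and the modulus of the
  component along \<open>v\<close> when all iterates lie on a ray in direction \<open>v\<close>. The factor \<open>2 \<sigma>\<close> compares the mean
  square of the difference of two independent samples with the mean square of one sample.
\<close>
lemma noise_bound:
  assumes r: "reachable x xp wp" and w: "w \<in> {x, xp}"
    and \<Psi>: "\<And>d. 0 \<le> \<Psi> d" "\<And>d y1 y2. y1 \<in> C \<Longrightarrow> y2 \<in> C \<Longrightarrow> d \<bullet> (y2 - y1) \<le> \<Psi> d * N (y1 - y2)"
    and var: "expect (Q x wp) (\<lambda>\<zeta>. expect (Q x wp) (\<lambda>\<xi>. (\<Psi> ((F\<xi> \<zeta> x - F\<xi> \<zeta> wp) - (F\<xi> \<xi> x - F\<xi> \<xi> wp)))\<^sup>2))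
      \<le> 2 * \<sigma> * (Lbar\<^sup>2 * (N (x - wp))\<^sup>2)"
  shows "expect (batch x wp) (noise x xp w wp) \<le> \<sigma> * (\<alpha>\<^sup>2 * Lbar\<^sup>2 / real b) * (N (x - wp))\<^sup>2"
proof -
  define X where "X \<xi> = F\<xi> \<xi> x - F\<xi> \<xi> wp" for \<xi>
  define q where "q = Q x wp"
  define y where "y = next_pt x xp w wp"
  have xG: "x \<in> G" and wpG: "wp \<in> G" using r C_D by (auto simp: reachable_def)
  have fin: "finite (set_pmf q)" unfolding q_def by (rule oracle_support[OF xG wpG])
  have EX: "expect q X = F x - F wp" unfolding X_def[abs_def] q_def
    using oracle_mean[OF xG wpG xG] oracle_mean[OF xG wpG wpG] fin by (simp add: expect_diff q_def)
  have b0: "0 < real b" using b by simp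
  have "expect (replicate_pmf b q) (\<lambda>B. ((\<Sum>\<xi>\<leftarrow>B. X \<xi>) - real b *\<^sub>R expect q X) \<bullet> (x' - y B))
      \<le> real b * (\<alpha> / real b / 2 * expect q (\<lambda>\<zeta>. expect q (\<lambda>\<xi>. (\<Psi> (X \<zeta> - X \<xi>))\<^sup>2)))"
  proof (rule batch_noise_bound[OF fin])
    fix B i \<zeta> assume B: "B \<in> set_pmf (replicate_pmf b q)" and i: "i < b" and \<zeta>: "\<zeta> \<in> set_pmf q"
    have B': "B[i := \<zeta>] \<in> set_pmf (replicate_pmf b q)" by (rule replicate_pmf_update[OF B \<zeta>])
    have len: "length B = b" "length (B[i := \<zeta>]) = b" using length_replicate_pmf[OF B] by auto
    have C1: "y B \<in> C" "y (B[i := \<zeta>]) \<in> C" using r w B B' unfolding reachable_def y_def q_def by auto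
    define u where "u = N (y B - y (B[i := \<zeta>]))"
    have u0: "0 \<le> u" unfolding u_def by (rule is_norm_nonneg[OF norm])
    have dd: "estimate x xp w wp B - estimate x xp w wp (B[i := \<zeta>])
        = (1 / real b) *\<^sub>R (X (B ! i) - X \<zeta>)"
      unfolding batch_estimate_eq[OF len(1)] batch_estimate_eq[OF len(2)] add_diff_cancel_left
      unfolding scaleR_diff_right[symmetric] X_def[symmetric]
      by (subst sum_list_map_update_diff) (simp_all add: i len)
    have le: "(X (B ! i) - X \<zeta>) \<bullet> (y (B[i := \<zeta>]) - y B) \<le> \<Psi> (X (B ! i) - X \<zeta>) * u"
      unfolding u_def by (rule \<Psi>(2)[OF C1])
    have "u\<^sup>2 \<le> \<alpha> * (((1 / real b) *\<^sub>R (X (B ! i) - X \<zeta>)) \<bullet> (y (B[i := \<zeta>]) - y B))"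
      unfolding u_def dd[symmetric] using r w B B' C1
      by (intro prox_stable) (auto simp: reachable_def y_def q_def)
    also have "\<dots> = \<alpha> / real b * ((X (B ! i) - X \<zeta>) \<bullet> (y (B[i := \<zeta>]) - y B))" by simp
    also have "\<dots> \<le> \<alpha> / real b * (\<Psi> (X (B ! i) - X \<zeta>) * u)" using \<alpha> b0 le by (intro mult_left_mono) auto
    finally have "u * u \<le> (\<alpha> / real b * \<Psi> (X (B ! i) - X \<zeta>)) * u" by (simp add: power2_eq_square)
    moreover have "0 \<le> \<alpha> / real b * \<Psi> (X (B ! i) - X \<zeta>)" using \<alpha> b0 \<Psi>(1) by simp
    moreover have "u \<le> c" if "u * u \<le> c * u" "0 \<le> c" for c
      using that u0 by (cases "u = 0") (simp, metis less_le mult_right_le_imp_le)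
    ultimately have "u \<le> \<alpha> / real b * \<Psi> (X (B ! i) - X \<zeta>)" by blast
    then have "\<Psi> (X (B ! i) - X \<zeta>) * u \<le> \<Psi> (X (B ! i) - X \<zeta>) * (\<alpha> / real b * \<Psi> (X (B ! i) - X \<zeta>))"
      using \<Psi>(1) by (rule mult_left_mono)
    with le show "(X (B ! i) - X \<zeta>) \<bullet> (y (B[i := \<zeta>]) - y B) \<le> \<alpha> / real b * (\<Psi> (X (B ! i) - X \<zeta>))\<^sup>2"
      by (simp add: power2_eq_square mult_ac)
  qed
  also have "\<dots> \<le> real b * (\<alpha> / real b / 2 * (2 * \<sigma> * (Lbar\<^sup>2 * (N (x - wp))\<^sup>2)))"
    using var \<alpha> b0 unfolding q_def X_def by (intro mult_left_mono) auto
  also have "\<dots> = \<alpha> * \<sigma> * Lbar\<^sup>2 * (N (x - wp))\<^sup>2" using b0 by simp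
  finally have main: "expect (replicate_pmf b q) (\<lambda>B. ((\<Sum>\<xi>\<leftarrow>B. X \<xi>) - real b *\<^sub>R expect q X) \<bullet> (x' - y B))
      \<le> \<alpha> * \<sigma> * Lbar\<^sup>2 * (N (x - wp))\<^sup>2" .
  have "expect (replicate_pmf b q) (noise x xp w wp)
      = expect (replicate_pmf b q) (\<lambda>B. \<alpha> / real b * (((\<Sum>\<xi>\<leftarrow>B. X \<xi>) - real b *\<^sub>R expect q X) \<bullet> (x' - y B)))"
  proof (intro expect_cong)
    fix B assume "B \<in> set_pmf (replicate_pmf b q)"
    then have len: "length B = b" by (rule length_replicate_pmf)
    have "estimate x xp w wp B - F w - (F x - F wp)
        = (1 / real b) *\<^sub>R ((\<Sum>\<xi>\<leftarrow>B. X \<xi>) - real b *\<^sub>R expect q X)"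
      unfolding batch_estimate_eq[OF len] EX X_def[symmetric] using b0 by (simp add: scaleR_diff_right)
    then show "noise x xp w wp B = \<alpha> / real b * (((\<Sum>\<xi>\<leftarrow>B. X \<xi>) - real b *\<^sub>R expect q X) \<bullet> (x' - y B))"
      unfolding noise_def y_def by simp
  qed
  also have "\<dots> = \<alpha> / real b * expect (replicate_pmf b q) (\<lambda>B. ((\<Sum>\<xi>\<leftarrow>B. X \<xi>) - real b *\<^sub>R expect q X) \<bullet> (x' - y B))"
    by simp
  also have "\<dots> \<le> \<alpha> / real b * (\<alpha> * \<sigma> * Lbar\<^sup>2 * (N (x - wp))\<^sup>2)"
    using main \<alpha> b0 by (intro mult_left_mono) auto
  finally show ?thesis unfolding q_def by (simp add: power2_eq_square mult_ac)
qed

text \<open>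
  Here \<open>\<sigma> = 2\<close>, by the triangle inequality and \<open>(a + b)\<^sup>2 \<le> 2 a\<^sup>2 + 2 b\<^sup>2\<close>.
\<close>
lemma noise_bound_norm:
  assumes r: "reachable x xp wp" and w: "w \<in> {x, xp}"
  shows "expect (batch x wp) (noise x xp w wp) \<le> 2 * (\<alpha>\<^sup>2 * Lbar\<^sup>2 / real b) * (N (x - wp))\<^sup>2"
proof (rule noise_bound[OF r w, where \<Psi> = "dual_norm N"])
  show "0 \<le> dual_norm N d" for d by (rule dual_norm_nonneg[OF norm])
  show "d \<bullet> (y2 - y1) \<le> dual_norm N d * N (y1 - y2)" for d y1 y2
    using dual_norm_ineq[OF norm, of d "y2 - y1"] unfolding is_norm_commute[OF norm, of y2 y1] .
  have xG: "x \<in> G" and wpG: "wp \<in> G" using r C_D by (auto simp: reachable_def)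
  have fin: "finite (set_pmf (Q x wp))" by (rule oracle_support[OF xG wpG])
  define s where "s \<xi> = (dual_norm N (F\<xi> \<xi> x - F\<xi> \<xi> wp))\<^sup>2" for \<xi>
  have "expect (Q x wp) (\<lambda>\<zeta>. expect (Q x wp) (\<lambda>\<xi>. (dual_norm N ((F\<xi> \<zeta> x - F\<xi> \<zeta> wp) - (F\<xi> \<xi> x - F\<xi> \<xi> wp)))\<^sup>2))
      \<le> expect (Q x wp) (\<lambda>\<zeta>. expect (Q x wp) (\<lambda>\<xi>. 2 * s \<zeta> + 2 * s \<xi>))"
  proof (intro expect_mono fin)
    fix \<zeta> \<xi>
    define A B where "A = dual_norm N (F\<xi> \<zeta> x - F\<xi> \<zeta> wp)" and "B = dual_norm N (F\<xi> \<xi> x - F\<xi> \<xi> wp)"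
    have "(dual_norm N ((F\<xi> \<zeta> x - F\<xi> \<zeta> wp) - (F\<xi> \<xi> x - F\<xi> \<xi> wp)))\<^sup>2 \<le> (A + B)\<^sup>2"
      unfolding A_def B_def by (intro power_mono dual_norm_diff[OF norm] dual_norm_nonneg[OF norm])
    also have "\<dots> \<le> 2 * A\<^sup>2 + 2 * B\<^sup>2" using sum_squares_bound[of A B] by (simp add: power2_sum)
    finally show "(dual_norm N ((F\<xi> \<zeta> x - F\<xi> \<zeta> wp) - (F\<xi> \<xi> x - F\<xi> \<xi> wp)))\<^sup>2 \<le> 2 * s \<zeta> + 2 * s \<xi>"
      by (simp add: s_def A_def B_def)
  qed
  also have "\<dots> = 4 * expect (Q x wp) s" using fin by (simp add: expect_add)
  also have "expect (Q x wp) s \<le> Lbar\<^sup>2 * (N (x - wp))\<^sup>2" unfolding s_def[abs_def] by (rule oracle_lipschitz[OF xG wpG])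
  finally show "expect (Q x wp) (\<lambda>\<zeta>. expect (Q x wp) (\<lambda>\<xi>. (dual_norm N ((F\<xi> \<zeta> x - F\<xi> \<zeta> wp) - (F\<xi> \<xi> x - F\<xi> \<xi> wp)))\<^sup>2))
      \<le> 2 * 2 * (Lbar\<^sup>2 * (N (x - wp))\<^sup>2)" by simp
qed

text \<open>
  On a ray only a scalar component of the oracle matters, and for scalars the mean square of the
  difference is twice the variance; hence \<open>\<sigma> = 1\<close>.
\<close>
lemma noise_bound_ray:
  assumes r: "reachable x xp wp" and w: "w \<in> {x, xp}"
    and v: "N v = 1" "\<And>y. y \<in> C \<Longrightarrow> y - x' = N (y - x') *\<^sub>R v"
  shows "expect (batch x wp) (noise x xp w wp) \<le> 1 * (\<alpha>\<^sup>2 * Lbar\<^sup>2 / real b) * (N (x - wp))\<^sup>2"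
proof (rule noise_bound[OF r w, where \<Psi> = "\<lambda>d. \<bar>d \<bullet> v\<bar>"])
  show "0 \<le> \<bar>d \<bullet> v\<bar>" for d by simp
  show "d \<bullet> (y2 - y1) \<le> \<bar>d \<bullet> v\<bar> * N (y1 - y2)" if y: "y1 \<in> C" "y2 \<in> C" for d y1 y2
  proof -
    define c where "c = N (y2 - x') - N (y1 - x')"
    have "y2 - y1 = (y2 - x') - (y1 - x')" by simp
    also have "\<dots> = c *\<^sub>R v" by (subst v(2)[OF y(1)], subst v(2)[OF y(2)]) (simp add: c_def scaleR_diff_left)
    finally have e: "y2 - y1 = c *\<^sub>R v" .
    have "N (y1 - y2) = \<bar>c\<bar>" unfolding is_norm_commute[OF norm, of y1 y2] e is_norm_scaleR[OF norm] v(1) by simp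
    moreover have "d \<bullet> (y2 - y1) \<le> \<bar>c * (d \<bullet> v)\<bar>" unfolding e by simp
    ultimately show ?thesis by (simp add: abs_mult mult.commute)
  qed
  have xG: "x \<in> G" and wpG: "wp \<in> G" using r C_D by (auto simp: reachable_def)
  have fin: "finite (set_pmf (Q x wp))" by (rule oracle_support[OF xG wpG])
  define s where "s \<xi> = (F\<xi> \<xi> x - F\<xi> \<xi> wp) \<bullet> v" for \<xi>
  define S where "S \<xi> = (s \<xi>)\<^sup>2" for \<xi>
  have "expect (Q x wp) (\<lambda>\<zeta>. expect (Q x wp) (\<lambda>\<xi>. \<bar>((F\<xi> \<zeta> x - F\<xi> \<zeta> wp) - (F\<xi> \<xi> x - F\<xi> \<xi> wp)) \<bullet> v\<bar>\<^sup>2))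
      = expect (Q x wp) (\<lambda>\<zeta>. expect (Q x wp) (\<lambda>\<xi>. S \<zeta> + S \<xi> - 2 * s \<zeta> * s \<xi>))"
    unfolding S_def s_def power2_abs inner_diff_left[of "F\<xi> _ x - F\<xi> _ wp"] by (simp add: power2_diff)
  also have "\<dots> = 2 * expect (Q x wp) S - 2 * (expect (Q x wp) s)\<^sup>2"
    using fin by (simp add: expect_add expect_diff power2_eq_square)
  also have "\<dots> \<le> 2 * expect (Q x wp) S" by simp
  also have "expect (Q x wp) S \<le> expect (Q x wp) (\<lambda>\<xi>. (dual_norm N (F\<xi> \<xi> x - F\<xi> \<xi> wp))\<^sup>2)"
  proof (intro expect_mono fin)
    fix \<xi>
    have "s \<xi> \<le> dual_norm N (F\<xi> \<xi> x - F\<xi> \<xi> wp)" unfolding s_def by (rule dual_norm_upper[OF norm]) (simp add: v)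
    moreover have "- s \<xi> \<le> dual_norm N (F\<xi> \<xi> x - F\<xi> \<xi> wp)"
      unfolding s_def inner_minus_right[symmetric] by (rule dual_norm_upper[OF norm]) (simp add: v is_norm_minus[OF norm])
    ultimately have "\<bar>s \<xi>\<bar> \<le> dual_norm N (F\<xi> \<xi> x - F\<xi> \<xi> wp)" by simp
    then show "S \<xi> \<le> (dual_norm N (F\<xi> \<xi> x - F\<xi> \<xi> wp))\<^sup>2"
      unfolding S_def by (metis abs_ge_zero power2_abs power_mono)
  qed
  also have "\<dots> \<le> Lbar\<^sup>2 * (N (x - wp))\<^sup>2" by (rule oracle_lipschitz[OF xG wpG])
  finally show "expect (Q x wp) (\<lambda>\<zeta>. expect (Q x wp) (\<lambda>\<xi>. \<bar>((F\<xi> \<zeta> x - F\<xi> \<zeta> wp) - (F\<xi> \<xi> x - F\<xi> \<xi> wp)) \<bullet> v\<bar>\<^sup>2))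
      \<le> 2 * 1 * (Lbar\<^sup>2 * (N (x - wp))\<^sup>2)" by simp
qed

section \<open>From contraction to a rate\<close>

text \<open>
  The bound is required for each batch and averaged over the coin only, so that the two
  outcomes of the coin may be compared with each other for the same batch.
\<close>
lemma expect_step_le:
  fixes V :: "'a \<times> 'a \<times> 'a \<Rightarrow> real"
  assumes r: "reachable x xp wp"
    and pointwise: "\<And>B. B \<in> set_pmf (batch x wp) \<Longrightarrow>
      p * V (next_pt x xp x wp B, x, x) + (1 - p) * V (next_pt x xp xp wp B, x, xp)
        \<le> W + (p * noise x xp x wp B + (1 - p) * noise x xp xp wp B)"
    and noise: "\<And>w. w \<in> {x, xp} \<Longrightarrow> expect (batch x wp) (noise x xp w wp) \<le> e"
  shows "expect (precoin_step (x, xp, wp)) V \<le> W + e"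
proof -
  have "finite (set_pmf (Q x wp))" using r oracle_support C_D by (auto simp: reachable_def)
  note fin = finite_replicate_pmf[OF this, of b]
  let ?E = "expect (batch x wp)"
  have "expect (precoin_step (x, xp, wp)) V \<le> ?E (\<lambda>B. W + (p * noise x xp x wp B + (1 - p) * noise x xp xp wp B))"
    unfolding expect_precoin_step[OF r] by (intro expect_mono fin pointwise)
  also have "\<dots> = W + (p * ?E (noise x xp x wp) + (1 - p) * ?E (noise x xp xp wp))"
    using fin by (simp add: expect_add)
  also have "\<dots> \<le> W + (p * e + (1 - p) * e)"
    using noise p by (intro add_mono mult_left_mono) auto
  finally show ?thesis by (simp add: algebra_simps)
qed

text \<open>
  The first step is estimated separately: its state \<open>(x0, x0, x0)\<close> has no noise and no drift, so the
  expected potential after it is bounded directly by a multiple of \<open>D x' x0\<close>. The constant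
  \<open>4 / \<mu>\<close> of the final rate enters through this bound.
\<close>
lemma decay:
  fixes V :: "'a \<times> 'a \<times> 'a \<Rightarrow> real"
  assumes la: "0 < la" and \<mu>: "0 < \<mu>" "\<mu> \<le> 2" and \<kappa>: "0 < \<kappa>"
    and contraction: "\<And>x xp wp. reachable x xp wp \<Longrightarrow> expect (precoin_step (x, xp, wp)) V \<le> la * V (x, xp, wp)"
    and lower: "\<And>x xp wp. reachable x xp wp \<Longrightarrow> \<kappa> * (N (x' - x))\<^sup>2 \<le> V (x, xp, wp)"
    and start: "expect (precoin_step (x0, x0, x0)) V \<le> E1" "E1 * \<mu> \<le> 4 * (la * \<kappa>) * D x' x0"
  shows "expect (precoin_law s) (\<lambda>(x, xp, wp). (N (x' - x))\<^sup>2) \<le> la ^ s * (4 * D x' x0 / \<mu>)"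
proof (cases s)
  case 0
  have x0C: "x0 \<in> C" using x0 by (simp add: C_def G_def)
  have "(N (x' - x0))\<^sup>2 \<le> 2 * D x' x0" by (rule strongD[OF x'_G x0C])
  also have "\<dots> = 4 * D x' x0 / 2" by simp
  also have "\<dots> \<le> 4 * D x' x0 / \<mu>" using \<mu> D_nonneg[OF x'_G x0C] by (intro divide_left_mono) auto
  finally show ?thesis using 0 by simp
next
  case (Suc n)
  have V: "expect (precoin_law (Suc j)) V \<le> la ^ j * E1" for j
  proof (induction j)
    case 0
    have "expect (precoin_law (Suc 0)) V = expect (precoin_step (x0, x0, x0)) V" unfolding expect_precoin_law_Suc by simp
    then show ?case using start(1) by simp
  next
    case (Suc j)
    have "expect (precoin_law (Suc (Suc j))) V = expect (precoin_law (Suc j)) (\<lambda>st. expect (precoin_step st) V)"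
      by (rule expect_precoin_law_Suc)
    also have "\<dots> \<le> expect (precoin_law (Suc j)) (\<lambda>st. la * V st)"
    proof (rule expect_mono[OF finite_precoin_law])
      fix st assume "st \<in> set_pmf (precoin_law (Suc j))"
      then show "expect (precoin_step st) V \<le> la * V st"
        using contraction[OF precoin_law_reachable[of _ _ _ "Suc j"]] by (metis prod_cases3)
    qed
    also have "\<dots> = la * expect (precoin_law (Suc j)) V" by simp
    also have "\<dots> \<le> la * (la ^ j * E1)" using Suc la by (intro mult_left_mono) auto
    finally show ?case by simp
  qed
  define h where "h = (\<lambda>(x, xp :: 'a, wp :: 'a). (N (x' - x))\<^sup>2)"
  have "\<kappa> * expect (precoin_law s) h = expect (precoin_law s) (\<lambda>st. \<kappa> * h st)" by simp
  also have "\<dots> \<le> expect (precoin_law s) V"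
  proof (rule expect_mono[OF finite_precoin_law])
    fix st assume "st \<in> set_pmf (precoin_law s)"
    then show "\<kappa> * h st \<le> V st"
      using lower[OF precoin_law_reachable[of _ _ _ s]] by (cases st) (simp add: h_def)
  qed
  also have "\<dots> \<le> la ^ n * E1" unfolding Suc by (rule V)
  also have "\<dots> \<le> la ^ n * (4 * (la * \<kappa>) * D x' x0 / \<mu>)"
    using start(2) \<mu> la by (intro mult_left_mono) (auto simp: pos_le_divide_eq)
  also have "\<dots> = \<kappa> * (la ^ s * (4 * D x' x0 / \<mu>))" unfolding Suc by (simp add: mult_ac)
  finally have "expect (precoin_law s) h \<le> la ^ s * (4 * D x' x0 / \<mu>)" by (rule mult_left_le_imp_le[OF _ \<kappa>])
  then show ?thesis unfolding h_def .
qed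

text \<open>
  The law of \<open>x\<^sub>s\<close> is not affected by the coin, and \<open>(E r)\<^sup>2 \<le> E r\<^sup>2\<close>.
\<close>
lemma rate_bound:
  assumes E: "expect (precoin_law s) (\<lambda>(x, xp, wp). (N (x' - x))\<^sup>2) \<le> R"
  shows "expect (state_law s) (\<lambda>(x, xp, w, wp). N (x' - x)) \<le> sqrt R"
proof -
  let ?h = "\<lambda>(x, xp, wp). N (x' - x)"
  note fin = finite_precoin_law[of s]
  define m where "m = expect (precoin_law s) ?h"
  have "expect (state_law s) (\<lambda>(x, xp, w, wp). N (x' - x)) = m"
    unfolding alg_law_precoin_law m_def using fin
    by (subst expect_bind) (auto intro!: expect_cong simp: expect_bind split: prod.splits)
  moreover have "m\<^sup>2 \<le> R"
  proof -
    have "0 \<le> expect (precoin_law s) (\<lambda>st. (?h st - m)\<^sup>2)" by simp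
    also have "\<dots> = expect (precoin_law s) (\<lambda>st. ((?h st)\<^sup>2 + m\<^sup>2) - 2 * m * ?h st)"
      by (simp add: power2_diff mult_ac)
    also have "\<dots> = expect (precoin_law s) (\<lambda>st. (?h st)\<^sup>2) + m\<^sup>2 - 2 * m * m"
      using fin by (simp add: expect_diff expect_add m_def)
    also have "expect (precoin_law s) (\<lambda>st. (?h st)\<^sup>2) = expect (precoin_law s) (\<lambda>(x, xp, wp). (N (x' - x))\<^sup>2)"
      by (intro expect_cong) auto
    finally show ?thesis using E by (simp add: power2_eq_square)
  qed
  ultimately show ?thesis using real_le_rsqrt by metis
qed

end

section \<open>Constants for the ray\<close>

text \<open>
  Since \<open>s (1 - s) \<le> 1/4\<close> for \<open>s = \<lambda> \<tau>\<close>, the left side is at most \<open>\<tau> (1 + \<lambda>)\<^sup>2 (1 - s) / 4\<close>, which is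
  quadratic in \<open>\<tau>\<close>.
\<close>
lemma coin_budget_poly:
  fixes la tau :: real
  assumes la: "0 \<le> la" "la \<le> 1" and tau: "0 \<le> tau" "tau \<le> 1"
  shows "la*(tau*(1-la*tau)*(1+la))^2 \<le> (3-2*la)*(la/4+(1-tau)/2) + tau*(1-la)^3/2"
proof -
  define s where "s = la*tau"
  have s: "0 \<le> s" "s \<le> 1" using la tau by (auto simp: s_def mult_le_one)
  have "4*(s*(1-s)) = 1 - (1-2 * s)^2" by algebra
  then have "s*(1-s) \<le> 1/4" using zero_le_power2[of "1-2 * s"] by linarith
  then have "tau*(1+la)^2*(1-s)*(s*(1-s)) \<le> tau*(1+la)^2*(1-s)*(1/4)"
    using tau s by (intro mult_left_mono) auto
  moreover have "la*(tau*(1-la*tau)*(1+la))^2 = tau*(1+la)^2*(1-s)*(s*(1-s))"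
    unfolding s_def by algebra
  ultimately have 1: "la*(tau*(1-la*tau)*(1+la))^2 \<le> tau*(1+la)^2*(1-s)/4" by simp
  \<comment> \<open>Apart from a multiple of \<open>(\<tau> - 3/4)\<^sup>2\<close>, the difference of the two sides (times 4)
    is affine in \<open>\<tau>\<close>, with end values \<open>U0\<close> and \<open>U1\<close>.\<close>
  define U0 where "U0 = (3-2*la)*(la+2) - 9/16*la*(1+la)^2"
  define U1 where "U1 = 11/4*(la-1/2)^2 + la/64 + 3/64 + 17/16*(1-la)*(la-1/2)^2"
  have "0 \<le> U0"
  proof -
    have "la*(1+la)^2 \<le> 1*2^2" using la by (intro mult_mono power_mono) auto
    moreover have "3*1 \<le> 3 + (1-la)*(3+2*la)" using la by simp
    moreover have "(3-2*la)*(la+2) = 3 + (1-la)*(3+2*la)" by algebra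
    ultimately show ?thesis unfolding U0_def by simp
  qed
  moreover have "0 \<le> U1" unfolding U1_def using la by simp
  ultimately have "0 \<le> (1-tau)*U0 + tau*U1 + la*(1+la)^2*(tau-3/4)^2" using la tau by simp
  also have "\<dots> = (3-2*la)*(la+2*(1-tau)) + 2*tau*(1-la)^3 - tau*(1+la)^2*(1-s)"
    unfolding U0_def U1_def s_def by (simp add: field_simps power2_eq_square power3_eq_cube)
  also have "(3-2*la)*(la+2*(1-tau)) = 4*((3-2*la)*(la/4+(1-tau)/2))" by algebra
  finally show ?thesis using 1 by linarith
qed

lemma start_noise_poly:
  fixes la tau :: real
  assumes la: "0 \<le> la" "la \<le> 1" and tau: "0 \<le> tau" "tau \<le> 1"
  shows "4*tau*(1-la*tau)^2 \<le> (3-2*la)*((1-la)*(3-la)+(1-tau))"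
proof (cases "la \<le> 1/2")
  case True
  have s: "0 \<le> 1-la*tau" "1-la*tau \<le> 1" using la tau by (auto simp: mult_le_one)
  have "(1-la*tau)^2 \<le> 1-la*tau" using s by (simp add: power2_eq_square mult_left_le)
  then have "4*tau*(1-la*tau)^2 \<le> 4*tau*(1-la*tau)" using tau by (intro mult_left_mono) auto
  also have "\<dots> = 4*tau*(1-la) + 4*tau*la*(1-tau)" by (simp add: algebra_simps)
  also have "\<dots> \<le> 5*(1-la) + 2*(1-tau)"
  proof (intro add_mono mult_right_mono)
    show "4*tau*la \<le> 2" using mult_mono[of tau 1 la "1/2"] True la tau by linarith
  qed (use la tau in auto)
  also have "\<dots> \<le> (3-2*la)*(3-la)*(1-la) + (3-2*la)*(1-tau)"
  proof (intro add_mono mult_right_mono)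
    show "5 \<le> (3-2*la)*(3-la)" using mult_mono[of 2 "3-2*la" "5/2" "3-la"] True la by linarith
  qed (use la tau True in auto)
  finally show ?thesis by (simp add: algebra_simps)
next
  case False
  define s where "s = la*tau"
  have s: "0 \<le> s" "s \<le> 1" using la tau by (auto simp: s_def mult_le_one)
  have "4*(s*(1-s)) = 1 - (1-2 * s)^2" by algebra
  then have q: "4*(s*(1-s)) \<le> 1" using zero_le_power2[of "1-2 * s"] by linarith
  have "la*(4*tau*(1-la*tau)^2) = (4*(s*(1-s)))*(1-s)" unfolding s_def by algebra
  also have "\<dots> \<le> 1*(1-s)" using q s by (intro mult_right_mono) auto
  also have "\<dots> \<le> 1*((1-la)*(3-la)+(1-tau))"
  proof -
    have "tau*(1-la) \<le> (3-la)*(1-la)" using la tau by (intro mult_right_mono) auto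
    then show ?thesis unfolding s_def by (simp add: algebra_simps)
  qed
  also have "\<dots> \<le> (la*(3-2*la))*((1-la)*(3-la)+(1-tau))"
  proof (intro mult_right_mono)
    have "la*(3-2*la) = 1 + (2*la-1)*(1-la)" by algebra
    then show "1 \<le> la*(3-2*la)" using False la by simp
  qed (use la tau in simp)
  finally show ?thesis using False by (simp add: mult.assoc)
qed

text \<open>
  The left side bounds the price for comparing the two coin outcomes, the right side is the slack that
  the potential leaves for it. Young's inequality splits the price into \<open>\<alpha>/4 + l X\<^sup>2\<close>, where the
  constraint \<open>l (3 - 2 \<lambda>) \<le> \<lambda> c\<close> reduces the second part to \<open>coin_budget_poly\<close>.
\<close>
lemma ray_coin_budget:
  fixes la tau c p al l k :: real
  assumes la: "0 < la" "la < 1" and tau: "0 < tau" "tau \<le> 1" and c: "0 < c" "c < 1"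
    and p: "0 < p" "p = 1 - la*tau/c" and al: "0 < al" "al \<le> 1 - c" and l: "0 \<le> l" "l*(3-2*la) \<le> la*c"
    and k: "0 \<le> k" "k^2 = al*l"
  shows "tau*p*k*(1+la) \<le> la/4 + (1-tau)/2 + al/4*(1-la) + tau*(1-la)^3*l/(2*la*c)"
proof -
  define X where "X = tau*p*(1+la)"
  have X0: "0 \<le> X" unfolding X_def using tau p la by simp
  have pp: "p \<le> 1 - la*tau"
  proof -
    have "la*tau*1 \<le> la*tau*(1/c)" using la tau c by (intro mult_left_mono) auto
    then show ?thesis unfolding p(2) by simp
  qed
  have X1: "X \<le> tau*(1-la*tau)*(1+la)" unfolding X_def using pp tau la by (intro mult_right_mono mult_left_mono) auto
  have "k*X \<le> al/4 + l*X^2"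
  proof (rule power2_le_imp_le)
    have "(k*X)^2 = al*l*X^2" using k by (simp add: power_mult_distrib)
    moreover have "(al/4 + l*X^2)^2 - al*l*X^2 = (al/4 - l*X^2)^2" by (simp add: power2_eq_square field_simps)
    ultimately show "(k*X)^2 \<le> (al/4 + l*X^2)^2" using zero_le_power2[of "al/4 - l*X^2"] by linarith
  qed (use al l in simp)
  moreover have "l*X^2 \<le> c*la/4 + c*((1-tau)/2) + tau*(1-la)^3*l/(2*la*c)"
  proof -
    \<comment> \<open>The last term of the goal takes care of the part \<open>\<tau> (1 - \<lambda>)\<^sup>3 / (2 \<lambda>)\<close> of \<open>X\<^sup>2\<close>;
      only the excess \<open>E\<close> has to be paid from the rest.\<close>
    define E where "E = X^2 - tau*(1-la)^3/(2*la)"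
    have "tau*(1-la)^3*l/(2*la)*1 \<le> tau*(1-la)^3*l/(2*la)*(1/c)"
      using tau la l c by (intro mult_left_mono) auto
    moreover have "l*X^2 - l*E = tau*(1-la)^3*l/(2*la)*1" unfolding E_def by (simp add: right_diff_distrib)
    moreover have "tau*(1-la)^3*l/(2*la)*(1/c) = tau*(1-la)^3*l/(2*la*c)" by simp
    ultimately have g: "l*X^2 - l*E \<le> tau*(1-la)^3*l/(2*la*c)" by linarith
    have "l*E \<le> c*(la/4 + (1-tau)/2)"
    proof (cases "E \<le> 0")
      case True
      then have "l*E \<le> 0" using l by (simp add: mult_nonneg_nonpos)
      also have "0 \<le> c*(la/4 + (1-tau)/2)" using c la tau by simp
      finally show ?thesis .
    next
      case False
      have "la*X^2 \<le> la*(tau*(1-la*tau)*(1+la))^2" using X0 X1 la by (intro mult_left_mono power_mono) auto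
      also have "\<dots> \<le> (3-2*la)*(la/4+(1-tau)/2) + tau*(1-la)^3/2" using la tau by (intro coin_budget_poly) auto
      moreover have "la*E = la*X^2 - tau*(1-la)^3/2" unfolding E_def using la by (simp add: field_simps)
      ultimately have "la*E \<le> (3-2*la)*(la/4+(1-tau)/2)" by linarith
      then have "c*(la*E) \<le> c*((3-2*la)*(la/4+(1-tau)/2))" using c by (intro mult_left_mono) auto
      moreover have "(l*(3-2*la))*E \<le> (la*c)*E" using l False by (intro mult_right_mono) auto
      moreover have "(l*(3-2*la))*E = (3-2*la)*(l*E)" "(la*c)*E = c*(la*E)"
        "c*((3-2*la)*(la/4+(1-tau)/2)) = (3-2*la)*(c*(la/4 + (1-tau)/2))" by simp_all
      ultimately have "(3-2*la)*(l*E) \<le> (3-2*la)*(c*(la/4 + (1-tau)/2))" by linarith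
      then show ?thesis using la by simp
    qed
    moreover have "c*(la/4 + (1-tau)/2) = c*la/4 + c*((1-tau)/2)" by (simp add: field_simps)
    ultimately show ?thesis using g by linarith
  qed
  moreover have "c*((1-tau)/2) \<le> (1-tau)/2" using c tau by (simp add: mult_left_le_one_le)
  moreover have "al*la \<le> (1-c)*la" using al la by (intro mult_right_mono) auto
  moreover have "al/4*(1-la) = al/4 - al*la/4" "(1-c)*la = la - c*la" "k*X = tau*p*k*(1+la)"
    unfolding X_def by (simp_all add: field_simps)
  ultimately show ?thesis by linarith
qed

text \<open>
  The coefficients of the potential in the case where all iterates lie on a ray; \<open>a\<close>, \<open>k\<close>, \<open>l\<close>, \<open>n\<close> stand for
  \<open>\<alpha> \<beta>\<close>, \<open>\<alpha> L\<close>, \<open>\<alpha> L\<^sup>2\<close>, \<open>\<alpha>\<^sup>2 Lbar\<^sup>2 / b\<close>. Nearly all choices are forced: \<open>c1\<close> and \<open>c2\<close> are the mean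
  coefficients of the mixed terms, \<open>A\<close> cancels the square of the new radius, \<open>B\<close> is the least value
  that absorbs the square of \<open>x\<^sub>p\<close>. The free parameter is \<open>R\<close>. It is taken a little below half of
  \<open>c = (1 - g) / (1 - p)\<close>, which suffices for the noise and the drift. What remains to
  be checked is that the square of \<open>x\<close> is absorbed (\<open>ray_coin_budget\<close>) and that the first step meets the
  constant \<open>4 / (1 + g - \<alpha>)\<close> of the rate.
\<close>
lemma ray_constants:
  fixes g p al la k l n a :: real
  assumes p: "0 < p" "p < 1" and g: "p < g" "g < 1" and al: "0 < al" "al \<le> (g-p)/(1-p)"
    and la: "0 < la" "la < 1" and tl: "1 - g \<le> la" and n: "0 \<le> n"
    and k: "0 \<le> k" "k^2 = al*l" and l: "0 \<le> l" "2*n + l*(3-2*la) \<le> la*((1-g)/(1-p))"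
    and a1: "1+g+al/2 \<le> la*(1/2+a+al/2)"
  defines "t \<equiv> 1 - g"
  obtains R A B c1 c2 where "l/2 \<le> R" "n + l/2 \<le> la*R" "0 \<le> c1" "0 \<le> c2" "0 \<le> B"
    "c1 = g - al*la - 2*R*p" "c2 = t - 2*R*(1-p)"
    "A + R - 1 - a/2 + al/2 = -(c1/2 + c2/(2*la))"
    "R*(1-p) + 2*R*p*(1-p)*k + c2*la/2 \<le> la*B"
    "R*p + 2*R*p*(1-p)*k + B + al*la^2/2 + c1/2 \<le> la*A"
    "(1+t/la)*(1+g-al) \<le> 4*(la*(A-al/2))"
    "(R + B + al*la^2/2 + c1/2 + la*c2/2)*(1+g-al) \<le> 2*(la*(A-al/2))"
    "(g+t/la)/la \<le> 1 + a"
proof -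
  define c where "c = t/(1-p)"
  define tau where "tau = t/la"
  have t0: "0 < t" using g by (simp add: t_def)
  have g0: "0 < g" using p g by simp
  have c0: "0 < c" using t0 p by (simp add: c_def)
  have ct: "c*(1-p) = t" using p by (simp add: c_def)
  have c1': "1 - c = (g-p)/(1-p)" using p unfolding c_def t_def by (simp add: field_simps)
  have alc: "al \<le> 1 - c" using al c1' by simp
  have cl1: "c < 1" using alc al by simp
  have tau: "0 < tau" "tau \<le> 1" "la*tau = t" using t0 la tl by (auto simp: tau_def t_def)
  have p2: "p = 1 - la*tau/c" using c0 ct tau by (simp add: field_simps)
  have l2: "l*(3-2*la) \<le> la*c" using l n unfolding c_def t_def by simp
  \<comment> \<open>\<open>R = c (1/2 - ze)\<close>; the correction \<open>ze\<close> never exceeds \<open>1/6\<close>.\<close>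
  define ze where "ze = (1-la)*l/(2*la*c)"
  have ze0: "0 \<le> ze" using la l c0 by (simp add: ze_def)
  have ze6: "ze \<le> 1/6"
  proof -
    have "l*(3-3*la) \<le> l*(3-2*la)" using l la by (intro mult_left_mono) auto
    then have "3*((1-la)*l) \<le> la*c" using l2 by (simp add: algebra_simps)
    then show ?thesis using la c0 unfolding ze_def by (simp add: field_simps)
  qed
  define R where "R = c*(1/2 - ze)"
  have R': "la*R = la*c/2 - (1-la)*l/2" using la c0 unfolding R_def ze_def by (simp add: field_simps)
  have R3: "c/3 \<le> R" using ze6 c0 mult_left_mono[of "1/3" "1/2-ze" c] unfolding R_def by simp
  have R2: "2*R \<le> c" using ze0 c0 unfolding R_def by (simp add: algebra_simps)
  have R0: "0 < R" using R3 c0 by simp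
  have laR: "n + l/2 \<le> la*R"
  proof -
    have "2*n + l*(3-2*la) \<le> la*c" using l unfolding c_def t_def by simp
    moreover have "la*l \<le> 1*l" using l la by (intro mult_right_mono) auto
    ultimately show ?thesis unfolding R' by (simp add: field_simps)
  qed
  define Rq where "Rq = R*(1-p)"
  have Rq: "Rq = t*(1/2-ze)" unfolding Rq_def R_def ct[symmetric] by simp
  have Rq3: "t/3 \<le> Rq" using ze6 t0 mult_left_mono[of "1/3" "1/2-ze" t] unfolding Rq by simp
  \<comment> \<open>The price for comparing the two outcomes of the coin.\<close>
  define chi where "chi = 2*R*p*(1-p)*k"
  have chi0: "0 \<le> chi" using R0 p k by (simp add: chi_def)
  have chi: "chi/la \<le> tau*p*k"
  proof -
    have "2*R*((1-p)*p*k) \<le> c*((1-p)*p*k)" using R2 p k by (intro mult_right_mono) auto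
    also have "\<dots> = la*(tau*p*k)" unfolding tau(3)[symmetric] ct[symmetric] using ct tau by (simp add: mult.assoc[symmetric])
    finally show ?thesis using la unfolding chi_def by (simp add: field_simps)
  qed
  define c1 where "c1 = g - al*la - 2*R*p"
  define c2 where "c2 = t - 2*R*(1-p)"
  have c10: "0 \<le> c1"
  proof -
    have "2*R*p \<le> c*p" using R2 p by (intro mult_right_mono) auto
    moreover have "c*p = c - t" using ct by (simp add: algebra_simps)
    moreover have "al*la \<le> al" using al la by (simp add: mult_left_le)
    ultimately show ?thesis using alc unfolding c1_def t_def by linarith
  qed
  have c20: "0 \<le> c2"
  proof -
    have "2*R*(1-p) \<le> c*(1-p)" using R2 p by (intro mult_right_mono) auto
    then show ?thesis unfolding c2_def ct by simp
  qed
  have c2': "c2 = t - 2*Rq" by (simp add: c2_def Rq_def)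
  have c1'': "c1 = g - al*la - 2*R + 2*Rq" by (simp add: c1_def Rq_def algebra_simps)
  define A where "A = 1 + a/2 - R - al/2 - (c1/2 + c2/(2*la))"
  define B where "B = (Rq + chi)/la + c2/2"
  \<comment> \<open>The lower bound for \<open>\<lambda> (1 + a / 2)\<close> that the hypothesis on \<open>a\<close> provides.\<close>
  define HH where "HH = 3/4*la + (1+g)/2 + al/4*(1-la)"
  have HH: "HH \<le> la*(1+a/2)" using a1 unfolding HH_def by (simp add: field_simps)
  have laA: "la*A = la*(1+a/2) - la*R - al*la/2 - la*c1/2 - c2/2"
    using la unfolding A_def by (simp add: field_simps)
  have g': "g = 1 - la*tau" using tau by (simp add: t_def)
  show ?thesis
  proof (rule that[of R c1 c2 B A])
    show "l/2 \<le> R"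
    proof -
      have "la*R \<le> R" using la R0 by simp
      with laR n show ?thesis by simp
    qed
    show "n + l/2 \<le> la*R" by (rule laR)
    show "0 \<le> c1" by (rule c10)
    show "0 \<le> c2" by (rule c20)
    show B0: "0 \<le> B" unfolding B_def using Rq3 t0 chi0 la c20 by simp
    show "c1 = g - al*la - 2*R*p" by (rule c1_def)
    show "c2 = t - 2*R*(1-p)" by (rule c2_def)
    show "A + R - 1 - a/2 + al/2 = -(c1/2 + c2/(2*la))" by (simp add: A_def)
    show "R*(1-p) + 2*R*p*(1-p)*k + c2*la/2 \<le> la*B"
      unfolding chi_def[symmetric] Rq_def[symmetric] B_def using la by (simp add: field_simps)
    show "R*p + 2*R*p*(1-p)*k + B + al*la^2/2 + c1/2 \<le> la*A"
    proof -
      have m: "tau*p*k*(1+la) \<le> la/4 + (1-tau)/2 + al/4*(1-la) + tau*(1-la)^3*l/(2*la*c)"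
        using la tau c0 cl1 p p2 al alc l l2 k by (intro ray_coin_budget) auto
      have ch: "chi/la*(1+la) \<le> tau*p*k*(1+la)" using chi la by (intro mult_right_mono) auto
      have Rp: "R*p = R - Rq" by (simp add: Rq_def algebra_simps)
      have "tau*(1-la)^3*l/(2*la*c) = ze*tau*(1-la)^2" unfolding ze_def
        by (simp add: power2_eq_square power3_eq_cube)
      moreover have "HH - la*R - al*la/2 - la*c1/2 - c2/2 - (R*p + B + al*la^2/2 + c1/2 + chi)
         = la/4 + (1-tau)/2 + al/4*(1-la) + ze*tau*(1-la)^2 - chi/la*(1+la)"
        unfolding B_def HH_def c1'' c2' Rp Rq g' tau(3)[symmetric] using la
        by (simp add: field_simps power2_eq_square)
      ultimately show ?thesis using m ch HH laA unfolding chi_def[symmetric] by linarith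
    qed
    define QQ where "QQ = la*(A-al/2)"
    have Q: "1 + la/4 - la*tau + la^2*tau/2 + Rq*(1-la) + al*(1/4 - 5/4*la + la^2/2) \<le> QQ"
    proof -
      have "HH - la*R - al*la/2 - la*c1/2 - c2/2 - la*al/2
         = 1 + la/4 - la*tau + la^2*tau/2 + Rq*(1-la) + al*(1/4 - 5/4*la + la^2/2)"
        unfolding HH_def c1'' c2' g' tau(3)[symmetric] by (simp add: field_simps power2_eq_square)
      with HH laA show ?thesis unfolding QQ_def by (simp add: right_diff_distrib)
    qed
    have al1: "al \<le> 1" using alc c0 by simp
    show "(1+t/la)*(1+g-al) \<le> 4*(la*(A-al/2))"
    proof -
      have r: "la*tau/3*(1-la) \<le> Rq*(1-la)" using Rq3 la tau by (intro mult_right_mono) auto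
      have "1 + la/4 - la*tau + la^2*tau/2 + la*tau/3*(1-la) + al*(1/4 - 5/4*la + la^2/2) \<le> QQ"
        by (rule order_trans[OF _ Q]) (intro add_mono order_refl r)
      then have q: "4*(1 + la/4 - la*tau + la^2*tau/2 + la*tau/3*(1-la) + al*(1/4 - 5/4*la + la^2/2)) \<le> 4*QQ"
        by (intro mult_left_mono) auto
      have "4*(1 + la/4 - la*tau + la^2*tau/2 + la*tau/3*(1-la) + al*(1/4 - 5/4*la + la^2/2)) - (1+tau)*(1+(1-la*tau)-al)
         = (1-tau) + la*((tau-5/6)^2 + 11/36) + 2/3*la^2*tau + al*((1-la)*(3-2*la)) + (1-al)*(1-tau)"
        by (simp add: field_simps power2_eq_square)
      moreover have "0 \<le> al*((1-la)*(3-2*la))" "0 \<le> (1-al)*(1-tau)" "0 \<le> la*((tau-5/6)^2 + 11/36)" "0 \<le> 2/3*la^2*tau"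
        using al la tau al1 by auto
      ultimately show ?thesis using q tau(2) unfolding tau_def[symmetric] g' QQ_def[symmetric] by linarith
    qed
    show "(R + B + al*la^2/2 + c1/2 + la*c2/2)*(1+g-al) \<le> 2*(la*(A-al/2))"
    proof -
      define m where "m = 2 - la*tau - al"
      have tc: "t \<le> c" using c0 p unfolding ct[symmetric] by (simp add: mult_left_le)
      have m: "1 \<le> m" "m \<le> 2" using tc alc tau(3) t0 al unfolding m_def by auto
      have S: "R + B + al*la^2/2 + c1/2 + la*c2/2
         = (1+tau)/2 - (ze*tau*(1-la^2) + al*la*(1-la)/2) + chi/la"
        unfolding B_def c1'' c2' Rq g' tau(3)[symmetric] using la by (simp add: field_simps power2_eq_square)
      have u: "0 \<le> ze*tau*(1-la^2) + al*la*(1-la)/2" using ze0 tau la al by (simp add: power_le_one)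
      have "(R + B + al*la^2/2 + c1/2 + la*c2/2)*m
        = (1+tau)/2*m - (ze*tau*(1-la^2) + al*la*(1-la)/2)*m + chi/la*m"
        unfolding S by (simp add: algebra_simps)
      also have "\<dots> \<le> (1+tau)/2*m - (ze*tau*(1-la^2) + al*la*(1-la)/2)*1 + tau*p*k*2"
      proof -
        have "(ze*tau*(1-la^2) + al*la*(1-la)/2)*1 \<le> (ze*tau*(1-la^2) + al*la*(1-la)/2)*m"
          using u m by (intro mult_left_mono) auto
        moreover have "chi/la*m \<le> tau*p*k*2" using m chi chi0 la tau p k by (intro mult_mono) auto
        ultimately show ?thesis by linarith
      qed
      also have "\<dots> \<le> 2*(1 + la/4 - la*tau + la^2*tau/2 + Rq*(1-la) + al*(1/4 - 5/4*la + la^2/2))"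
      proof -
        have id: "2*(1 + la/4 - la*tau + la^2*tau/2 + Rq*(1-la) + al*(1/4 - 5/4*la + la^2/2))
            - ((1+tau)/2*m - (ze*tau*(1-la^2) + al*la*(1-la)/2)*1)
          = (1-tau)/2 + la*tau/2 + al*((1-la)*(3-la))/2 + (1-al)*(1-tau)/2 + la*(1-tau)^2/2 + ze*tau*(1-la)^2"
          unfolding m_def Rq tau(3)[symmetric] by (simp add: field_simps power2_eq_square)
        have n1: "0 \<le> (1-al)*(1-tau)/2" "0 \<le> la*(1-tau)^2/2" "0 \<le> ze*tau*(1-la)^2"
          using al1 tau la ze0 by auto
        have "2*(p*k) \<le> la/2 + 2*(p*k)^2/la"
        proof -
          have "la*(la/2 + 2*(p*k)^2/la - 2*(p*k)) = 2*(la/2 - p*k)^2"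
            using la by (simp add: field_simps power2_eq_square)
          then have "0 \<le> la*(la/2 + 2*(p*k)^2/la - 2*(p*k))" by simp
          then show ?thesis using la by (simp add: zero_le_mult_iff)
        qed
        then have v1: "tau*(2*(p*k)) \<le> tau*(la/2 + 2*(p*k)^2/la)" using tau by (intro mult_left_mono) auto
        have v2: "tau*(2*(p*k)^2/la) \<le> al*((1-la)*(3-la)+(1-tau))/2"
        proof -
          have pc: "p^2*c \<le> (1-la*tau)^2"
          proof -
            have "p*c = c - la*tau" using ct tau by (simp add: algebra_simps)
            moreover have "c*(p^2*c) = (p*c)^2" by (simp add: power2_eq_square)
            ultimately have "c*(p^2*c) = (c-la*tau)^2" by simp
            also have "\<dots> = c*(1-la*tau)^2 - (1-c)*(c-(la*tau)^2)" by algebra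
            also have "\<dots> \<le> c*(1-la*tau)^2"
            proof -
              have "t \<le> 1" using tc cl1 by simp
              then have "(la*tau)^2 \<le> la*tau" using t0 unfolding tau by (simp add: power2_eq_square mult_left_le)
              then have "(la*tau)^2 \<le> c" using tc tau by simp
              then show ?thesis using cl1 by simp
            qed
            finally show ?thesis using c0 by simp
          qed
          have "(3-2*la)*(p*k)^2 = al*p^2*(l*(3-2*la))" using k by (simp add: power_mult_distrib)
          also have "\<dots> \<le> al*p^2*(la*c)" using l2 al by (intro mult_left_mono) auto
          also have "\<dots> = al*la*(p^2*c)" by simp
          also have "\<dots> \<le> al*la*(1-la*tau)^2" using pc al la by (intro mult_left_mono) auto
          finally have "(3-2*la)*((p*k)^2/la) \<le> al*(1-la*tau)^2" using la by (simp add: field_simps)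
          then have "(4*tau)*((3-2*la)*((p*k)^2/la)) \<le> (4*tau)*(al*(1-la*tau)^2)" using tau by (intro mult_left_mono) auto
          also have "\<dots> = al*(4*tau*(1-la*tau)^2)" by simp
          also have "\<dots> \<le> al*((3-2*la)*((1-la)*(3-la)+(1-tau)))" using al la tau by (intro mult_left_mono start_noise_poly) auto
          finally have "(3-2*la)*(4*tau*((p*k)^2/la)) \<le> (3-2*la)*(al*((1-la)*(3-la)+(1-tau)))" by (simp add: algebra_simps)
          moreover have "0 < 3-2*la" using la by simp
          ultimately have "4*tau*((p*k)^2/la) \<le> al*((1-la)*(3-la)+(1-tau))"
            using mult_le_cancel_left_pos by blast
          then show ?thesis by simp
        qed
        have v3: "al*(1-tau) \<le> 1-tau" using al1 al tau by (simp add: mult_left_le_one_le)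
        have "tau*p*k*2 \<le> la*tau/2 + al*((1-la)*(3-la))/2 + (1-tau)/2"
        proof -
          have "tau*p*k*2 = tau*(2*(p*k))" by simp
          also have "\<dots> \<le> la*tau/2 + tau*(2*(p*k)^2/la)" using v1 by (simp add: distrib_left mult.commute)
          also have "\<dots> \<le> la*tau/2 + al*((1-la)*(3-la)+(1-tau))/2" by (intro add_left_mono v2)
          also have "\<dots> = la*tau/2 + al*((1-la)*(3-la))/2 + al*(1-tau)/2" by (simp add: distrib_left add_divide_distrib)
          also have "\<dots> \<le> la*tau/2 + al*((1-la)*(3-la))/2 + (1-tau)/2"
            using v3 by (intro add_left_mono divide_right_mono) auto
          finally show ?thesis .
        qed
        with id n1 show ?thesis by linarith
      qed
      also have "\<dots> \<le> 2*QQ" using Q by (intro mult_left_mono) auto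
      finally show ?thesis unfolding m_def g' QQ_def by (simp add: algebra_simps)
    qed
    show "(g+t/la)/la \<le> 1 + a"
    proof -
      have "al/2*la \<le> al/2" using al la by (simp add: mult_left_le)
      then have "1+g \<le> la*(1/2+a)" using a1 by (simp add: algebra_simps)
      then have "g+t/la \<le> la*(1+a)" using tau la unfolding tau_def[symmetric] by (simp add: algebra_simps)
      then show ?thesis using la by (simp add: field_simps)
    qed
  qed
qed

section \<open>Contraction on the ray\<close>

lemma cross_term_bound:
  fixes \<delta> \<alpha> l q u :: real
  assumes "0 < \<alpha>" "\<delta>\<^sup>2 \<le> \<alpha> * l * q"
  shows "- (\<delta> * u) \<le> l / 2 * q + \<alpha> / 2 * u\<^sup>2"
proof -
  have "0 \<le> (\<delta> + \<alpha> * u)\<^sup>2" by simp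
  also have "\<dots> = \<delta>\<^sup>2 + \<alpha> * (2 * (\<delta> * u) + \<alpha> * u\<^sup>2)" by (simp add: power2_eq_square algebra_simps)
  also have "\<dots> \<le> \<alpha> * (l * q + 2 * (\<delta> * u) + \<alpha> * u\<^sup>2)" using assms(2) by (simp add: algebra_simps)
  finally have "0 \<le> l * q + 2 * (\<delta> * u) + \<alpha> * u\<^sup>2" using assms(1) by (simp add: zero_le_mult_iff)
  then show ?thesis by simp
qed

text \<open>
  One outcome of the coin in radial coordinates: \<open>x\<close>, \<open>xp\<close>, \<open>y\<close>, \<open>w\<close> are distances to \<open>x'\<close>, \<open>P\<close>, \<open>Pp\<close>, \<open>Py\<close> are
  the excesses of the Bregman distance over half the squared distance, and \<open>\<delta>\<close>, \<open>\<delta>y\<close> are differences of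
  \<open>\<alpha> F\<close> along the ray. The drift \<open>\<delta> y\<close> is split as \<open>\<lambda> \<delta> x + \<delta> (y - \<lambda> x)\<close>; the first part reproduces \<open>\<lambda>\<close>
  times the drift term of the old potential, the second is small.
\<close>
lemma ray_coin_step:
  fixes P Pp Py x xp y w dx dxp \<delta> \<delta>y \<nu> :: real
  assumes step: "(1 + a) * (Py + y\<^sup>2 / 2) - \<delta>y * y
      \<le> g * (P + x\<^sup>2 / 2 - dx) + (1 - g) * (Pp + xp\<^sup>2 / 2 - dxp) - \<delta> * y + \<nu>"
    and d: "(y - x)\<^sup>2 / 2 \<le> dx" "(y - xp)\<^sup>2 / 2 \<le> dxp" and g: "0 \<le> g" "g \<le> 1"
    and Py: "0 \<le> Py" "AP \<le> 1 + a"
    and \<delta>: "0 < \<alpha>" "\<delta>\<^sup>2 \<le> \<alpha> * l * q"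
  shows "AP * Py + BP * P + A * y\<^sup>2 + B * x\<^sup>2 - \<delta>y * y + R * (y - w)\<^sup>2
    \<le> ((g + BP) * P + (1 - g) * Pp - la * (\<delta> * x) + l / 2 * q + (B + \<alpha> * la\<^sup>2 / 2) * x\<^sup>2)
      + ((A + R - 1 - a / 2 + \<alpha> / 2) * y\<^sup>2 + (g - \<alpha> * la) * (x * y) + (1 - g) * (xp * y) + R * (w\<^sup>2 - 2 * (w * y))) + \<nu>"
proof -
  \<comment> \<open>The summands are the slacks of the inequalities that are combined.\<close>
  define slack where "slack = (g * (P + x\<^sup>2 / 2 - dx) + (1 - g) * (Pp + xp\<^sup>2 / 2 - dxp) - \<delta> * y + \<nu> - ((1 + a) * (Py + y\<^sup>2 / 2) - \<delta>y * y))
     + g * (dx - (y - x)\<^sup>2 / 2) + (1 - g) * (dxp - (y - xp)\<^sup>2 / 2) + (1 + a - AP) * Py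
     + (l / 2 * q + \<alpha> / 2 * (y - la * x)\<^sup>2 + \<delta> * (y - la * x))"
  have f: "0 \<le> g * (P + x\<^sup>2 / 2 - dx) + (1 - g) * (Pp + xp\<^sup>2 / 2 - dxp) - \<delta> * y + \<nu> - ((1 + a) * (Py + y\<^sup>2 / 2) - \<delta>y * y)"
    "0 \<le> g * (dx - (y - x)\<^sup>2 / 2)" "0 \<le> (1 - g) * (dxp - (y - xp)\<^sup>2 / 2)" "0 \<le> (1 + a - AP) * Py"
    using step d g Py by simp_all
  have f5: "0 \<le> l / 2 * q + \<alpha> / 2 * (y - la * x)\<^sup>2 + \<delta> * (y - la * x)"
    using cross_term_bound[OF \<delta>, of "y - la * x"] by linarith
  have "0 \<le> slack" unfolding slack_def by (intro add_nonneg_nonneg[OF _ f5] add_nonneg_nonneg[OF _ f(4)]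
      add_nonneg_nonneg[OF _ f(3)] add_nonneg_nonneg[OF f(1,2)])
  moreover have "((g + BP) * P + (1 - g) * Pp - la * (\<delta> * x) + l / 2 * q + (B + \<alpha> * la\<^sup>2 / 2) * x\<^sup>2)
      + ((A + R - 1 - a / 2 + \<alpha> / 2) * y\<^sup>2 + (g - \<alpha> * la) * (x * y) + (1 - g) * (xp * y) + R * (w\<^sup>2 - 2 * (w * y))) + \<nu>
     = AP * Py + BP * P + A * y\<^sup>2 + B * x\<^sup>2 - \<delta>y * y + R * (y - w)\<^sup>2 + slack"
    unfolding slack_def by (simp add: power2_eq_square field_simps)
  ultimately show ?thesis by linarith
qed

lemma coin_average_le:
  fixes v1 v0 c e1 e0 \<nu>1 \<nu>0 E p :: real
  assumes "v1 \<le> c + e1 + \<nu>1" "v0 \<le> c + e0 + \<nu>0" "p * e1 + (1 - p) * e0 \<le> E" "0 \<le> p" "p \<le> 1"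
  shows "p * v1 + (1 - p) * v0 \<le> c + E + (p * \<nu>1 + (1 - p) * \<nu>0)"
proof -
  have "p * v1 + (1 - p) * v0 \<le> p * (c + e1 + \<nu>1) + (1 - p) * (c + e0 + \<nu>0)"
    using assms by (intro add_mono mult_left_mono) auto
  also have "\<dots> = c + (p * e1 + (1 - p) * e0) + (p * \<nu>1 + (1 - p) * \<nu>0)" by (simp add: algebra_simps)
  finally show ?thesis using assms(3) by simp
qed

text \<open>
  The mixed terms \<open>- 2 R w y\<close> differ between the outcomes \<open>w = x\<close> and \<open>w = xp\<close>. Replacing \<open>w\<close> by its mean
  turns the coefficients of \<open>x y\<close> and \<open>xp y\<close> into \<open>c1\<close> and \<open>c2\<close> and costs \<open>2 R p (1 - p) (x - xp) (y0 - y1)\<close>,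
  which is small because the two outcomes lead to nearby points. The weights of the following two
  applications of Young's inequality add up to \<open>- S\<close>.
\<close>
lemma ray_average:
  fixes x xp y1 y0 :: real
  assumes nn: "0 \<le> x" "0 \<le> xp" "0 \<le> y1" "0 \<le> y0" and p: "0 \<le> p" "p \<le> 1" and R: "0 \<le> R" and la: "0 < la"
    and c: "0 \<le> c1" "0 \<le> c2" "c1 = g - al * la - 2 * R * p" "c2 = 1 - g - 2 * R * (1 - p)"
    and S: "S = - (c1 / 2 + c2 / (2 * la))"
    and coupling: "\<bar>y1 - y0\<bar> \<le> k * \<bar>x - xp\<bar>"
  shows "p * (S * y1\<^sup>2 + (g - al * la) * (x * y1) + (1 - g) * (xp * y1) + R * (x\<^sup>2 - 2 * (x * y1)))
      + (1 - p) * (S * y0\<^sup>2 + (g - al * la) * (x * y0) + (1 - g) * (xp * y0) + R * (xp\<^sup>2 - 2 * (xp * y0)))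
    \<le> (c1 / 2 + R * p) * x\<^sup>2 + (c2 * la / 2 + R * (1 - p)) * xp\<^sup>2 + 2 * R * p * (1 - p) * k * (x - xp)\<^sup>2"
proof -
  have amgm: "S * y\<^sup>2 + c1 * (x * y) + c2 * (xp * y) \<le> c1 / 2 * x\<^sup>2 + c2 * la / 2 * xp\<^sup>2" for y
  proof -
    have "c1 * (x * y) \<le> c1 * ((x\<^sup>2 + y\<^sup>2) / 2)"
      using sum_squares_bound[of x y] c by (intro mult_left_mono) auto
    moreover have "xp * y \<le> la / 2 * xp\<^sup>2 + y\<^sup>2 / (2 * la)"
      using sum_squares_bound[of "la * xp" y] la by (simp add: field_simps power2_eq_square)
    then have "c2 * (xp * y) \<le> c2 * (la / 2 * xp\<^sup>2 + y\<^sup>2 / (2 * la))" using c by (intro mult_left_mono)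
    ultimately show ?thesis unfolding S by (simp add: algebra_simps)
  qed
  have "(x - xp) * (y0 - y1) \<le> \<bar>x - xp\<bar> * \<bar>y1 - y0\<bar>"
    by (metis abs_ge_self abs_minus_commute abs_mult)
  also have "\<dots> \<le> \<bar>x - xp\<bar> * (k * \<bar>x - xp\<bar>)" using coupling by (intro mult_left_mono) auto
  also have "\<dots> = k * (x - xp)\<^sup>2" by (simp add: power2_eq_square mult_ac)
  finally have "2 * R * p * (1 - p) * ((x - xp) * (y0 - y1)) \<le> 2 * R * p * (1 - p) * (k * (x - xp)\<^sup>2)"
    using R p by (intro mult_left_mono) auto
  then have cross: "2 * R * p * (1 - p) * ((x - xp) * (y0 - y1)) \<le> 2 * R * p * (1 - p) * k * (x - xp)\<^sup>2"
    by (simp only: mult.assoc)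
  define E where "E = c1 / 2 * x\<^sup>2 + c2 * la / 2 * xp\<^sup>2"
  have "p * (S * y1\<^sup>2 + c1 * (x * y1) + c2 * (xp * y1)) + (1 - p) * (S * y0\<^sup>2 + c1 * (x * y0) + c2 * (xp * y0))
      \<le> p * E + (1 - p) * E"
    unfolding E_def using p by (intro add_mono mult_left_mono amgm) auto
  also have "\<dots> = E" by (simp add: algebra_simps)
  finally have both: "p * (S * y1\<^sup>2 + c1 * (x * y1) + c2 * (xp * y1)) + (1 - p) * (S * y0\<^sup>2 + c1 * (x * y0) + c2 * (xp * y0)) \<le> E" .
  have "p * (S * y1\<^sup>2 + (g - al * la) * (x * y1) + (1 - g) * (xp * y1) + R * (x\<^sup>2 - 2 * (x * y1)))
      + (1 - p) * (S * y0\<^sup>2 + (g - al * la) * (x * y0) + (1 - g) * (xp * y0) + R * (xp\<^sup>2 - 2 * (xp * y0)))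
    = (p * (S * y1\<^sup>2 + c1 * (x * y1) + c2 * (xp * y1)) + (1 - p) * (S * y0\<^sup>2 + c1 * (x * y0) + c2 * (xp * y0)))
      + 2 * R * p * (1 - p) * ((x - xp) * (y0 - y1)) + (R * p * x\<^sup>2 + R * (1 - p) * xp\<^sup>2)"
    unfolding c(3,4) by (simp add: algebra_simps power2_eq_square)
  also have "\<dots> \<le> E + 2 * R * p * (1 - p) * k * (x - xp)\<^sup>2 + (R * p * x\<^sup>2 + R * (1 - p) * xp\<^sup>2)"
    by (intro add_mono order.refl both cross)
  also have "\<dots> = (c1 / 2 + R * p) * x\<^sup>2 + (c2 * la / 2 + R * (1 - p)) * xp\<^sup>2 + 2 * R * p * (1 - p) * k * (x - xp)\<^sup>2"
    unfolding E_def by (simp add: distrib_right)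
  finally show ?thesis .
qed

context vr_setting begin

lemma coin_step:
  assumes r: "reachable x xp wp" and w: "w \<in> {x, xp}" and B: "B \<in> set_pmf (batch x wp)"
  shows "next_pt x xp w wp B \<in> C" (is "?y \<in> C")
    "(1 + \<alpha> * \<beta>) * D x' (next_pt x xp w wp B) + \<alpha> * ((F (next_pt x xp w wp B) - F w) \<bullet> (x' - next_pt x xp w wp B))
      \<le> \<gamma> * (D x' x - D (next_pt x xp w wp B) x) + (1 - \<gamma>) * (D x' xp - D (next_pt x xp w wp B) xp)
        + \<alpha> * ((F x - F wp) \<bullet> (x' - next_pt x xp w wp B)) + noise x xp w wp B" (is ?ineq)
proof -
  show y: "?y \<in> C" using r w B by (auto simp: reachable_def)
  have "(1 + \<alpha> * \<beta>) * D x' ?y \<le> \<gamma> * (D x' x - D ?y x) + (1 - \<gamma>) * (D x' xp - D ?y xp)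
        + \<alpha> * ((estimate x xp w wp B - F ?y) \<bullet> (x' - ?y))"
    using r w B by (intro one_step[OF y]) (auto simp: reachable_def)
  then show ?ineq unfolding noise_def by (simp add: inner_diff_left algebra_simps)
qed

text \<open>
  For a common batch the two estimates differ by \<open>F x - F xp\<close> only, so stability of the proximal step
  applies.
\<close>
lemma coin_coupling:
  assumes r: "reachable x xp wp" and B: "B \<in> set_pmf (batch x wp)"
  shows "N (next_pt x xp x wp B - next_pt x xp xp wp B) \<le> \<alpha> * L * N (x - xp)"
proof -
  define y1 y0 where "y1 = next_pt x xp x wp B" and "y0 = next_pt x xp xp wp B"
  have C: "y1 \<in> C" "y0 \<in> C" using coin_step(1)[OF r _ B] by (simp_all add: y1_def y0_def)
  have xG: "x \<in> G" "xp \<in> G" using r C_D by (auto simp: reachable_def)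
  have len: "length B = b" by (rule length_replicate_pmf[OF B])
  have "(N (y1 - y0))\<^sup>2 \<le> \<alpha> * ((estimate x xp x wp B - estimate x xp xp wp B) \<bullet> (y0 - y1))"
    using r B C by (intro prox_stable) (auto simp: reachable_def y1_def y0_def)
  also have "estimate x xp x wp B - estimate x xp xp wp B = F x - F xp"
    unfolding batch_estimate_eq[OF len] by simp
  also have "\<alpha> * ((F x - F xp) \<bullet> (y0 - y1)) \<le> \<alpha> * (L * N (x - xp) * N (y0 - y1))"
    using \<alpha> A4_C[OF xG] by (intro mult_left_mono) auto
  finally have "N (y1 - y0) * N (y1 - y0) \<le> (\<alpha> * L * N (x - xp)) * N (y1 - y0)"
    unfolding is_norm_commute[OF norm, of y0 y1] by (simp add: power2_eq_square mult_ac)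
  moreover have "0 \<le> \<alpha> * L * N (x - xp)" using \<alpha> A4 is_norm_nonneg[OF norm] by simp
  moreover have "u \<le> c" if "u * u \<le> c * u" "0 \<le> c" "0 \<le> u" for u c :: real
    using that by (cases "u = 0") (simp, metis less_le mult_right_le_imp_le)
  ultimately show ?thesis using is_norm_nonneg[OF norm] unfolding y1_def y0_def by blast
qed

text \<open>
  By \<open>iterates_on_ray\<close> everything is expressed by the distances \<open>r\<close> to \<open>x'\<close>, the excesses \<open>P\<close> and the
  components \<open>\<phi>\<close> of \<open>\<alpha> F\<close> along the ray.
\<close>
lemma ray_regime_bound:
  assumes L\<beta>: "2 * L < \<beta>" and la: "0 < la" "la < 1" "1 - \<gamma> \<le> la" and al: "\<alpha> \<le> (\<gamma> - p) / (1 - p)"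
    and la1: "2 * (\<alpha>\<^sup>2 * Lbar\<^sup>2 / real b) + \<alpha> * L\<^sup>2 * (3 - 2 * la) \<le> la * ((1 - \<gamma>) / (1 - p))"
    and la2: "1 + \<gamma> + \<alpha> / 2 \<le> la * (1 / 2 + \<alpha> * \<beta> + \<alpha> / 2)"
  shows "expect (precoin_law s) (\<lambda>(x, xp, wp). (N (x' - x))\<^sup>2) \<le> la ^ s * (4 * D x' x0 / (1 + \<gamma> - \<alpha>))"
proof -
  obtain v where v: "N v = 1" "\<And>y. y \<in> C \<Longrightarrow> y - x' = N (y - x') *\<^sub>R v" using iterates_on_ray[OF L\<beta>] by blast
  define n where "n = \<alpha>\<^sup>2 * Lbar\<^sup>2 / real b"
  define l where "l = \<alpha> * L\<^sup>2"
  define k where "k = \<alpha> * L"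
  define a where "a = \<alpha> * \<beta>"
  have n0: "0 \<le> n" and l0: "0 \<le> l" and k0: "0 \<le> k" and k2: "k\<^sup>2 = \<alpha> * l"
    using \<alpha> A4(1) by (simp_all add: n_def l_def k_def power_mult_distrib power2_eq_square[of \<alpha>])
  define t where "t = 1 - \<gamma>"
  have t0: "0 < t" and g0: "0 < \<gamma>" using \<gamma> p by (auto simp: t_def)
  obtain R A B c1 c2 where cs: "l / 2 \<le> R" "n + l / 2 \<le> la * R" "0 \<le> c1" "0 \<le> c2" "0 \<le> B"
    "c1 = \<gamma> - \<alpha> * la - 2 * R * p" "c2 = 1 - \<gamma> - 2 * R * (1 - p)"
    "A + R - 1 - a / 2 + \<alpha> / 2 = - (c1 / 2 + c2 / (2 * la))"
    "R * (1 - p) + 2 * R * p * (1 - p) * k + c2 * la / 2 \<le> la * B"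
    "R * p + 2 * R * p * (1 - p) * k + B + \<alpha> * la\<^sup>2 / 2 + c1 / 2 \<le> la * A"
    "(1 + t / la) * (1 + \<gamma> - \<alpha>) \<le> 4 * (la * (A - \<alpha> / 2))"
    "(R + B + \<alpha> * la\<^sup>2 / 2 + c1 / 2 + la * c2 / 2) * (1 + \<gamma> - \<alpha>) \<le> 2 * (la * (A - \<alpha> / 2))"
    "(\<gamma> + t / la) / la \<le> 1 + a"
    using ray_constants[OF p \<gamma> \<alpha> al la n0 k0 k2 l0 la1[folded n_def l_def] la2[folded a_def]]
    unfolding t_def by metis
  have R0: "0 \<le> R" using cs(1) l0 by linarith
  define \<mu> where "\<mu> = 1 + \<gamma> - \<alpha>"
  have "(\<gamma> - p) / (1 - p) < 1" using p \<gamma> by simp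
  then have "\<alpha> < 1" using al by linarith
  then have \<mu>: "0 < \<mu>" "\<mu> \<le> 2" using g0 \<gamma> \<alpha> unfolding \<mu>_def by linarith+
  define \<kappa> where "\<kappa> = A - \<alpha> / 2"
  have "0 < (1 + t / la) * \<mu>" using \<mu> t0 la by (intro mult_pos_pos add_pos_pos) auto
  then have "0 < la * \<kappa>" using cs(11) unfolding \<kappa>_def \<mu>_def by linarith
  then have \<kappa>: "0 < \<kappa>" using la by (simp add: zero_less_mult_iff)
  define r where "r z = N (z - x')" for z
  define P where "P z = D x' z - (r z)\<^sup>2 / 2" for z
  define \<phi> where "\<phi> z = \<alpha> * (F z \<bullet> v)" for z
  define BP AP where "BP = t / la" and "AP = (\<gamma> + t / la) / la"
  define V where "V = (\<lambda>(x, xp, wp). AP * P x + BP * P xp + A * (r x)\<^sup>2 + B * (r xp)\<^sup>2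
     - (\<phi> x - \<phi> wp) * r x + R * (r x - r wp)\<^sup>2)"
  have r0: "0 \<le> r z" for z unfolding r_def by (rule is_norm_nonneg[OF norm])
  have sub: "y - z = (r y - r z) *\<^sub>R v" if "y \<in> C" "z \<in> C" for y z
  proof -
    have "y - z = (y - x') - (z - x')" by simp
    also have "\<dots> = (r y - r z) *\<^sub>R v"
      by (subst v(2)[OF that(1)], subst v(2)[OF that(2)]) (simp add: r_def scaleR_diff_left)
    finally show ?thesis .
  qed
  have Nsub: "N (y - z) = \<bar>r y - r z\<bar>" if "y \<in> C" "z \<in> C" for y z
    unfolding sub[OF that] is_norm_scaleR[OF norm] v(1) by simp
  have P0: "0 \<le> P z" if "z \<in> C" for z
    using strongD[OF x'_G that] unfolding P_def r_def is_norm_commute[OF norm, of z x'] by simp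
  have DP: "D x' z = P z + (r z)\<^sup>2 / 2" for z by (simp add: P_def)
  have Dlow: "(r y - r z)\<^sup>2 / 2 \<le> D y z" if "y \<in> C" "z \<in> C" for y z
    using strongD[OF C_D(1)[OF that(1)] that(2)] unfolding Nsub[OF that] by simp
  have inn: "\<alpha> * ((F z - F w) \<bullet> (x' - y)) = - ((\<phi> z - \<phi> w) * r y)" if "y \<in> C" for y z w
  proof -
    have "x' - y = - (r y *\<^sub>R v)" using v(2)[OF that] unfolding r_def by (metis minus_diff_eq)
    then show ?thesis by (simp only:) (simp add: \<phi>_def inner_diff_left algebra_simps)
  qed
  have \<phi>lip: "(\<phi> z - \<phi> w)\<^sup>2 \<le> \<alpha> * l * (r z - r w)\<^sup>2" if "z \<in> C" "w \<in> C" for z w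
  proof -
    have 1: "\<phi> z - \<phi> w \<le> k * \<bar>r z - r w\<bar>" if "z \<in> C" "w \<in> C" for z w
    proof -
      have "\<alpha> * ((F z - F w) \<bullet> v) \<le> \<alpha> * (L * N (z - w) * N v)"
        using \<alpha> by (intro mult_left_mono A4_C C_D that) auto
      then show ?thesis unfolding Nsub[OF that] v(1) by (simp add: \<phi>_def k_def inner_diff_left right_diff_distrib)
    qed
    have "\<bar>\<phi> z - \<phi> w\<bar> \<le> k * \<bar>r z - r w\<bar>" using 1[OF that] 1[OF that(2,1)] by (simp add: abs_minus_commute)
    then have "\<bar>\<phi> z - \<phi> w\<bar>\<^sup>2 \<le> (k * \<bar>r z - r w\<bar>)\<^sup>2" by (intro power_mono) auto
    then show ?thesis by (simp add: power_mult_distrib k2)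
  qed
  have APa: "AP \<le> 1 + a" using cs(13) by (simp add: AP_def)
  define cst where "cst x xp wp = (\<gamma> + BP) * P x + (1 - \<gamma>) * P xp - la * ((\<phi> x - \<phi> wp) * r x)
      + l / 2 * (r x - r wp)\<^sup>2 + (B + \<alpha> * la\<^sup>2 / 2) * (r x)\<^sup>2" for x xp wp
  have coin: "V (next_pt x xp w wp bt, x, w)
      \<le> cst x xp wp
      + ((A + R - 1 - a / 2 + \<alpha> / 2) * (r (next_pt x xp w wp bt))\<^sup>2 + (\<gamma> - \<alpha> * la) * (r x * r (next_pt x xp w wp bt))
        + (1 - \<gamma>) * (r xp * r (next_pt x xp w wp bt)) + R * ((r w)\<^sup>2 - 2 * (r w * r (next_pt x xp w wp bt)))) + noise x xp w wp bt"
    if rc: "reachable x xp wp" and w: "w \<in> {x, xp}" and bt: "bt \<in> set_pmf (batch x wp)" for x xp w wp bt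
  proof -
    define y where "y = next_pt x xp w wp bt"
    have y: "y \<in> C" unfolding y_def by (rule coin_step(1)[OF rc w bt])
    have xC: "x \<in> C" "xp \<in> C" "wp \<in> C" using rc by (auto simp: reachable_def)
    have "(1 + a) * (P y + (r y)\<^sup>2 / 2) - (\<phi> y - \<phi> w) * r y
      \<le> \<gamma> * (P x + (r x)\<^sup>2 / 2 - D y x) + (1 - \<gamma>) * (P xp + (r xp)\<^sup>2 / 2 - D y xp) - (\<phi> x - \<phi> wp) * r y + noise x xp w wp bt"
      using coin_step(2)[OF rc w bt, folded y_def] unfolding inn[OF y] DP a_def by simp
    from ray_coin_step[OF this Dlow[OF y xC(1)] Dlow[OF y xC(2)] _ _ P0[OF y] APa \<alpha> \<phi>lip[OF xC(1,3)], where BP = BP and A = A and B = B and R = R and w = "r w" and la = la]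
    show ?thesis using g0 \<gamma> unfolding V_def y_def cst_def by simp
  qed
  define W where "W x xp wp = cst x xp wp + ((c1 / 2 + R * p) * (r x)\<^sup>2 + (c2 * la / 2 + R * (1 - p)) * (r xp)\<^sup>2
      + 2 * R * p * (1 - p) * k * (r x - r xp)\<^sup>2)" for x xp wp
  have step: "expect (precoin_step (x, xp, wp)) V \<le> W x xp wp + n * (r x - r wp)\<^sup>2" if rc: "reachable x xp wp" for x xp wp
  proof (rule expect_step_le[OF rc])
    have xC: "x \<in> C" "xp \<in> C" "wp \<in> C" using rc by (auto simp: reachable_def)
    show "expect (batch x wp) (noise x xp w wp) \<le> n * (r x - r wp)\<^sup>2" if "w \<in> {x, xp}" for w
      using noise_bound_ray[OF rc that v] unfolding Nsub[OF xC(1,3)] n_def by simp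
    fix bt assume bt: "bt \<in> set_pmf (batch x wp)"
    define y1 y0 where "y1 = next_pt x xp x wp bt" and "y0 = next_pt x xp xp wp bt"
    have yC: "y1 \<in> C" "y0 \<in> C" using coin_step(1)[OF rc _ bt] by (simp_all add: y1_def y0_def)
    have "\<bar>r y1 - r y0\<bar> \<le> k * \<bar>r x - r xp\<bar>"
      using coin_coupling[OF rc bt] unfolding y1_def[symmetric] y0_def[symmetric] Nsub[OF yC] Nsub[OF xC(1,2)] k_def .
    note avg = ray_average[OF r0 r0 r0 r0 _ _ R0 la(1) cs(3,4,6,7,8) this]
    show "p * V (next_pt x xp x wp bt, x, x) + (1 - p) * V (next_pt x xp xp wp bt, x, xp)
        \<le> W x xp wp + (p * noise x xp x wp bt + (1 - p) * noise x xp xp wp bt)"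
      unfolding W_def using p
      by (intro coin_average_le[OF coin[OF rc _ bt] coin[OF rc _ bt] avg[unfolded y1_def y0_def]]) auto
  qed
  show ?thesis unfolding \<mu>_def[symmetric]
  proof (rule decay[OF la(1) \<mu> \<kappa>, where V = V and ?E1.0 = "W x0 x0 x0"])
    fix x xp wp assume rc: "reachable x xp wp"
    then have xC: "x \<in> C" "xp \<in> C" "wp \<in> C" by (auto simp: reachable_def)
    have "(r x - r xp)\<^sup>2 \<le> (r x)\<^sup>2 + (r xp)\<^sup>2" using r0[of x] r0[of xp] by (simp add: power2_diff)
    then have chi: "2 * R * p * (1 - p) * k * (r x - r xp)\<^sup>2 \<le> 2 * R * p * (1 - p) * k * ((r x)\<^sup>2 + (r xp)\<^sup>2)"
      using R0 p k0 by (intro mult_left_mono) auto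
    have "(n + l / 2) * (r x - r wp)\<^sup>2 \<le> la * R * (r x - r wp)\<^sup>2"
      "(R * (1 - p) + 2 * R * p * (1 - p) * k + c2 * la / 2) * (r xp)\<^sup>2 \<le> la * B * (r xp)\<^sup>2"
      "(R * p + 2 * R * p * (1 - p) * k + B + \<alpha> * la\<^sup>2 / 2 + c1 / 2) * (r x)\<^sup>2 \<le> la * A * (r x)\<^sup>2"
      by (intro mult_right_mono cs; simp)+
    moreover have "(\<gamma> + BP) * P x = la * AP * P x" "(1 - \<gamma>) * P xp = la * BP * P xp"
      using la by (simp_all add: AP_def BP_def t_def)
    ultimately have "W x xp wp + n * (r x - r wp)\<^sup>2 \<le> la * V (x, xp, wp)"
      using chi unfolding W_def cst_def V_def by (simp add: algebra_simps)
    with step[OF rc] show "expect (precoin_step (x, xp, wp)) V \<le> la * V (x, xp, wp)" by linarith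
    have "(\<phi> x - \<phi> wp) * r x \<le> l / 2 * (r x - r wp)\<^sup>2 + \<alpha> / 2 * (r x)\<^sup>2"
      using cross_term_bound[OF \<alpha> \<phi>lip[OF xC(1,3)], of "- r x"] by simp
    also have "\<dots> \<le> R * (r x - r wp)\<^sup>2 + \<alpha> / 2 * (r x)\<^sup>2" using cs(1) by (intro add_mono mult_right_mono) auto
    finally have "(\<phi> x - \<phi> wp) * r x \<le> R * (r x - r wp)\<^sup>2 + \<alpha> / 2 * (r x)\<^sup>2" .
    moreover have "0 \<le> AP * P x" "0 \<le> BP * P xp" "0 \<le> B * (r xp)\<^sup>2"
      using P0 xC la t0 g0 cs(5) by (auto simp: AP_def BP_def)
    moreover have "N (x' - x) = r x" unfolding r_def by (rule is_norm_commute[OF norm])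
    ultimately show "\<kappa> * (N (x' - x))\<^sup>2 \<le> V (x, xp, wp)"
      unfolding \<kappa>_def V_def by (simp add: algebra_simps)
  next
    have x0C: "x0 \<in> C" using x0 by (simp add: C_def G_def)
    have "reachable x0 x0 x0" using precoin_law_reachable[of x0 x0 x0 0] by simp
    from step[OF this] show "expect (precoin_step (x0, x0, x0)) V \<le> W x0 x0 x0" by simp
    have W: "W x0 x0 x0 = (1 + BP) * P x0 + (R + B + \<alpha> * la\<^sup>2 / 2 + c1 / 2 + la * c2 / 2) * (r x0)\<^sup>2"
      unfolding W_def cst_def by (simp add: algebra_simps)
    have "(1 + BP) * \<mu> * P x0 \<le> 4 * (la * \<kappa>) * P x0"
      "(R + B + \<alpha> * la\<^sup>2 / 2 + c1 / 2 + la * c2 / 2) * \<mu> * (r x0)\<^sup>2 \<le> 2 * (la * \<kappa>) * (r x0)\<^sup>2"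
      unfolding BP_def \<mu>_def \<kappa>_def using P0[OF x0C] by (intro mult_right_mono cs; simp)+
    then show "W x0 x0 x0 * \<mu> \<le> 4 * (la * \<kappa>) * D x' x0"
      unfolding W DP by (simp add: algebra_simps)
  qed
qed

end

section \<open>Constants for weak monotonicity\<close>

text \<open>
  The hypothesis is the residue of the two competing demands on \<open>\<alpha> L\<close>. Its right side is at most 1, and
  at most its value \<open>4 g (1 - g)\<close> at \<open>z = 0\<close>.
\<close>
lemma gamma_range:
  fixes g z :: real
  assumes "0 < g" "g < 1" "0 \<le> z" "z \<le> 1" and H: "(1/2 + g)^2 \<le> 4*g*(1-z)*(1-g+g*z)"
  shows "1/10 \<le> g" "g \<le> 1/2"
proof -
  have "4*(g*(1-z))*(1-g*(1-z)) \<le> 1"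
    using zero_le_power2[of "1-2*(g*(1-z))"] by (simp add: power2_eq_square algebra_simps)
  then have "4*g*(1-z)*(1-g+g*z) \<le> 1" by (simp add: algebra_simps)
  with H have "(1/2+g)^2 \<le> 1^2" by simp
  then show g: "g \<le> 1/2" using power2_le_imp_le[of "1/2+g" 1] by simp
  have "z*(1-2*g) + g*z^2 \<ge> 0" using g assms by simp
  then have "(1-z)*(1-g+g*z) \<le> 1-g" by (simp add: power2_eq_square algebra_simps)
  then have "4*g*((1-z)*(1-g+g*z)) \<le> 4*g*(1-g)" using assms by (intro mult_left_mono) auto
  with H have "(1/2+g)^2 \<le> 4*g*(1-g)" by (simp add: mult.assoc)
  moreover have "4*g*(1-g) - (1/2+g)^2 = 5 * ((g - 1/10) * (1/2 - g))" by algebra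
  ultimately have "(g - 1/10) * (1/2 - g) \<ge> 0" by linarith
  then show "1/10 \<le> g" using g by (cases "g = 1/2") (auto simp: zero_le_mult_iff)
qed

text \<open>
  The shifted variable \<open>y = z + 3/2 e\<close> satisfies the hypothesis with \<open>e = 0\<close>. Its right side decreases in
  \<open>y\<close>, so an upper bound on \<open>y\<close> follows by evaluating it at a single value.
\<close>
lemma z_range:
  fixes g z e :: real
  assumes g: "0 < g" "g < 1" and z: "0 \<le> z" "z \<le> 1" and e: "0 \<le> e"
    and H: "(1/2 + g)^2 * (1+6*e) \<le> 4*g*(1-z)*(1-g+g*z)"
  shows "e \<le> 1/18" "z + 3/2*e \<le> 1/3" "z + 3/2*e \<le> 7/5*g + 1/50"
proof -
  have h0: "(1/2+g)^2 > 0" using g by simp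
  have H0: "(1/2 + g)^2 \<le> 4*g*(1-z)*(1-g+g*z)"
    using H mult_left_mono[of 1 "1+6*e" "(1/2+g)^2"] e by simp
  note gr = gamma_range[OF g z H0]
  have q: "(1-z)*(1-g+g*z) = (1-g) - z*(1-2*g) - g*z^2" by (simp add: power2_eq_square algebra_simps)
  have "z*(1-2*g) + g*z^2 \<ge> 0" using gr g z by simp
  then have "4*g*((1-z)*(1-g+g*z)) \<le> 4*g*(1-g)" unfolding q using g by (intro mult_left_mono) auto
  moreover have "4/3 * (1/2+g)^2 - 4*g*(1-g) = 1/3*(1-4*g)^2" by algebra
  then have "4*g*(1-g) \<le> (1/2+g)^2 * (4/3)" using zero_le_power2[of "1-4*g"] by linarith
  ultimately have "(1/2 + g)^2 * (1+6*e) \<le> (1/2+g)^2 * (4/3)" using H unfolding mult.assoc by linarith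
  then have "1+6*e \<le> 4/3" using h0 mult_le_cancel_left_pos by blast
  then show e18: "e \<le> 1/18" by simp
  \<comment> \<open>The slope \<open>3/2\<close> is what the factor \<open>1 + 6 e\<close> can pay for.\<close>
  define y where "y = z + 3/2*e"
  have y0: "0 \<le> y" using z e by (simp add: y_def)
  have key: "(1/2 + g)^2 \<le> 4*g*((1-g) - y*(1-2*g) - g*y^2)"
  proof -
    have "g*(1-2*g+g*(z+y)) \<le> (1/2+g)^2"
    proof -
      have "g*(g*(z+y)) \<le> g*(g*3)" using g z e e18 by (intro mult_left_mono) (auto simp: y_def)
      then show ?thesis using g by (simp add: power2_eq_square algebra_simps)
    qed
    then have "6*e*(g*(1-2*g+g*(z+y))) \<le> 6*e*(1/2+g)^2" using e by (intro mult_left_mono) auto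
    moreover have "4*g*((1-g) - z*(1-2*g) - g*z^2) - 4*g*((1-g) - y*(1-2*g) - g*y^2)
        = 6*e*(g*(1-2*g+g*(z+y)))"
      unfolding y_def by algebra
    ultimately show ?thesis using H unfolding mult.assoc[of "4*g"] q by (simp add: algebra_simps)
  qed
  have mono: "y \<le> b" if b: "0 \<le> b" and B: "4*g*((1-g) - b*(1-2*g) - g*b^2) \<le> (1/2+g)^2" for b
  proof (rule ccontr)
    assume "\<not> y \<le> b"
    then have yb: "b < y" by simp
    then have "b*(1-2*g) \<le> y*(1-2*g)" using gr by (intro mult_right_mono) auto
    moreover have "b^2 < y^2" using yb b by (intro power_strict_mono) auto
    then have "g*b^2 < g*y^2" using g by simp
    ultimately have "(1-g) - y*(1-2*g) - g*y^2 < (1-g) - b*(1-2*g) - g*b^2" by simp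
    then have "4*g*((1-g) - y*(1-2*g) - g*y^2) < 4*g*((1-g) - b*(1-2*g) - g*b^2)"
      using g by simp
    with key B show False by simp
  qed
  have "4*g*((1-g) - (1/3)*(1-2*g) - g*(1/3)^2) \<le> (1/2+g)^2"
    using zero_le_power2[of "1/2-5/3*g"] by (simp add: power2_eq_square algebra_simps)
  then show "z + 3/2*e \<le> 1/3" using mono[of "1/3"] by (simp add: y_def)
  have "4*g*((1-g) - (7/5*g+1/50)*(1-2*g) - g*(7/5*g+1/50)^2) \<le> (1/2+g)^2"
  proof -
    have "(1/2+g)^2 - 4*g*((1-g) - (7/5*g+1/50)*(1-2*g) - g*(7/5*g+1/50)^2)
        = (14/5*g^2 - 49/25*g + 3/10)^2 + 123/25*(g - 22/125)^2 + (2968/390625 - 38/3125*g)" by algebra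
    then show ?thesis
      using gr zero_le_power2[of "14/5*g^2 - 49/25*g + 3/10"] zero_le_power2[of "g - 22/125"] by linarith
  qed
  then show "z + 3/2*e \<le> 7/5*g + 1/50" using mono[of "7/5*g+1/50"] g by (simp add: y_def)
qed

text \<open>
  The inequality of \<open>young_budget_limit\<close> with its denominators cleared, \<open>S\<close> being the weight \<open>2 g + w\<close>.
\<close>
definition young_gap :: "real \<Rightarrow> real \<Rightarrow> real \<Rightarrow> real" where
  "young_gap g z S = 2*(1-g+g*z)*(1/2+g)^2*S - z*(1-z)*(1/2+g)^2*S
     - 4*g*(1-g+2*g*z)*(1-z)*(1-g+g*z)*S - 2*(1-g)*g*(1-z)*(1/2+g)^2"

text \<open>
  Both forms of \<open>S\<close> arise as \<open>2 g + w\<close> for the two branches of \<open>w = min (3/10) (1/5 + g - 9/8 z)\<close>. On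
  each box the polynomial is expanded in the Bernstein basis of that box, that is, in products of
  powers of the distances to its four sides; all coefficients turn out to be positive.
\<close>
lemma young_gap_cap_1:
  fixes x y :: real
  assumes "1/10 \<le> x" "x \<le> 3/10" "0 \<le> y" "y \<le> 1/6"
  shows "0 \<le> young_gap x y (2*x+3/10)"
proof -
  define a b c d where "a = 3/10 - x" and "b = x - 1/10" and "c = 1/6 - y" and "d = y"
  have "young_gap x y (2*x+3/10) =
      13122*a^4*c^3 + 40014*a^4*d*c^2 + (83049/2)*a^4*d^2*c + 14635*a^4*d^3 + 34020*b*a^3*c^3
      + 108108*b*a^3*d*c^2 + 119421*b*a^3*d^2*c + 45360*b*a^3*d^3 + 20952*b^2*a^2*c^3 + 72666*b^2*a^2*d*c^2
      + 94521*b^2*a^2*d^2*c + 42915*b^2*a^2*d^3 + 3348*b^3*a*c^3 + 10692*b^3*a*d*c^2 + 23205*b^3*a*d^2*c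
      + 16050*b^3*a*d^3 + 1134*b^4*c^3 + 864*b^4*d*c^2 + (4617/2)*b^4*d^2*c + 2700*b^4*d^3"
    unfolding young_gap_def a_def b_def c_def d_def by algebra
  moreover have "0 \<le> a" "0 \<le> b" "0 \<le> c" "0 \<le> d" using assms by (simp_all add: a_def b_def c_def d_def)
  ultimately show ?thesis by simp
qed

lemma young_gap_cap_2:
  fixes x y :: real
  assumes "1/10 \<le> x" "x \<le> 3/10" "1/6 \<le> y" "y \<le> 1/3"
  shows "0 \<le> young_gap x y (2*x+3/10)"
proof -
  define a b c d where "a = 3/10 - x" and "b = x - 1/10" and "c = 1/3 - y" and "d = y - 1/6"
  have "young_gap x y (2*x+3/10) =
      14635*a^4*c^3 + (92571/2)*a^4*d*c^2 + 49536*a^4*d^2*c + 17888*a^4*d^3 + 45360*b*a^3*c^3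
      + 152739*b*a^3*d*c^2 + 174744*b*a^3*d^2*c + 67392*b*a^3*d^3 + 42915*b^2*a^2*c^3 + 162969*b^2*a^2*d*c^2
      + 209562*b^2*a^2*d^2*c + 89616*b^2*a^2*d^3 + 16050*b^3*a*c^3 + 73095*b^3*a*d*c^2 + 110472*b^3*a*d^2*c
      + 53616*b^3*a*d^3 + 2700*b^4*c^3 + (27783/2)*b^4*d*c^2 + 24030*b^4*d^2*c + 12960*b^4*d^3"
    unfolding young_gap_def a_def b_def c_def d_def by algebra
  moreover have "0 \<le> a" "0 \<le> b" "0 \<le> c" "0 \<le> d" using assms by (simp_all add: a_def b_def c_def d_def)
  ultimately show ?thesis by simp
qed

lemma young_gap_cap_3:
  fixes x y :: real
  assumes "3/10 \<le> x" "x \<le> 1/2" "0 \<le> y" "y \<le> 1/12"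
  shows "0 \<le> young_gap x y (2*x+3/10)"
proof -
  define a b c d where "a = 1/2 - x" and "b = x - 3/10" and "c = 1/12 - y" and "d = y"
  have "young_gap x y (2*x+3/10) =
      9072*a^4*c^3 + 17064*a^4*d*c^2 + 14877*a^4*d^2*c + (14013/2)*a^4*d^3 + 45792*b*a^3*c^3
      + 53568*b*a^3*d*c^2 + 9750*b*a^3*d^2*c + 2757*b*a^3*d^3 + 224640*b^2*a^2*c^3 + 453960*b^2*a^2*d*c^2
      + 306870*b^2*a^2*d^2*c + 79440*b^2*a^2*d^3 + 367200*b^3*a*c^3 + 878400*b^3*a*d*c^2 + 711150*b^3*a*d^2*c
      + 201975*b^3*a*d^3 + 162000*b^4*c^3 + 414000*b^4*d*c^2 + 356625*b^4*d^2*c + (210875/2)*b^4*d^3"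
    unfolding young_gap_def a_def b_def c_def d_def by algebra
  moreover have "0 \<le> a" "0 \<le> b" "0 \<le> c" "0 \<le> d" using assms by (simp_all add: a_def b_def c_def d_def)
  ultimately show ?thesis by simp
qed

lemma young_gap_cap_4:
  fixes x y :: real
  assumes "3/10 \<le> x" "x \<le> 1/2" "1/12 \<le> y" "y \<le> 1/6"
  shows "0 \<le> young_gap x y (2*x+3/10)"
proof -
  define a b c d where "a = 1/2 - x" and "b = x - 3/10" and "c = 1/6 - y" and "d = y - 1/12"
  have "young_gap x y (2*x+3/10) =
      (14013/2)*a^4*c^3 + 27162*a^4*d*c^2 + 41634*a^4*d^2*c + 21600*a^4*d^3 + 2757*b*a^3*c^3
      + 6792*b*a^3*d*c^2 + 47652*b*a^3*d^2*c + 44400*b*a^3*d^3 + 79440*b^2*a^2*c^3 + 169770*b^2*a^2*d*c^2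
      + 179760*b^2*a^2*d^2*c + 91320*b^2*a^2*d^3 + 201975*b^3*a*c^3 + 500700*b^3*a*d*c^2 + 457500*b^3*a*d^2*c
      + 160800*b^3*a*d^3 + (210875/2)*b^4*c^3 + 276000*b^4*d*c^2 + 252750*b^4*d^2*c + 83000*b^4*d^3"
    unfolding young_gap_def a_def b_def c_def d_def by algebra
  moreover have "0 \<le> a" "0 \<le> b" "0 \<le> c" "0 \<le> d" using assms by (simp_all add: a_def b_def c_def d_def)
  ultimately show ?thesis by simp
qed

lemma young_gap_cap_5:
  fixes x y :: real
  assumes "3/10 \<le> x" "x \<le> 1/2" "1/6 \<le> y" "y \<le> 1/3"
  shows "0 \<le> young_gap x y (2*x+3/10)"
proof -
  define a b c d where "a = 1/2 - x" and "b = x - 3/10" and "c = 1/3 - y" and "d = y - 1/6"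
  have "young_gap x y (2*x+3/10) =
      2700*a^4*c^3 + (27783/2)*a^4*d*c^2 + 24030*a^4*d^2*c + 12960*a^4*d^3 + 5550*b*a^3*c^3
      + 38037*b*a^3*d*c^2 + 81768*b*a^3*d^2*c + 50064*b*a^3*d^3 + 11415*b^2*a^2*c^3 + 57795*b^2*a^2*d*c^2
      + 123450*b^2*a^2*d^2*c + 78960*b^2*a^2*d^3 + 20100*b^3*a*c^3 + 66525*b^3*a*d*c^2 + 106800*b^3*a*d^2*c
      + 62400*b^3*a*d^3 + 10375*b^4*c^3 + (60375/2)*b^4*d*c^2 + 39000*b^4*d^2*c + 20000*b^4*d^3"
    unfolding young_gap_def a_def b_def c_def d_def by algebra
  moreover have "0 \<le> a" "0 \<le> b" "0 \<le> c" "0 \<le> d" using assms by (simp_all add: a_def b_def c_def d_def)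
  ultimately show ?thesis by simp
qed

lemma young_gap_linear_1:
  fixes x y :: real
  assumes "1/10 \<le> x" "x \<le> 3/10" "0 \<le> y" "y \<le> 1/3"
  shows "0 \<le> young_gap x y (1/5+3*x-9*y/8)"
proof -
  define a b c d where "a = 3/10 - x" and "b = x - 1/10" and "c = 1/3 - y" and "d = y"
  have "young_gap x y (1/5+3*x-9*y/8) =
      (19683/4)*a^4*c^4 + (224289/16)*a^4*d*c^3 + (228465/16)*a^4*d^2*c^2 + (41793/8)*a^4*d^3*c
      + (147/4)*a^4*d^4 + 16038*b*a^3*c^4 + (383535/8)*b*a^3*d*c^3 + (460251/8)*b*a^3*d^2*c^2
      + (121305/4)*b*a^3*d^3*c + (9285/2)*b*a^3*d^4 + (31023/2)*b^2*a^2*c^4 + (316197/8)*b^2*a^2*d*c^3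
      + (408519/8)*b^2*a^2*d^2*c^2 + (71487/2)*b^2*a^2*d^3*c + (33957/4)*b^2*a^2*d^4 + 9234*b^3*a*c^4
      + (114993/8)*b^3*a*d*c^3 + (124947/8)*b^3*a*d^2*c^2 + (34353/2)*b^3*a*d^3*c + (12789/2)*b^3*a*d^4
      + (14175/4)*b^4*c^4 + (79893/16)*b^4*d*c^3 + (59229/16)*b^4*d^2*c^2 + (36441/8)*b^4*d^3*c + 2151*b^4*d^4"
    unfolding young_gap_def a_def b_def c_def d_def by algebra
  moreover have "0 \<le> a" "0 \<le> b" "0 \<le> c" "0 \<le> d" using assms by (simp_all add: a_def b_def c_def d_def)
  ultimately show ?thesis by simp
qed

lemma young_gap_linear_2:
  fixes x y :: real
  assumes "3/10 \<le> x" "x \<le> 1/2" "0 \<le> y" "y \<le> 1/3"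
  shows "0 \<le> young_gap x y (1/5+3*x-9*y/8)"
proof -
  define a b c d where "a = 1/2 - x" and "b = x - 3/10" and "c = 1/3 - y" and "d = y"
  have "young_gap x y (1/5+3*x-9*y/8) =
      (14175/4)*a^4*c^4 + (79893/16)*a^4*d*c^3 + (59229/16)*a^4*d^2*c^2 + (36441/8)*a^4*d^3*c + 2151*a^4*d^4
      + 19116*b*a^3*c^4 + (204579/8)*b*a^3*d*c^3 + (111969/8)*b*a^3*d^2*c^2 + (38529/2)*b*a^3*d^3*c
      + (21627/2)*b*a^3*d^4 + (90315/2)*b^2*a^2*c^4 + (584955/8)*b^2*a^2*d*c^3 + (369585/8)*b^2*a^2*d^2*c^2
      + (84015/2)*b^2*a^2*d^3*c + (86985/4)*b^2*a^2*d^4 + 48600*b^3*a*c^4 + (779625/8)*b^3*a*d*c^3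
      + (622125/8)*b^3*a*d^2*c^2 + (209175/4)*b^3*a*d^3*c + (42825/2)*b^3*a*d^4 + (70875/4)*b^4*c^4
      + (658125/16)*b^4*d*c^3 + (604125/16)*b^4*d^2*c^2 + (184125/8)*b^4*d^3*c + (31875/4)*b^4*d^4"
    unfolding young_gap_def a_def b_def c_def d_def by algebra
  moreover have "0 \<le> a" "0 \<le> b" "0 \<le> c" "0 \<le> d" using assms by (simp_all add: a_def b_def c_def d_def)
  ultimately show ?thesis by simp
qed

lemma young_gap_nonneg:
  fixes g z w :: real
  assumes g: "1/10 \<le> g" "g \<le> 1/2" and z: "0 \<le> z" "z \<le> 1/3"
    and w: "w = 3/10 \<or> w = 1/5 + g - 9/8*z"
  shows "young_gap g z (2*g+w) \<ge> 0"
  using w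
proof
  assume w: "w = 3/10"
  consider "g \<le> 3/10" "z \<le> 1/6" | "g \<le> 3/10" "1/6 \<le> z" | "3/10 \<le> g" "z \<le> 1/12"
    | "3/10 \<le> g" "1/12 \<le> z" "z \<le> 1/6" | "3/10 \<le> g" "1/6 \<le> z" by linarith
  then show ?thesis unfolding w
    using young_gap_cap_1[of g z] young_gap_cap_2[of g z] young_gap_cap_3[of g z] young_gap_cap_4[of g z] young_gap_cap_5[of g z] g z by cases blast+
next
  assume w: "w = 1/5 + g - 9/8*z"
  have E: "2*g+w = 1/5+3*g-9*z/8" using w by simp
  consider "g \<le> 3/10" | "3/10 \<le> g" by linarith
  then show ?thesis unfolding E using young_gap_linear_1[of g z] young_gap_linear_2[of g z] g z by cases blast+
qed

text \<open>
  The budget for Young's inequality in the limit \<open>\<lambda> = 1\<close>; it has to cover both outcomes of the coin.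
\<close>
lemma young_budget_limit:
  fixes g z w :: real
  assumes g: "1/10 \<le> g" "g \<le> 1/2" and z: "0 \<le> z" "z \<le> 1/3"
    and w: "w = 3/10 \<or> w = 1/5 + g - 9/8*z" and S: "2*g+w > 0"
    and c: "c = 1 - g + g*z"
  shows "(1-g)/c * g / (2*g+w) \<le> 1/(1-z) - z/(2*c) - 2*g*(c+g*z)/(1/2+g)^2"
proof -
  have c0: "c > 0" and z1: "1 - z > 0" and h0: "(1/2+g)^2 > 0" using g z unfolding c by (auto intro: add_pos_nonneg)
  define S where "S = 2*g+w"
  define h where "h = (1/2+g)^2"
  have "2*c*h*S - z*(1-z)*h*S - 4*g*(c+g*z)*(1-z)*c*S - 2*(1-g)*g*(1-z)*h \<ge> 0"
    using young_gap_nonneg[OF g z w] unfolding young_gap_def c S_def h_def by (simp add: algebra_simps)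
  moreover have "1/(1-z) - z/(2*c) - 2*g*(c+g*z)/h - (1-g)/c * g / S
     = (2*c*h*S - z*(1-z)*h*S - 4*g*(c+g*z)*(1-z)*c*S - 2*(1-g)*g*(1-z)*h) / (2*c*h*S*(1-z))"
    using c0 z1 h0 S unfolding S_def[symmetric] h_def[symmetric]
    by (simp add: field_simps)
  ultimately have "1/(1-z) - z/(2*c) - 2*g*(c+g*z)/h - (1-g)/c * g / S \<ge> 0"
    using c0 z1 h0 S unfolding S_def[symmetric] h_def[symmetric] by simp
  then show ?thesis unfolding S_def h_def by simp
qed

text \<open>
  For \<open>\<lambda> = 1 - e\<close> the weight \<open>w\<close> must shrink by \<open>8/5 e\<close>, which costs at most \<open>9/4 e\<close>. The hypothesis on \<open>H\<close>
  improves the limit budget by at least the same amount.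
\<close>
lemma young_budget:
  fixes g z e H c :: real
  assumes g: "0 < g" "g < 1" and z: "0 \<le> z" "z < 1" and e: "0 \<le> e" and c: "c = 1 - g + g*z"
    and H: "(1/2 + g)^2 * (1+6*e) \<le> H" "H \<le> 4*g*(1-z)*c"
    and w: "w = min (3/10) (1/5 + g - 9/8*z - 8/5*e)"
  shows "1/10 \<le> g" "g \<le> 1/2" "z \<le> 1/3" "e \<le> 1/18" "0 \<le> w"
    "(1-g)/c * g / (2*g+w) \<le> 1/(1-z) - z/(2*c) - 2*g*(c+g*z)/H"
proof -
  define h where "h = (1/2+g)^2"
  have h0: "h > 0" using g by (simp add: h_def)
  have c0: "c > 0" using g z unfolding c by (auto intro: add_pos_nonneg)
  have H1: "h * (1+6*e) \<le> 4*g*(1-z)*(1-g+g*z)" using H c by (simp add: h_def)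
  have "h * 1 \<le> h * (1+6*e)" using e h0 by (intro mult_left_mono) auto
  then have H0: "h \<le> 4*g*(1-z)*(1-g+g*z)" using H1 by linarith
  have z1: "z \<le> 1" using z by simp
  from gamma_range[OF g z(1) z1] H0 show gr: "1/10 \<le> g" "g \<le> 1/2" unfolding h_def by auto
  from z_range[OF g z(1) z1 e] H1 have b: "e \<le> 1/18" "z + 3/2*e \<le> 1/3" "z + 3/2*e \<le> 7/5*g + 1/50"
    unfolding h_def by auto
  from b(1) show e18: "e \<le> 1/18" .
  from b(2) e show z3: "z \<le> 1/3" by simp
  show w0: "0 \<le> w" unfolding w using b e gr by auto
  define v where "v = min (3/10) (1/5 + g - 9/8*z)"
  have v: "v = 3/10 \<or> v = 1/5 + g - 9/8*z" by (auto simp: v_def)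
  have v': "v \<le> 3/10" "v \<le> 1/5 + g - 9/8*z" unfolding v_def by (rule min.cobounded1, rule min.cobounded2)
  have wv: "v - 8/5*e \<le> w" unfolding w by (rule min.boundedI) (use e v' in linarith)+
  define S where "S = 2*g+v"
  have SS: "S * (S - 8/5*e) \<ge> 32/45 * g" and S'0: "S - 8/5*e > 0"
  proof -
    have "S - 8/5*e \<ge> 71/400 + 57/40*g"
    proof (cases "v = 3/10")
      case True then show ?thesis using e18 gr by (simp add: S_def)
    next
      case False
      then have "v = 1/5 + g - 9/8*z" using v by simp
      then show ?thesis using b e unfolding S_def by simp
    qed
    then have a: "71/400 + 57/40*g \<le> S - 8/5*e" "71/400 + 57/40*g \<le> S" using e by auto
    have "(71/400 + 57/40*g)*(71/400 + 57/40*g) \<le> S * (S - 8/5*e)"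
      using a g by (intro mult_mono) auto
    moreover have "(71/400 + 57/40*g)*(71/400 + 57/40*g) = (71/400 - 57/40*g)^2 + 4*(71/400)*(57/40)*g" by algebra
    ultimately show "S * (S - 8/5*e) \<ge> 32/45 * g" using zero_le_power2[of "71/400 - 57/40*g"] g by linarith
    show "S - 8/5*e > 0" using a g by simp
  qed
  have S0: "S > 0" using S'0 e by simp
  define r where "r = (1-g)/c"
  have r: "0 \<le> r" "r \<le> 1" using g c0 z unfolding r_def c by auto
  have main: "r * g / S \<le> 1/(1-z) - z/(2*c) - 2*g*(c+g*z)/h"
    using young_budget_limit[OF gr z(1) z3 v _ c] S0 unfolding S_def h_def r_def by simp
  have "r * g / (2*g+w) \<le> r * g / (S - 8/5*e)"
    using wv S'0 r g unfolding S_def by (intro divide_left_mono) (auto intro!: mult_pos_pos)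
  also have "\<dots> = r * g / S + r * g * (8/5*e) / (S * (S - 8/5*e))"
    using S0 S'0 by (simp add: field_simps)
  also have "r * g * (8/5*e) / (S * (S - 8/5*e)) \<le> g * (8/5*e) / (32/45*g)"
    using r g e SS by (intro frac_le mult_right_mono) (auto simp: mult_left_le_one_le)
  also have "g * (8/5*e) / (32/45*g) = 9/4*e" using g by simp
  also have "9/4*e \<le> 2*g*(c+g*z)/h - 2*g*(c+g*z)/H"
  proof -
    have "2*g*(c+g*z)/H \<le> 2*g*(c+g*z)/(h*(1+6*e))"
      using H h0 e g c0 z unfolding h_def[symmetric] by (intro divide_left_mono) (auto intro!: mult_pos_pos add_pos_nonneg elim: order.strict_trans2[rotated])
    also have "\<dots> = 2*g*(c+g*z)/h - (2*g*(c+g*z)/h)*(6*e/(1+6*e))"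
    proof -
      have "1/(1+6*e) = 1 - 6*e/(1+6*e)" using e by (simp add: field_simps)
      then have "(2*g*(c+g*z)/h)*(1/(1+6*e)) = (2*g*(c+g*z)/h)*(1 - 6*e/(1+6*e))" by simp
      then show ?thesis by (simp add: right_diff_distrib)
    qed
    finally have 1: "(2*g*(c+g*z)/h)*(6*e/(1+6*e)) \<le> 2*g*(c+g*z)/h - 2*g*(c+g*z)/H" by simp
    have "h \<le> 4*g*c"
    proof -
      have "4*g*(1-z)*c \<le> 4*g*c" using g z c0 by (simp add: mult_left_le)
      with H0 show ?thesis unfolding c by linarith
    qed
    also have "\<dots> \<le> 4*g*(c+g*z)" using g z by simp
    finally have "1/2 \<le> 2*g*(c+g*z)/h" using h0 by (simp add: field_simps)
    moreover have "9/2*e \<le> 6*e/(1+6*e)"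
    proof -
      have "9/2*e*(1+6*e) \<le> 6*e" using e e18 mult_left_mono[of "6*e" "1/3" "9/2*e"] by (simp add: algebra_simps)
      then show ?thesis using e by (simp add: field_simps)
    qed
    ultimately have "1/2*(9/2*e) \<le> (2*g*(c+g*z)/h)*(6*e/(1+6*e))" using e by (intro mult_mono) auto
    with 1 show ?thesis by simp
  qed
  finally show "(1-g)/c * g / (2*g+w) \<le> 1/(1-z) - z/(2*c) - 2*g*(c+g*z)/H"
    using main unfolding r_def[symmetric] by linarith
qed

text \<open>
  The coefficients of the potential when \<open>a = \<alpha> \<beta> \<le> 2 \<alpha> L = 2 k\<close>. The lower bound on \<open>a\<close> and the upper bound
  on \<open>k\<^sup>2\<close> enclose the quantity \<open>H = 4 k\<^sup>2 (3 - 2 \<lambda>) / \<lambda>\<close>, which confines \<open>g\<close>, \<open>z = p c / g\<close> and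
  \<open>e = 1 - \<lambda>\<close> to the region treated above. The value \<open>3/10\<close> is the part of the coefficient of the
  new Bregman distance that is kept in reserve against the squares that each coin outcome produces; \<open>w\<close>
  is the surplus paid when the coin keeps the old point, and \<open>X1\<close>, \<open>X2\<close> are the amounts paid
  when it refreshes.
\<close>
lemma bregman_constants:
  fixes g p al la k n a :: real
  assumes p: "0 < p" "p < 1" and g: "p < g" "g < 1" and al: "0 < al" "al \<le> (g-p)/(1-p)"
    and la: "0 < la" "la < 1" and n: "0 \<le> n" and k: "0 \<le> k"
    and l: "k^2*(3-2*la) \<le> al*(la*((1-g)/(1-p)) - 2*n)"
    and a1: "1+g+al/2 \<le> la*(1/2+a+al/2)" and a2: "a \<le> 2*k"
  defines "t \<equiv> 1 - g"
  defines "zz \<equiv> 3/10 + g*t"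
  defines "X1 \<equiv> t^2*(1+t)/zz - t" and "X2 \<equiv> t^3*(1+t)/zz + t^2"
  obtains A B w where "0 \<le> w" "w \<le> 3/10" "0 \<le> B" "A \<le> 1 + a"
    "2*n + p*k^2/(2*g^2) + (1-p)*k^2/(2*g+w) \<le> la*t/2"
    "A - 1 - a + g^2*(1-la) \<le> -3/10" "A - 1 - a + (g+w/2)*(1-la) \<le> -3/10"
    "t + p*X1 \<le> la*B" "g + B + (1-p)*w + p*X2 \<le> la*A"
    "(1+B)*(1+g-al) \<le> 2*la*(A - k^2/t)" "0 \<le> X1" "0 < t" "0 < g" "0 < k"
proof -
  define c where "c = t/(1-p)"
  define e where "e = 1 - la"
  define z where "z = p*c/g"
  have t0: "0 < t" using g by (simp add: t_def)
  have g0: "0 < g" using p g by simp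
  have c0: "0 < c" using t0 p by (simp add: c_def)
  have ct: "c*(1-p) = t" using p by (simp add: c_def)
  have gz: "g*z = p*c" using g0 by (simp add: z_def)
  have c: "c = 1 - g + g*z" using ct unfolding gz t_def by (simp add: algebra_simps)
  have G: "1 - c = (g-p)/(1-p)" using p unfolding c_def t_def by (simp add: field_simps)
  have G0: "1 - c > 0" unfolding G using p g by simp
  have Gz: "1 - c = g*(1-z)" using c by (simp add: algebra_simps)
  have z: "0 \<le> z" "z < 1"
  proof -
    show "0 \<le> z" using p c0 g0 by (simp add: z_def)
    show "z < 1" using G0 g0 unfolding Gz by (simp add: zero_less_mult_iff)
  qed
  have e: "0 < e" "e < 1" and lae: "la = 1 - e" using la by (auto simp: e_def)
  have inv: "1 + e \<le> 1/la" using la unfolding lae by (simp add: field_simps power2_eq_square)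
  define h where "h = 1/2 + g"
  define H where "H = 4*k^2*(3-2*la)/la"
  have lc: "al * (la*c - 2*n) \<le> (1-c)*(la*c-2*n)" if "0 \<le> la*c - 2*n"
    using that al unfolding G by (intro mult_right_mono) auto
  have pos: "0 \<le> la*c - 2*n"
  proof -
    have "0 \<le> k^2*(3-2*la)" using la by simp
    with l have "0 \<le> al*(la*c-2*n)" unfolding c_def t_def by linarith
    then show ?thesis using al by (simp add: zero_le_mult_iff)
  qed
  have l2: "k^2*(3-2*la) \<le> (1-c)*(la*c-2*n)"
    using l lc[OF pos] unfolding c_def t_def by linarith
  have l3: "k^2*(3-2*la) \<le> (1-c)*c*la"
  proof -
    have "(1-c)*(la*c-2*n) \<le> (1-c)*(la*c)" using n G0 by (intro mult_left_mono) auto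
    with l2 show ?thesis by (simp add: algebra_simps)
  qed
  have H4: "H \<le> 4*g*(1-z)*c"
  proof -
    have "H \<le> 4*((1-c)*c)" using l3 la unfolding H_def by (simp add: field_simps)
    then show ?thesis unfolding Gz by (simp add: algebra_simps)
  qed
  have a3: "(1+g)/la - 1/2 \<le> a"
  proof -
    have "al/2*la \<le> al/2" using al la by (simp add: mult_left_le)
    then have "1+g \<le> la*(1/2+a)" using a1 by (simp add: algebra_simps)
    then show ?thesis using la by (simp add: field_simps)
  qed
  have k2: "h + (1+g)*e \<le> 2*k"
  proof -
    have "(1+g)*(1+e) \<le> (1+g)*(1/la)" using inv g0 by (intro mult_left_mono) auto
    then show ?thesis using a3 a2 unfolding h_def by (simp add: algebra_simps)
  qed
  have h0: "0 < h" using g0 by (simp add: h_def)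
  have k0: "0 < k" using k2 h0 g0 e mult_pos_pos[of "1+g" e] by linarith
  have la3: "1 + 3*e \<le> (3-2*la)/la" using la e unfolding lae by (simp add: field_simps power2_eq_square)
  have HH: "(h + (1+g)*e)^2*(1+3*e) \<le> H"
  proof -
    have "(h + (1+g)*e)^2*(1+3*e) \<le> (2*k)^2*((3-2*la)/la)"
      using k2 la3 h0 g0 e by (intro mult_mono power_mono) auto
    then show ?thesis unfolding H_def by (simp add: power_mult_distrib)
  qed
  have g12: "g \<le> 1/2"
  proof -
    have "h^2*1 \<le> (h + (1+g)*e)^2*(1+3*e)" using h0 g0 e by (intro mult_mono power_mono) auto
    then have "(1/2+g)^2 \<le> 4*g*(1-z)*(1-g+g*z)" using HH H4 unfolding h_def c by linarith
    from gamma_range(2)[OF g0 g(2) z(1) _ this] z show ?thesis by simp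
  qed
  have H6: "(1/2+g)^2*(1+6*e) \<le> H"
  proof -
    have "3/2*h \<le> 1+g" using g12 unfolding h_def by simp
    then have "h + 3/2*h*e \<le> h + (1+g)*e" using e by (simp add: mult_right_mono)
    then have "(h + 3/2*h*e)^2*(1+3*e) \<le> (h + (1+g)*e)^2*(1+3*e)"
      using h0 e by (intro mult_right_mono power_mono) auto
    moreover have "(h + 3/2*h*e)^2*(1+3*e) - h^2*(1+6*e) = h^2*e^2*(45/4 + 27/4*e)" by algebra
    moreover have "h^2*e^2*(45/4 + 27/4*e) \<ge> 0" using e by simp
    ultimately show ?thesis using HH unfolding h_def by linarith
  qed
  \<comment> \<open>The cap \<open>3/10\<close> is the reserve; the other branch is what the recursion for \<open>A\<close> allows.\<close>
  define w where "w = min (3/10) (1/5 + g - 9/8*z - 8/5*e)"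
  note F = young_budget[OF g0 g(2) z less_imp_le[OF e(1)] c H6 H4 w_def]
  have w3: "w \<le> 3/10" "w \<le> 1/5 + g - 9/8*z - 8/5*e" unfolding w_def by (rule min.cobounded1, rule min.cobounded2)
  have z0: "0 < zz" using g0 t0 by (simp add: zz_def add_pos_pos)
  have t12: "1/2 \<le> t" "t \<le> 1" using g12 g0 by (auto simp: t_def)
  have X1: "X1 = t*(2*t^2-3/10)/zz" using z0 unfolding X1_def zz_def t_def by (simp add: field_simps power2_eq_square)
  have tt: "1/4 \<le> t^2" using power_mono[of "1/2" t 2] t12 by (simp add: power2_eq_square)
  have X10: "0 \<le> X1" unfolding X1 using t0 z0 tt by simp
  have pt: "p \<le> g*z/t"
  proof -
    have "p*t \<le> p*c" using p c0 unfolding ct[symmetric] by (simp add: mult_left_le)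
    then show ?thesis using t0 unfolding gz by (simp add: field_simps)
  qed
  have pX1: "p*X1 \<le> 3/20"
  proof -
    have "p*X1 \<le> g*z/t*X1" using pt X10 by (intro mult_right_mono) auto
    also have "\<dots> = z*(g*(2*t^2-3/10)/zz)" using t0 unfolding X1 by simp
    also have "\<dots> \<le> 1/3*(9/20)"
    proof -
      have "9/20*zz - g*(2*t^2-3/10) = 7/4*(g-11/50)^2 + 103/10000 + 2*((1/2-g)*(g-1/5)^2)"
        unfolding zz_def t_def by algebra
      moreover have "0 \<le> (1/2-g)*(g-1/5)^2" using g12 by simp
      ultimately have "g*(2*t^2-3/10) \<le> 9/20*zz"
        using zero_le_power2[of "g-11/50"] by linarith
      then have "g*(2*t^2-3/10)/zz \<le> 9/20" using z0 by (simp add: field_simps)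
      then show ?thesis using F(3) z g0 z0 tt by (intro mult_mono) auto
    qed
    finally show ?thesis by simp
  qed
  have pX: "p*X1 + p*X2 \<le> 9/8*z"
  proof -
    have s: "X1 + X2 = t*(t*(1+t)^2 - g*zz)/zz"
    proof -
      have "X1 + X2 = (t^2*(1+t) + t^3*(1+t))/zz - (t - t^2)"
        unfolding X1_def X2_def by (simp add: add_divide_distrib)
      also have "t^2*(1+t) + t^3*(1+t) = t*(t*(1+t)^2)" by algebra
      also have "t - t^2 = t*g" unfolding t_def by algebra
      also have "t*(t*(1+t)^2)/zz - t*g = t*(t*(1+t)^2 - g*zz)/zz" using z0 by (simp add: field_simps)
      finally show ?thesis .
    qed
    have "9/8*zz - g*(t*(1+t)^2 - g*zz) = 127/40*(g-32/125)^2 + 4*((1/2-g)*(g-1/4)^2) + (5529/1250000 + 3/5000*g)"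
      unfolding zz_def t_def by algebra
    moreover have "0 \<le> (1/2-g)*(g-1/4)^2" using g12 by simp
    ultimately have u: "g*(t*(1+t)^2 - g*zz) \<le> 9/8*zz"
      using g0 zero_le_power2[of "g-32/125"] by linarith
    have "X2 \<ge> 0" unfolding X2_def using t0 z0 by simp
    then have "p*(X1+X2) \<le> g*z/t*(X1+X2)" using pt X10 by (intro mult_right_mono) auto
    also have "\<dots> = z*(g*(t*(1+t)^2 - g*zz)/zz)" using t0 unfolding s by simp
    also have "\<dots> \<le> z*(9/8)" using u z0 z by (intro mult_left_mono) (auto simp: field_simps)
    finally show ?thesis by (simp add: algebra_simps)
  qed
  \<comment> \<open>The summand \<open>(g + 3/20) e\<close> covers the Young terms for both coin outcomes,
    as \<open>g\<^sup>2\<close> and \<open>g + w / 2\<close> are at most \<open>g + 3/20\<close>.\<close>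
  define A where "A = 1 + a - 3/10 - (g+3/20)*e"
  define B where "B = (t + p*X1)/la"
  have la18: "1/la \<le> 1 + 18/17*e" using la F(4) e unfolding lae by (simp add: field_simps power2_eq_square)
  have laA: "1 + g + la/5 - (g+3/20)*e \<le> la*A"
  proof -
    have "1+g \<le> la*(1/2+a)" using a3 la by (simp add: field_simps)
    moreover have "(g+3/20)*e*la \<le> (g+3/20)*e" using g0 e la by (simp add: mult_left_le)
    moreover have "la*A = la*(1/2+a) + la/5 - (g+3/20)*e*la" unfolding A_def by (simp add: algebra_simps)
    ultimately show ?thesis by linarith
  qed
  have Bb: "B \<le> (t + p*X1)*(1 + 18/17*e)"
    unfolding B_def using la18 mult_left_mono[OF la18, of "t+p*X1"] t0 p X10 by simp
  have Bt: "t + p*X1 \<le> t + 3/20" using pX1 by simp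
  have B2: "B \<le> t + p*X1 + 18/17*e*(t + 3/20)"
  proof -
    have "(t + p*X1)*(18/17*e) \<le> (t+3/20)*(18/17*e)" using Bt e by (intro mult_right_mono) auto
    moreover have "(t + p*X1)*(1 + 18/17*e) = t + p*X1 + (t + p*X1)*(18/17*e)" by algebra
    moreover have "(t+3/20)*(18/17*e) = 18/17*e*(t + 3/20)" by simp
    ultimately show ?thesis using Bb by linarith
  qed
  show ?thesis
  proof (rule that[of w B A])
    show "0 \<le> w" by (rule F(5))
    show "w \<le> 3/10" by (rule w3)
    show "0 \<le> B" unfolding B_def using t0 p X10 la by simp
    show "A \<le> 1 + a" unfolding A_def using mult_pos_pos[of "g+3/20" e] g0 e by linarith
    show "A - 1 - a + g^2*(1-la) \<le> -3/10"
    proof -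
      have "g^2*e \<le> (g+3/20)*e" using g0 g12 e by (intro mult_right_mono) (auto simp: power2_eq_square intro: order_trans[OF mult_left_le])
      then show ?thesis unfolding A_def e_def by simp
    qed
    show "A - 1 - a + (g+w/2)*(1-la) \<le> -3/10"
    proof -
      have "(g+w/2)*e \<le> (g+3/20)*e" using w3 e by (intro mult_right_mono) auto
      then show ?thesis unfolding A_def e_def by simp
    qed
    show "t + p*X1 \<le> la*B" unfolding B_def using la by simp
    show "g + B + (1-p)*w + p*X2 \<le> la*A"
    proof -
      have "(1-p)*w \<le> w" using F(5) p by (simp add: mult_left_le_one_le)
      moreover have "18/17*e*(t+3/20) + (g+3/20)*e + e/5 \<le> 8/5*e"
      proof -
        have "18/17*(t+3/20) + (g+3/20) + 1/5 \<le> 8/5" using g0 unfolding t_def by (simp add: field_simps)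
        then have "(18/17*(t+3/20) + (g+3/20) + 1/5)*e \<le> 8/5*e" using e by (intro mult_right_mono) auto
        then show ?thesis by (simp add: algebra_simps)
      qed
      ultimately show ?thesis using laA B2 pX w3(2) lae t_def by linarith
    qed
    show "(1+B)*(1+g-al) \<le> 2*la*(A - k^2/t)"
    proof -
      have kc: "k^2 \<le> al*c"
      proof -
        have "al*(la*c - 2*n) \<le> al*(la*c)" using n al by (intro mult_left_mono) auto
        then have "k^2*(3-2*la) \<le> al*(la*c)" using l unfolding c_def t_def by linarith
        moreover have "k^2*1 \<le> k^2*(3-2*la)" using la by (intro mult_left_mono) auto
        moreover have "al*(la*c) \<le> al*c" using al la c0 by (simp add: mult_left_le_one_le)
        ultimately show ?thesis by linarith
      qed
      have c1: "c \<le> 1" using G0 by simp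
      have "h/2 \<le> k" using k2 g0 e mult_pos_pos[of "1+g" e] by linarith
      then have "(h/2)^2 \<le> k^2" using h0 by (intro power_mono) auto
      moreover have "al*c \<le> al" using al c1 by (simp add: mult_left_le)
      ultimately have alb: "h^2/4 \<le> al" using kc by (simp add: power_divide)
      have "1 + g - al \<le> 15/16 + 3/4*g"
      proof -
        have "h^2 = 1/4 + g + g^2" unfolding h_def by (simp add: power2_eq_square field_simps)
        then show ?thesis using alb zero_le_power2[of g] by linarith
      qed
      moreover have "1 + B \<le> 20/9 - 18/17*g"
      proof -
        have "18/17*e*(t+3/20) \<le> 18/17*(1/18)*(t+3/20)" using F(4) t0 by (intro mult_right_mono) auto
        then show ?thesis using B2 pX1 unfolding t_def by simp
      qed
      ultimately have "(1+B)*(1+g-al) \<le> (20/9 - 18/17*g)*(15/16 + 3/4*g)"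
      proof (intro mult_mono)
        show "0 \<le> 20/9 - 18/17*g" using g12 by simp
        have "al \<le> 1 - c" using al G by simp
        then show "0 \<le> 1 + g - al" using c0 g0 by simp
      qed
      also have "\<dots> \<le> 23/10"
      proof -
        have "23/10 - (20/9 - 18/17*g)*(15/16 + 3/4*g) = 27/34*(g - 21/50)^2 + (19529/255000 + (-71/10200)*g)"
          by algebra
        then show ?thesis using zero_le_power2[of "g - 21/50"] g12 by linarith
      qed
      also have "\<dots> \<le> 2*la*(A - k^2/t)"
      proof -
        have kt: "k^2*la/t \<le> g"
        proof -
          have "k^2*1 \<le> k^2*(3-2*la)" using la by (intro mult_left_mono) auto
          then have "k^2 \<le> (1-c)*c*la" using l3 by linarith
          moreover have "(1-c)*c*la \<le> (1-c)*c" using la G0 c0 by (simp add: mult_left_le)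
          moreover have "g*t - (1-c)*c = g*z*(t-g) + (g*z)^2" unfolding c t_def by algebra
          moreover have "g*z*(t-g) + (g*z)^2 \<ge> 0" using g0 z g12 unfolding t_def by simp
          ultimately have "k^2 \<le> g*t" by linarith
          moreover have "k^2*la \<le> k^2" using la by (simp add: mult_left_le)
          ultimately show ?thesis using t0 by (simp add: field_simps)
        qed
        have "(g+3/20)*e \<le> (13/20)*(1/18)" using g12 g0 e F(4) by (intro mult_mono) auto
        then have "1 + g + 3/20 \<le> la*A" using laA F(4) lae by linarith
        then have "23/10 \<le> 2*(la*A) - 2*(k^2*la/t)" using kt by linarith
        also have "\<dots> = 2*la*(A - k^2/t)" by (simp add: right_diff_distrib)
        finally show ?thesis .
      qed
      finally show ?thesis .
    qed
    show "0 \<le> X1" by (rule X10)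
    show "0 < t" "0 < g" "0 < k" using t0 g0 k0 by auto
    show "2*n + p*k^2/(2*g^2) + (1-p)*k^2/(2*g+w) \<le> la*t/2"
    proof -
      have H0: "H > 0" unfolding H_def using k0 la by simp
      have S0: "2*g+w > 0" using g0 F(5) by simp
      have 1: "(1-p)/(2*g+w) + p/(2*g^2) \<le> 1/(1-c) - 2*(c+p*c)/H"
      proof -
        have e1: "(1-g)/c = 1-p" using ct c0 unfolding t_def by (simp add: field_simps)
        have e2: "z/(2*c) = g*(p/(2*g^2))" unfolding z_def using g0 c0 by (simp add: power2_eq_square)
        have e3: "1/(1-z) = g*(1/(1-c))" unfolding Gz using g0 z by simp
        have "g*((1-p)/(2*g+w)) \<le> g*(1/(1-c)) - g*(p/(2*g^2)) - g*(2*(c+p*c)/H)"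
          using F(6) unfolding e1 e2 e3 gz by (simp add: mult.commute mult.left_commute)
        then have "g*((1-p)/(2*g+w)) \<le> g*(1/(1-c) - p/(2*g^2) - 2*(c+p*c)/H)" by (simp add: algebra_simps)
        then have "(1-p)/(2*g+w) \<le> 1/(1-c) - p/(2*g^2) - 2*(c+p*c)/H" using g0 mult_le_cancel_left_pos by blast
        then show ?thesis by linarith
      qed
      have kH: "k^2 \<le> la*(H/4)"
      proof -
        have "k^2*1 \<le> k^2*(3-2*la)" using la by (intro mult_left_mono) auto
        then show ?thesis unfolding H_def using la by simp
      qed
      have "k^2*((1-p)/(2*g+w) + p/(2*g^2)) \<le> la*(H/4)*(1/(1-c) - 2*(c+p*c)/H)"
        using kH 1 S0 p g0 la H0 by (intro mult_mono) (auto intro!: add_nonneg_nonneg)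
      also have "\<dots> = la*(H/4)/(1-c) - la*(H/4)*(2*(c+p*c)/H)" by (simp add: right_diff_distrib)
      also have "la*(H/4)*(2*(c+p*c)/H) = la*(c+p*c)/2" using H0 by simp
      also have "la*(H/4)/(1-c) = k^2*(3-2*la)/(1-c)" unfolding H_def using la by simp
      also have "\<dots> \<le> la*c - 2*n" using l2 G0 by (simp add: field_simps)
      finally have "2*n + k^2*((1-p)/(2*g+w) + p/(2*g^2)) \<le> la*(c - (c+p*c)/2)" by (simp add: algebra_simps)
      also have "c - (c+p*c)/2 = t/2" unfolding ct[symmetric] by (simp add: field_simps)
      finally show ?thesis by (simp add: algebra_simps)
    qed
  qed
qed

section \<open>Contraction under weak monotonicity\<close>

text \<open>
  Outcome \<open>w = xp\<close>: the term \<open>t / 2 e'\<^sup>2\<close> is absorbed by the Bregman distance to \<open>xp\<close>, and Young's weight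
  \<open>g / 2 + w / 4\<close> exceeds what the Bregman distance to \<open>x\<close> absorbs by \<open>w / 4\<close>, which the triangle
  inequality and the reserve \<open>3/10\<close> cover.
\<close>
lemma keep_coin_bound:
  fixes g w la t Dy D dyx dyp x y e e' coef :: real
  assumes g: "0 \<le> g" and t: "0 \<le> t" and la: "0 \<le> la" "la \<le> 1" and w: "0 \<le> w" "w \<le> 3/10"
    and xy: "x\<^sup>2 \<le> 2 * D" "y\<^sup>2 \<le> 2 * Dy" and e: "0 \<le> e" "e \<le> y + x" "e\<^sup>2 \<le> 2 * dyx" "e'\<^sup>2 \<le> 2 * dyp"
    and coef: "coef + (g + w / 2) * (1 - la) \<le> - 3 / 10"
  shows "coef * Dy - g * dyx - t * dyp + (g / 2 + w / 4) * (la * e\<^sup>2 + (1 - la) * y\<^sup>2) + t / 2 * e'\<^sup>2 \<le> w * D"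
proof -
  have Dy: "0 \<le> Dy" using xy(2) zero_le_power2[of y] by linarith
  have "(g / 2 + w / 4) * (1 - la) * y\<^sup>2 \<le> (g / 2 + w / 4) * (1 - la) * (2 * Dy)"
    using g w la xy by (intro mult_left_mono) auto
  then have 1: "coef * Dy + (g / 2 + w / 4) * (1 - la) * y\<^sup>2 \<le> (coef + (g + w / 2) * (1 - la)) * Dy"
    by (simp add: field_simps)
  have 2: "(coef + (g + w / 2) * (1 - la)) * Dy \<le> - 3 / 10 * Dy" using coef Dy by (rule mult_right_mono)
  have 3: "(g / 2 + w / 4) * la * e\<^sup>2 \<le> (g / 2 + w / 4) * 1 * e\<^sup>2"
    using g w la by (intro mult_right_mono mult_left_mono) auto
  have 4: "g * (e\<^sup>2 / 2) \<le> g * dyx" "t * (e'\<^sup>2 / 2) \<le> t * dyp" using g t e by (intro mult_left_mono; simp)+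
  have "e\<^sup>2 \<le> (y + x)\<^sup>2" using e by (intro power_mono) auto
  also have "\<dots> \<le> 2 * x\<^sup>2 + 2 * y\<^sup>2" using sum_squares_bound[of y x] by (simp add: power2_sum)
  also have "\<dots> \<le> 4 * (D + Dy)" using xy by simp
  finally have "w / 4 * e\<^sup>2 \<le> w / 4 * (4 * (D + Dy))" using w by (intro mult_left_mono) auto
  then have 5: "w / 4 * e\<^sup>2 \<le> w * D + w * Dy" by (simp add: algebra_simps)
  have 6: "w * Dy \<le> 3/10 * Dy" using w Dy by (intro mult_right_mono) auto
  have "coef * Dy - g * dyx - t * dyp + (g / 2 + w / 4) * (la * e\<^sup>2 + (1 - la) * y\<^sup>2) + t / 2 * e'\<^sup>2
      = (coef * Dy + (g / 2 + w / 4) * (1 - la) * y\<^sup>2) + (g / 2 + w / 4) * la * e\<^sup>2 - g * dyx - (t * dyp - t * (e'\<^sup>2 / 2))"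
    by (simp add: field_simps)
  also have "\<dots> \<le> - 3 / 10 * Dy + (g / 2 + w / 4) * 1 * e\<^sup>2 - g * (e\<^sup>2 / 2)" using 1 2 3 4 by linarith
  also have "\<dots> = - 3 / 10 * Dy + w / 4 * e\<^sup>2" by (simp add: algebra_simps)
  finally show ?thesis using 5 6 by linarith
qed

text \<open>
  Outcome \<open>w = x\<close>: after Young's inequality with weight \<open>g\<^sup>2 / 2\<close> a multiple \<open>t\<^sup>2 / 2\<close> of \<open>e\<^sup>2\<close> is left over.
  By the triangle inequality it is a concave quadratic in the distance \<open>y\<close>, together with the reserve and
  the Bregman distance to \<open>xp\<close>; its maximum over \<open>y\<close> gives \<open>X1\<close> and \<open>X2\<close>.
\<close>
lemma refresh_coin_bound:
  fixes g la Dy D Dp dyx dyp x xp y e e' coef :: real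
  assumes g: "0 < g" "g < 1" and la: "0 \<le> la" "la \<le> 1"
    and xy: "x\<^sup>2 \<le> 2 * D" "xp\<^sup>2 \<le> 2 * Dp" "y\<^sup>2 \<le> 2 * Dy"
    and e: "0 \<le> e" "e \<le> y + x" "\<bar>y - xp\<bar> \<le> e'" "e\<^sup>2 \<le> 2 * dyx" "e'\<^sup>2 \<le> 2 * dyp"
    and coef: "coef + g\<^sup>2 * (1 - la) \<le> - 3 / 10"
    and t: "t = 1 - g" and zz: "zz = 3/10 + g * t"
    and X: "X1 = t\<^sup>2 * (1 + t) / zz - t" "X2 = t^3 * (1 + t) / zz + t\<^sup>2" "0 \<le> X1"
  shows "coef * Dy - g * dyx - t * dyp + g\<^sup>2 / 2 * (la * e\<^sup>2 + (1 - la) * y\<^sup>2) + t / 2 * e\<^sup>2 \<le> X2 * D + X1 * Dp"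
proof -
  have t0: "0 < t" using g t by simp
  have zz0: "0 < zz" using zz g t0 by (simp add: add_pos_pos)
  have X20: "0 \<le> X2" using X t0 zz0 by simp
  have Dy: "0 \<le> Dy" using xy(3) zero_le_power2[of y] by linarith
  have "g\<^sup>2 / 2 * (1 - la) * y\<^sup>2 \<le> g\<^sup>2 / 2 * (1 - la) * (2 * Dy)"
    using g la xy by (intro mult_left_mono) auto
  then have 1: "coef * Dy + g\<^sup>2 / 2 * (1 - la) * y\<^sup>2 \<le> (coef + g\<^sup>2 * (1 - la)) * Dy" by (simp add: field_simps)
  have 2: "(coef + g\<^sup>2 * (1 - la)) * Dy \<le> - 3 / 10 * Dy" using coef Dy by (rule mult_right_mono)
  have 3: "g\<^sup>2 / 2 * la * e\<^sup>2 \<le> g\<^sup>2 / 2 * 1 * e\<^sup>2" using g la by (intro mult_right_mono mult_left_mono) auto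
  have 4: "g * (e\<^sup>2 / 2) \<le> g * dyx" "t * (e'\<^sup>2 / 2) \<le> t * dyp" using g t0 e by (intro mult_left_mono; simp)+
  have "e\<^sup>2 \<le> (y + x)\<^sup>2" using e by (intro power_mono) auto
  then have 5: "t\<^sup>2 / 2 * e\<^sup>2 \<le> t\<^sup>2 / 2 * (y + x)\<^sup>2" by (intro mult_left_mono) auto
  have "\<bar>y - xp\<bar>\<^sup>2 \<le> e'\<^sup>2" using e by (intro power_mono) auto
  then have 6: "t * ((y - xp)\<^sup>2 / 2) \<le> t * (e'\<^sup>2 / 2)" using t0 by (intro mult_left_mono) auto
  have 7: "t\<^sup>2 / 2 * (y + x)\<^sup>2 - t * ((y - xp)\<^sup>2 / 2) - 3/10 * (y\<^sup>2 / 2) \<le> X2 * (x\<^sup>2 / 2) + X1 * (xp\<^sup>2 / 2)"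
  proof -
    have "(t * x + xp)\<^sup>2 + t * (x - xp)\<^sup>2 = (1 + t) * (t * x\<^sup>2 + xp\<^sup>2)" by (simp add: power2_eq_square algebra_simps)
    then have "(t * x + xp)\<^sup>2 \<le> (1 + t) * (t * x\<^sup>2 + xp\<^sup>2)" using t0 zero_le_power2[of "x - xp"] by (smt (verit) mult_nonneg_nonneg)
    then have "t\<^sup>2 / (2 * zz) * (t * x + xp)\<^sup>2 \<le> t\<^sup>2 / (2 * zz) * ((1 + t) * (t * x\<^sup>2 + xp\<^sup>2))"
      using zz0 by (intro mult_left_mono) auto
    moreover have "y * (t * (t * x + xp)) - zz / 2 * y\<^sup>2 \<le> t\<^sup>2 / (2 * zz) * (t * x + xp)\<^sup>2"
    proof -
      have "0 \<le> (zz * y - t * (t * x + xp))\<^sup>2 / (2 * zz)" using zz0 by simp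
      also have "\<dots> = zz / 2 * y\<^sup>2 - y * (t * (t * x + xp)) + t\<^sup>2 / (2 * zz) * (t * x + xp)\<^sup>2"
        using zz0 by (simp add: power2_eq_square field_simps)
      finally show ?thesis by simp
    qed
    moreover have "t\<^sup>2 / (2 * zz) * ((1 + t) * (t * x\<^sup>2 + xp\<^sup>2)) + t\<^sup>2 / 2 * x\<^sup>2 - t / 2 * xp\<^sup>2 = X2 * (x\<^sup>2 / 2) + X1 * (xp\<^sup>2 / 2)"
      unfolding X using zz0 by (simp add: power2_eq_square power3_eq_cube field_simps)
    moreover have "t\<^sup>2 / 2 * (y + x)\<^sup>2 - t * ((y - xp)\<^sup>2 / 2) - 3/10 * (y\<^sup>2 / 2)
        = (y * (t * (t * x + xp)) - zz / 2 * y\<^sup>2) + t\<^sup>2 / 2 * x\<^sup>2 - t / 2 * xp\<^sup>2"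
      unfolding zz t by (simp add: power2_eq_square field_simps)
    ultimately show ?thesis by linarith
  qed
  have 8: "X2 * (x\<^sup>2 / 2) \<le> X2 * D" "X1 * (xp\<^sup>2 / 2) \<le> X1 * Dp" using X20 X xy by (intro mult_left_mono; simp)+
  have "coef * Dy - g * dyx - t * dyp + g\<^sup>2 / 2 * (la * e\<^sup>2 + (1 - la) * y\<^sup>2) + t / 2 * e\<^sup>2
      = (coef * Dy + g\<^sup>2 / 2 * (1 - la) * y\<^sup>2) + g\<^sup>2 / 2 * la * e\<^sup>2 - g * dyx - t * dyp + t / 2 * e\<^sup>2"
    by (simp add: field_simps)
  also have "\<dots> \<le> - 3 / 10 * Dy + g\<^sup>2 / 2 * 1 * e\<^sup>2 - g * (e\<^sup>2 / 2) - t * ((y - xp)\<^sup>2 / 2) + t / 2 * e\<^sup>2"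
    using 1 2 3 4 6 by linarith
  also have "\<dots> = - 3 / 10 * Dy + t\<^sup>2 / 2 * e\<^sup>2 - t * ((y - xp)\<^sup>2 / 2)"
    unfolding t by (simp add: power2_eq_square field_simps)
  finally show ?thesis using 5 7 8 xy(3) by linarith
qed

context vr_setting begin

text \<open>
  As on the ray, \<open>x' - y = \<lambda> (x' - x) + u\<close>, where now \<open>u\<close> is a convex combination of \<open>x - y\<close> and \<open>x' - y\<close>; the
  parameter \<open>\<kappa>\<close> will depend on the coin.
\<close>
lemma drift_bound:
  assumes x: "x \<in> C" "wp \<in> C" and la: "0 \<le> la" "la \<le> 1" and \<kappa>: "0 < \<kappa>"
  shows "\<alpha> * ((F x - F wp) \<bullet> (x' - y)) \<le> la * (\<alpha> * ((F x - F wp) \<bullet> (x' - x)))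
    + (\<alpha> * L)\<^sup>2 / (4 * \<kappa>) * (N (x - wp))\<^sup>2 + \<kappa> * (la * (N (y - x))\<^sup>2 + (1 - la) * (N (x' - y))\<^sup>2)"
proof -
  define u where "u = la *\<^sub>R (x - y) + (1 - la) *\<^sub>R (x' - y)"
  define k where "k = \<alpha> * L * N (x - wp)"
  have "N u \<le> la * N (y - x) + (1 - la) * N (x' - y)"
    using is_norm_triangle[OF norm, of "la *\<^sub>R (x - y)" "(1 - la) *\<^sub>R (x' - y)"] la
    unfolding u_def is_norm_scaleR[OF norm] is_norm_commute[OF norm, of y x] by simp
  then have "(N u)\<^sup>2 \<le> (la * N (y - x) + (1 - la) * N (x' - y))\<^sup>2"
    using is_norm_nonneg[OF norm] by (intro power_mono) auto
  also have "\<dots> + la * (1 - la) * (N (y - x) - N (x' - y))\<^sup>2 = la * (N (y - x))\<^sup>2 + (1 - la) * (N (x' - y))\<^sup>2"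
    by (simp add: power2_eq_square algebra_simps)
  then have "(la * N (y - x) + (1 - la) * N (x' - y))\<^sup>2 \<le> la * (N (y - x))\<^sup>2 + (1 - la) * (N (x' - y))\<^sup>2"
    using la mult_nonneg_nonneg[of "la * (1 - la)" "(N (y - x) - N (x' - y))\<^sup>2"]
    by (metis add_le_same_cancel1 diff_ge_0_iff_ge le_add_same_cancel1 mult_nonneg_nonneg zero_le_power2)
  finally have Nu: "\<kappa> * (N u)\<^sup>2 \<le> \<kappa> * (la * (N (y - x))\<^sup>2 + (1 - la) * (N (x' - y))\<^sup>2)"
    using \<kappa> by (intro mult_left_mono) auto
  have "\<alpha> * ((F x - F wp) \<bullet> u) \<le> \<alpha> * (L * N (x - wp) * N u)"
    using \<alpha> by (intro mult_left_mono A4_C C_D x) auto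
  also have "\<dots> = k * N u" by (simp add: k_def)
  also have "\<dots> \<le> k\<^sup>2 / (4 * \<kappa>) + \<kappa> * (N u)\<^sup>2"
  proof -
    have "0 \<le> (k - 2 * \<kappa> * N u)\<^sup>2 / (4 * \<kappa>)" using \<kappa> by simp
    also have "\<dots> = k\<^sup>2 / (4 * \<kappa>) + \<kappa> * (N u)\<^sup>2 - k * N u" using \<kappa> by (simp add: power2_eq_square field_simps)
    finally show ?thesis by simp
  qed
  finally have "\<alpha> * ((F x - F wp) \<bullet> u) \<le> k\<^sup>2 / (4 * \<kappa>) + \<kappa> * (la * (N (y - x))\<^sup>2 + (1 - la) * (N (x' - y))\<^sup>2)"
    using Nu by linarith
  moreover have xy: "x' - y = la *\<^sub>R (x' - x) + u" unfolding u_def by (simp add: algebra_simps)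
  have "\<alpha> * ((F x - F wp) \<bullet> (x' - y)) = la * (\<alpha> * ((F x - F wp) \<bullet> (x' - x))) + \<alpha> * ((F x - F wp) \<bullet> u)"
    unfolding xy inner_add_right inner_scaleR_right by (simp add: distrib_left)
  ultimately show ?thesis unfolding k_def by (simp add: power_mult_distrib)
qed

text \<open>
  The noise bound with the factor 2 and two different Young weights, \<open>\<gamma>\<^sup>2 / 2\<close> when \<open>w = x\<close> and \<open>\<gamma> / 2 + w / 4\<close>
  when \<open>w = xp\<close>, fit into \<open>R = t / 2\<close>.
\<close>
lemma bregman_regime_bound:
  assumes L\<beta>: "\<beta> \<le> 2 * L" and la: "0 < la" "la < 1" and al: "\<alpha> \<le> (\<gamma> - p) / (1 - p)"
    and la1: "2 * (\<alpha>\<^sup>2 * Lbar\<^sup>2 / real b) + \<alpha> * L\<^sup>2 * (3 - 2 * la) \<le> la * ((1 - \<gamma>) / (1 - p))"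
    and la2: "1 + \<gamma> + \<alpha> / 2 \<le> la * (1 / 2 + \<alpha> * \<beta> + \<alpha> / 2)"
  shows "expect (precoin_law s) (\<lambda>(x, xp, wp). (N (x' - x))\<^sup>2) \<le> la ^ s * (4 * D x' x0 / (1 + \<gamma> - \<alpha>))"
proof -
  define n where "n = \<alpha>\<^sup>2 * Lbar\<^sup>2 / real b"
  define k where "k = \<alpha> * L"
  define a where "a = \<alpha> * \<beta>"
  have n0: "0 \<le> n" and k0: "0 \<le> k" and a2k: "a \<le> 2 * k"
    using \<alpha> A4(1) mult_left_mono[OF L\<beta>, of \<alpha>] by (simp_all add: n_def k_def a_def)
  have kc: "k\<^sup>2 * (3 - 2 * la) \<le> \<alpha> * (la * ((1 - \<gamma>) / (1 - p)) - 2 * n)"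
  proof -
    have "\<alpha> * (\<alpha> * L\<^sup>2 * (3 - 2 * la)) \<le> \<alpha> * (la * ((1 - \<gamma>) / (1 - p)) - 2 * n)"
      using la1 \<alpha> unfolding n_def by (intro mult_left_mono) auto
    then show ?thesis by (simp add: k_def power2_eq_square mult_ac)
  qed
  define t where "t = 1 - \<gamma>"
  define zz where "zz = 3/10 + \<gamma> * t"
  define X1 X2 where "X1 = t\<^sup>2 * (1 + t) / zz - t" and "X2 = t^3 * (1 + t) / zz + t\<^sup>2"
  obtain A B w where cs: "0 \<le> w" "w \<le> 3/10" "0 \<le> B" "A \<le> 1 + a"
    "2 * n + p * k\<^sup>2 / (2 * \<gamma>\<^sup>2) + (1 - p) * k\<^sup>2 / (2 * \<gamma> + w) \<le> la * t / 2"
    "A - 1 - a + \<gamma>\<^sup>2 * (1 - la) \<le> - 3 / 10" "A - 1 - a + (\<gamma> + w / 2) * (1 - la) \<le> - 3 / 10"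
    "t + p * X1 \<le> la * B" "\<gamma> + B + (1 - p) * w + p * X2 \<le> la * A"
    "(1 + B) * (1 + \<gamma> - \<alpha>) \<le> 2 * la * (A - k\<^sup>2 / t)" "0 \<le> X1" "0 < t" "0 < \<gamma>"
    using bregman_constants[OF p \<gamma> \<alpha>(1) al la n0 k0 kc la2[folded a_def] a2k]
    unfolding X1_def X2_def zz_def t_def by metis
  define \<mu> where "\<mu> = 1 + \<gamma> - \<alpha>"
  have "(\<gamma> - p) / (1 - p) < 1" using p \<gamma> by simp
  then have "\<alpha> < 1" using al by linarith
  then have \<mu>: "0 < \<mu>" "\<mu> \<le> 2" using cs(13) \<gamma> \<alpha> unfolding \<mu>_def by linarith+
  define \<kappa> where "\<kappa> = (A - k\<^sup>2 / t) / 2"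
  have "0 < (1 + B) * \<mu>" using \<mu> cs by (intro mult_pos_pos) auto
  then have "0 < la * (A - k\<^sup>2 / t)" using cs(10) unfolding \<mu>_def by (simp add: mult.assoc)
  then have \<kappa>: "0 < \<kappa>" using la by (simp add: zero_less_mult_iff \<kappa>_def)
  define T where "T x wp = \<alpha> * ((F x - F wp) \<bullet> (x' - x))" for x wp
  define V where "V = (\<lambda>(x, xp, wp). A * D x' x + B * D x' xp + T x wp + t / 2 * (N (x - wp))\<^sup>2)"
  have sq: "(N (x' - z))\<^sup>2 \<le> 2 * D x' z" if "z \<in> C" for z by (rule strongD[OF x'_G that])
  have coin: "V (next_pt x xp v wp bt, x, v)
      \<le> (A - 1 - a) * D x' (next_pt x xp v wp bt) + (B + \<gamma>) * D x' x + t * D x' xp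
        - \<gamma> * D (next_pt x xp v wp bt) x - t * D (next_pt x xp v wp bt) xp
        + \<alpha> * ((F x - F wp) \<bullet> (x' - next_pt x xp v wp bt))
        + t / 2 * (N (next_pt x xp v wp bt - v))\<^sup>2 + noise x xp v wp bt"
    if rc: "reachable x xp wp" and v: "v \<in> {x, xp}" and bt: "bt \<in> set_pmf (batch x wp)" for x xp v wp bt
    using coin_step(2)[OF rc v bt] unfolding V_def T_def t_def a_def by (simp add: algebra_simps)
  define Z where "Z = p * k\<^sup>2 / (2 * \<gamma>\<^sup>2) + (1 - p) * k\<^sup>2 / (2 * \<gamma> + w)"
  have Z: "2 * n + Z \<le> la * t / 2" using cs(5) by (simp add: Z_def)
  define W where "W x xp wp = (\<gamma> + B + (1 - p) * w + p * X2) * D x' x + (t + p * X1) * D x' xp + la * T x wp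
      + Z * (N (x - wp))\<^sup>2" for x xp wp
  have step: "expect (precoin_step (x, xp, wp)) V \<le> W x xp wp + 2 * n * (N (x - wp))\<^sup>2" if rc: "reachable x xp wp" for x xp wp
  proof (rule expect_step_le[OF rc])
    have xC: "x \<in> C" "xp \<in> C" "wp \<in> C" using rc by (auto simp: reachable_def)
    show "expect (batch x wp) (noise x xp v wp) \<le> 2 * n * (N (x - wp))\<^sup>2" if "v \<in> {x, xp}" for v
      using noise_bound_norm[OF rc that] unfolding n_def by simp
    fix bt assume bt: "bt \<in> set_pmf (batch x wp)"
    define y1 y0 where "y1 = next_pt x xp x wp bt" and "y0 = next_pt x xp xp wp bt"
    have yC: "y1 \<in> C" "y0 \<in> C" using coin_step(1)[OF rc _ bt] by (simp_all add: y1_def y0_def)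
    define cst where "cst = (\<gamma> + B) * D x' x + t * D x' xp + la * T x wp"
    have tri: "N (y - x) \<le> N (x' - y) + N (x' - x)" for y
      using is_norm_triangle[OF norm, of "y - x'" "x' - x"] unfolding is_norm_commute[OF norm, of y x'] by simp
    have tri': "\<bar>N (x' - y) - N (x' - xp)\<bar> \<le> N (y - xp)" for y
      using is_norm_triangle[OF norm, of "x' - y" "y - xp"] is_norm_triangle[OF norm, of "x' - xp" "xp - y"]
      unfolding is_norm_commute[OF norm, of xp y] by (simp add: abs_le_iff)
    have D2: "(N (y - z))\<^sup>2 \<le> 2 * D y z" if "y \<in> C" "z \<in> C" for y z by (rule strongD[OF C_D(1)[OF that(1)] that(2)])
    have v1: "V (y1, x, x) \<le> cst + (X2 * D x' x + X1 * D x' xp + k\<^sup>2 / (2 * \<gamma>\<^sup>2) * (N (x - wp))\<^sup>2) + noise x xp x wp bt"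
    proof -
      have "\<alpha> * ((F x - F wp) \<bullet> (x' - y1)) \<le> la * T x wp + k\<^sup>2 / (4 * (\<gamma>\<^sup>2 / 2)) * (N (x - wp))\<^sup>2
          + \<gamma>\<^sup>2 / 2 * (la * (N (y1 - x))\<^sup>2 + (1 - la) * (N (x' - y1))\<^sup>2)"
        unfolding T_def k_def using la cs(13) by (intro drift_bound xC) auto
      moreover have "(A - 1 - a) * D x' y1 - \<gamma> * D y1 x - t * D y1 xp
          + \<gamma>\<^sup>2 / 2 * (la * (N (y1 - x))\<^sup>2 + (1 - la) * (N (x' - y1))\<^sup>2) + t / 2 * (N (y1 - x))\<^sup>2
          \<le> X2 * D x' x + X1 * D x' xp"
        using \<gamma> la cs(13) is_norm_nonneg[OF norm]
        by (intro refresh_coin_bound[OF _ _ _ _ sq[OF xC(1)] sq[OF xC(2)] sq[OF yC(1)] _ tri tri' D2[OF yC(1) xC(1)] D2[OF yC(1) xC(2)]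
           cs(6) t_def zz_def X1_def X2_def cs(11)]) auto
      ultimately show ?thesis using coin[OF rc _ bt, of x] unfolding y1_def[symmetric] cst_def by (simp add: algebra_simps)
    qed
    have v0: "V (y0, x, xp) \<le> cst + (w * D x' x + k\<^sup>2 / (2 * \<gamma> + w) * (N (x - wp))\<^sup>2) + noise x xp xp wp bt"
    proof -
      have "\<alpha> * ((F x - F wp) \<bullet> (x' - y0)) \<le> la * T x wp + k\<^sup>2 / (4 * (\<gamma> / 2 + w / 4)) * (N (x - wp))\<^sup>2
          + (\<gamma> / 2 + w / 4) * (la * (N (y0 - x))\<^sup>2 + (1 - la) * (N (x' - y0))\<^sup>2)"
        unfolding T_def k_def using la cs(1,13) by (intro drift_bound xC) auto
      moreover have "4 * (\<gamma> / 2 + w / 4) = 2 * \<gamma> + w" by simp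
      moreover have "(A - 1 - a) * D x' y0 - \<gamma> * D y0 x - t * D y0 xp
          + (\<gamma> / 2 + w / 4) * (la * (N (y0 - x))\<^sup>2 + (1 - la) * (N (x' - y0))\<^sup>2) + t / 2 * (N (y0 - xp))\<^sup>2
          \<le> w * D x' x"
        using la cs(12,13) is_norm_nonneg[OF norm]
        by (intro keep_coin_bound[OF _ _ _ _ cs(1,2) sq[OF xC(1)] sq[OF yC(2)] _ tri D2[OF yC(2) xC(1)] D2[OF yC(2) xC(2)] cs(7)]) auto
      ultimately show ?thesis using coin[OF rc _ bt, of xp] unfolding y0_def[symmetric] cst_def by (simp add: algebra_simps)
    qed
    have "p * (X2 * D x' x + X1 * D x' xp + k\<^sup>2 / (2 * \<gamma>\<^sup>2) * (N (x - wp))\<^sup>2) + (1 - p) * (w * D x' x + k\<^sup>2 / (2 * \<gamma> + w) * (N (x - wp))\<^sup>2)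
        \<le> (p * X2 + (1 - p) * w) * D x' x + p * X1 * D x' xp + Z * (N (x - wp))\<^sup>2"
      unfolding Z_def by (simp add: algebra_simps add_divide_distrib diff_divide_distrib)
    from coin_average_le[OF v1 v0 this] p
    show "p * V (next_pt x xp x wp bt, x, x) + (1 - p) * V (next_pt x xp xp wp bt, x, xp)
        \<le> W x xp wp + (p * noise x xp x wp bt + (1 - p) * noise x xp xp wp bt)"
      unfolding W_def cst_def y1_def y0_def by (simp add: algebra_simps)
  qed
  show ?thesis unfolding \<mu>_def[symmetric]
  proof (rule decay[OF la(1) \<mu> \<kappa>, where V = V and ?E1.0 = "(1 + B) * D x' x0 + 0"])
    fix x xp wp assume rc: "reachable x xp wp"
    then have xC: "x \<in> C" "xp \<in> C" "wp \<in> C" by (auto simp: reachable_def)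
    have Dn: "0 \<le> D x' x" "0 \<le> D x' xp" using D_nonneg[OF x'_G] xC by auto
    have "(\<gamma> + B + (1 - p) * w + p * X2) * D x' x \<le> la * A * D x' x" "(t + p * X1) * D x' xp \<le> la * B * D x' xp"
      "(2 * n + Z) * (N (x - wp))\<^sup>2 \<le> la * t / 2 * (N (x - wp))\<^sup>2"
      by (intro mult_right_mono cs Dn Z; simp)+
    then have "W x xp wp + 2 * n * (N (x - wp))\<^sup>2 \<le> la * V (x, xp, wp)"
      unfolding W_def V_def by (simp add: algebra_simps)
    with step[OF rc] show "expect (precoin_step (x, xp, wp)) V \<le> la * V (x, xp, wp)" by linarith
    define u where "u = N (x - wp)"
    define r where "r = N (x' - x)"
    have "- T x wp = \<alpha> * ((F wp - F x) \<bullet> (x' - x))" by (simp add: T_def inner_diff_left algebra_simps)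
    also have "\<dots> \<le> \<alpha> * (L * N (wp - x) * N (x' - x))" using \<alpha> by (intro mult_left_mono A4_C C_D xC) auto
    also have "\<dots> = k * (u * r)" unfolding u_def r_def k_def is_norm_commute[OF norm, of wp x] by simp
    also have "\<dots> \<le> t / 2 * u\<^sup>2 + k\<^sup>2 / t / 2 * r\<^sup>2"
    proof -
      have "0 \<le> (t * u - k * r)\<^sup>2 / (2 * t)" using cs(12) by simp
      also have "\<dots> = t / 2 * u\<^sup>2 + k\<^sup>2 / t / 2 * r\<^sup>2 - k * (u * r)" using cs(12) by (simp add: power2_eq_square field_simps)
      finally show ?thesis by simp
    qed
    finally have T: "- T x wp \<le> t / 2 * u\<^sup>2 + k\<^sup>2 / t / 2 * r\<^sup>2" .
    have "0 \<le> B * D x' xp" using cs(3) Dn by simp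
    moreover have "A * (r\<^sup>2 / 2) \<le> A * D x' x"
    proof (rule mult_left_mono)
      show "r\<^sup>2 / 2 \<le> D x' x" using sq[OF xC(1)] by (simp add: r_def)
      have "0 \<le> k\<^sup>2 / t" using cs(12) by simp
      then show "0 \<le> A" using \<kappa> unfolding \<kappa>_def by simp
    qed
    ultimately have "A * (r\<^sup>2 / 2) - k\<^sup>2 / t / 2 * r\<^sup>2 \<le> V (x, xp, wp)"
      using T unfolding V_def u_def by simp
    then show "\<kappa> * (N (x' - x))\<^sup>2 \<le> V (x, xp, wp)" unfolding \<kappa>_def r_def by (simp add: algebra_simps diff_divide_distrib)
  next
    have x0C: "x0 \<in> C" using x0 by (simp add: C_def G_def)
    have rc: "reachable x0 x0 x0" using precoin_law_reachable[of x0 x0 x0 0] by simp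
    show "expect (precoin_step (x0, x0, x0)) V \<le> (1 + B) * D x' x0 + 0"
    proof (rule expect_step_le[OF rc])
      show "expect (batch x0 x0) (noise x0 x0 v x0) \<le> 0" if "v \<in> {x0, x0}" for v
        using noise_bound_norm[OF rc that] is_norm_zero[OF norm] by simp
      fix bt assume bt: "bt \<in> set_pmf (batch x0 x0)"
      define y where "y = next_pt x0 x0 x0 x0 bt"
      have yC: "y \<in> C" using coin_step(1)[OF rc _ bt] by (simp add: y_def)
      have "(A - 1 - a) * D x' y \<le> 0" using cs(4) D_nonneg[OF x'_G yC] by (simp add: mult_nonpos_nonneg)
      moreover have "t / 2 * (N (y - x0))\<^sup>2 \<le> 1 / 2 * (N (y - x0))\<^sup>2"
        using cs(13) by (intro mult_right_mono) (auto simp: t_def)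
      moreover have "(N (y - x0))\<^sup>2 \<le> 2 * D y x0" by (rule strongD[OF C_D(1)[OF yC] x0C])
      moreover have "(B + \<gamma>) * D x' x0 + t * D x' x0 = (1 + B) * D x' x0" "\<gamma> * D y x0 + t * D y x0 = D y x0"
        unfolding t_def by (simp_all add: algebra_simps)
      ultimately have "V (y, x0, x0) \<le> (1 + B) * D x' x0 + noise x0 x0 x0 x0 bt"
        using coin[OF rc _ bt, of x0] unfolding y_def[symmetric] by simp
      then have "V (y, x0, x0) \<le> (1 + B) * D x' x0 + 0 + noise x0 x0 x0 x0 bt" by simp
      from coin_average_le[OF this this, of p 0] p
      show "p * V (next_pt x0 x0 x0 x0 bt, x0, x0) + (1 - p) * V (next_pt x0 x0 x0 x0 bt, x0, x0)
          \<le> (1 + B) * D x' x0 + (p * noise x0 x0 x0 x0 bt + (1 - p) * noise x0 x0 x0 x0 bt)"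
        unfolding y_def by simp
    qed
    have "(1 + B) * \<mu> * D x' x0 \<le> 2 * la * (A - k\<^sup>2 / t) * D x' x0"
      using cs(10) D_nonneg[OF x'_G x0C] unfolding \<mu>_def by (rule mult_right_mono)
    moreover have "4 * (la * \<kappa>) = 2 * la * (A - k\<^sup>2 / t)" by (simp add: \<kappa>_def)
    moreover have "((1 + B) * D x' x0 + 0) * \<mu> = (1 + B) * \<mu> * D x' x0" by simp
    ultimately show "((1 + B) * D x' x0 + 0) * \<mu> \<le> 4 * (la * \<kappa>) * D x' x0" by (simp only:)
  qed
qed

end

section \<open>The convergence rate\<close>

theorem theorem3p6:
  fixes N :: "'a::euclidean_space \<Rightarrow> real"
    and K :: "'a set"
    and g f :: "'a \<Rightarrow> ereal"
    and gradf F :: "'a \<Rightarrow> 'a"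
    and Fi F\<xi> :: "nat \<Rightarrow> 'a \<Rightarrow> 'a"
    and Q :: "'a \<Rightarrow> 'a \<Rightarrow> nat pmf"
    and M b s :: nat
    and L Lbar \<alpha> \<beta> \<gamma> p \<theta> :: real
    and x0 x' :: 'a
  assumes norm: "is_norm N"
    and K: "K \<noteq> {}" "closed K" "convex K"
    and g: "proper_on K g" "ereal_convex_on K g" "lsc_on K g"
    and f: "proper_on K f" "ereal_convex_on K f" "lsc_on K f"
    and dom: "eff_dom K g \<subseteq> eff_dom K f"
    and grad: "has_gradient_map K f gradf"
    and strong: "strongly_convex1 N K f gradf"
    and F_sum: "\<forall>x\<in>eff_dom K g. F x = (1 / real M) *\<^sub>R (\<Sum>i=1..M. Fi i x)"
    and A1: "vi_solutions K g F \<noteq> {}"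
    and A3: "0 < Lbar" "variable_lipschitz_oracle N (eff_dom K g) F M F\<xi> Q Lbar"
    and A4: "0 \<le> L"
      "\<forall>x\<in>eff_dom K g. \<forall>y\<in>eff_dom K g. dual_norm N (F x - F y) \<le> L * N (x - y)"
    and A7: "0 < \<beta>"
      "\<forall>x\<in>eff_dom K f. \<forall>y\<in>dom_subdiff K f.
         ereal (F x \<bullet> (y - x)) + g y - g x \<ge> 0 \<longrightarrow>
         ereal (F y \<bullet> (y - x)) + g y - g x \<ge> ereal (\<beta> * bregman f gradf x y)"
    and b: "1 \<le> b" "b \<le> M"
    and p: "0 < p" "p < 1"
    and \<gamma>: "p < \<gamma>" "\<gamma> < 1"
    and \<alpha>: "0 < \<alpha>" "\<alpha> \<le> (\<gamma> - p) / (1 - p)"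
      "(1/2 + \<gamma>) / \<beta> < \<alpha>"
      "\<alpha> < (sqrt ((real b)\<^sup>2 * L^4 + 8 * real b * Lbar\<^sup>2 * ((1 - \<gamma>) / (1 - p))) - real b * L\<^sup>2)
             / (4 * Lbar\<^sup>2)"
    and x0: "x0 \<in> eff_dom K g" "x0 \<in> dom_subdiff K f"
    and well_defined: "alg_well_defined K g f gradf F F\<xi> Q \<alpha> \<gamma> p b x0"
    and x': "x' \<in> vi_solutions K g F"
    and \<theta>: "1 < \<theta>"
      "\<theta> \<le> Min {(1/2 + \<alpha> * \<beta> + \<alpha>/2) / (1 + \<gamma> + \<alpha>/2),
                ((1 - \<gamma>) / (1 - p) + 2 * \<alpha> * L\<^sup>2) / (2 * \<alpha>\<^sup>2 * Lbar\<^sup>2 / real b + 3 * \<alpha> * L\<^sup>2),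
                1 / (1 - \<gamma>)}"
  shows "measure_pmf.expectation (alg_law K g f gradf F F\<xi> Q \<alpha> \<gamma> p b x0 s)
           (\<lambda>(x, xp, w, wp). N (x' - x))
         \<le> sqrt (4 / ((1 + \<gamma> - \<alpha>) * \<theta> ^ s) * bregman f gradf x' x0)"
proof -
  interpret vr: vr_setting N K g f gradf F F\<xi> Q M b L Lbar \<alpha> \<beta> \<gamma> p x0 x'
    by unfold_locales (use assms in auto)
  define la where "la = 1 / \<theta>"
  have \<theta>0: "0 < \<theta>" using \<theta> by simp
  have la: "0 < la" "la < 1" using \<theta> by (simp_all add: la_def)
  have la\<theta>: "z \<le> la * u" if "\<theta> \<le> u / z" "0 < z" for z u
    using that \<theta>0 by (simp add: la_def pos_le_divide_eq mult.commute)
  have gt: "0 < \<gamma>" using p \<gamma> by simp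
  have b0: "0 < real b" using b by simp
  have den: "0 < 2 * \<alpha>\<^sup>2 * Lbar\<^sup>2 / real b + 3 * \<alpha> * L\<^sup>2"
    using \<alpha>(1) A3(1) b0 by (intro add_pos_nonneg) auto
  have "1 + \<gamma> + \<alpha> / 2 \<le> la * (1 / 2 + \<alpha> * \<beta> + \<alpha> / 2)"
    using \<theta>(2) gt \<alpha>(1) by (intro la\<theta>) auto
  moreover have "2 * \<alpha>\<^sup>2 * Lbar\<^sup>2 / real b + 3 * \<alpha> * L\<^sup>2 \<le> la * ((1 - \<gamma>) / (1 - p) + 2 * \<alpha> * L\<^sup>2)"
    using \<theta>(2) den by (intro la\<theta>) auto
  then have "2 * (\<alpha>\<^sup>2 * Lbar\<^sup>2 / real b) + \<alpha> * L\<^sup>2 * (3 - 2 * la) \<le> la * ((1 - \<gamma>) / (1 - p))"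
    by (simp add: algebra_simps)
  moreover have "1 - \<gamma> \<le> la * 1" using \<theta>(2) \<gamma> by (intro la\<theta>) auto
  ultimately have "measure_pmf.expectation (vr.precoin_law s) (\<lambda>(x, xp, wp). (N (x' - x))\<^sup>2)
      \<le> la ^ s * (4 * bregman f gradf x' x0 / (1 + \<gamma> - \<alpha>))"
    using la \<alpha>(2) vr.ray_regime_bound[of la s] vr.bregman_regime_bound[of la s] by (cases "2 * L < \<beta>") auto
  also have "\<dots> = 4 / ((1 + \<gamma> - \<alpha>) * \<theta> ^ s) * bregman f gradf x' x0"
    by (simp add: la_def power_one_over)
  finally show ?thesis by (rule vr.rate_bound)
qed

end
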